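(* Let $1\le p<\infty$, let $\rho$ be an admissible weight function on $\mathbb{R}$, and let $\mathcal{T}=(T_t)_{t\ge0}$ be the translation semigroup on $L_p^\rho(\mathbb{R})$. The following assertions are equivalent: (1) $\mathcal{T}$ is frequently hypercyclic on $L_p^\rho(\mathbb{R})$. (2) $\sum_{k\in\mathbb{Z}}\rho(k)<\infty$. (3) $\int_{-\infty}^\infty\rho(t)\,dt<\infty$. (4) $\mathcal{T}$ is chaotic on $L_p^\rho(\mathbb{R})$. (5) $\mathcal{T}$ satisfies the Frequent Hypercyclicity Criterion.
   Context: An admissible weight function on $\mathbb{R}$ is a measurable function $\rho:\mathbb{R}\to\,]0,\infty[$ for which there exist $M\ge1$ and $\omega\in\mathbb{R}$ such that $\rho(\tau)\le Me^{\omega t}\rho(\tau+t)$ for all $\tau\in\mathbb{R}$ and $t>0$. $L_p^\rho(\mathbb{R})$ is the Banach space of (classes of a.e. equal) measurable $u:\mathbb{R}\to\mathbb{R}$ with $\|u\|_p^\rho=\left(\int_{\mathbb{R}}|u(t)|^p\rho(t)\,dt\right)^{1/p}<\infty$. The translation semigroup on it is $T_tf(x)=f(x+t)$, $t\ge0$, $x\in\mathbb{R}$; it is a $C_0$-semigroup. Let $(T_t)_{t\ge0}$ be a $C_0$-semigroup on a separable Banach space $X$. The lower density of a measurable $S\subseteq\mathbb{R}_+$ is $\underline{\mathrm{Dens}}(S)=\liminf_{N\to\infty}\mu(S\cap[0,N])/N$, with $\mu$ Lebesgue measure. The semigroup is frequently hypercyclic if there exists $x\in X$ such that $\underline{\mathrm{Dens}}(\{t\in\mathbb{R}_+:T_tx\in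 U\})>0$ for every non-empty open $U\subseteq X$. It is hypercyclic if there exists $x\in X$ with $\{T_tx:t\ge0\}$ dense in $X$. A point $x\in X$ is periodic if $T_tx=x$ for some $t>0$. The semigroup is chaotic if it is hypercyclic and its set of periodic points is dense in $X$. The semigroup satisfies the Frequent Hypercyclicity Criterion (for $C_0$-semigroups) if there exist a dense subset $X_0\subseteq X$ and maps $S_t:X_0\to X_0$, $t>0$, such that: (i) $T_tS_tx=x$ and $T_tS_rx=S_{r-t}x$ for all $x\in X_0$ and $r>t>0$; (ii) $t\mapsto T_tx$ is Pettis integrable on $[0,\infty[$ for all $x\in X_0$; (iii) $t\mapsto S_tx$ is Pettis integrable on $[0,\infty[$ for all $x\in X_0$. *)

theory Defs
  imports "HOL-Analysis.Analysis"
begin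

section \<open>Classes of measurable functions modulo equality almost everywhere\<close>

text \<open>All the spaces \<open>L\<^sub>p\<^sup>\<rho>\<close> live in one common vector space: since \<open>\<rho>\<close> is everywhere positive, the
  null sets of \<open>\<rho>(t) dt\<close> are the Lebesgue null sets, so the notion of class does not depend on
  \<open>p\<close> and \<open>\<rho>\<close>.\<close>

definition ae_eq :: "(real \<Rightarrow> real) \<Rightarrow> (real \<Rightarrow> real) \<Rightarrow> bool" where
  "ae_eq f g \<longleftrightarrow> f \<in> borel_measurable lebesgue \<and> g \<in> borel_measurable lebesgue \<and>
     (AE x in lebesgue. f x = g x)"

lemma part_equivp_ae_eq: "part_equivp ae_eq"
proof (rule part_equivpI)
  show "\<exists>f. ae_eq f f"
    by (rule exI[of _ "\<lambda>_. 0"]) (simp add: ae_eq_def)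
  show "symp ae_eq"
    by (auto simp: symp_def ae_eq_def)
  show "transp ae_eq"
    unfolding transp_def ae_eq_def by (auto elim: eventually_elim2)
qed

quotient_type aefun = "real \<Rightarrow> real" / partial: ae_eq
  by (rule part_equivp_ae_eq)

instantiation aefun :: real_vector
begin

lift_definition zero_aefun :: aefun is "\<lambda>_. 0"
  by (simp add: ae_eq_def)

lift_definition plus_aefun :: "aefun \<Rightarrow> aefun \<Rightarrow> aefun" is "\<lambda>f g x. f x + g x"
  unfolding ae_eq_def by auto

lift_definition minus_aefun :: "aefun \<Rightarrow> aefun \<Rightarrow> aefun" is "\<lambda>f g x. f x - g x"
  unfolding ae_eq_def by auto

lift_definition uminus_aefun :: "aefun \<Rightarrow> aefun" is "\<lambda>f x. - f x"
  unfolding ae_eq_def by auto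

lift_definition scaleR_aefun :: "real \<Rightarrow> aefun \<Rightarrow> aefun" is "\<lambda>c f x. c * f x"
  unfolding ae_eq_def by auto

instance
  by standard (transfer; auto simp: ae_eq_def algebra_simps)+

end

lemma measurable_shift_lebesgue: "(\<lambda>x::real. x + t) \<in> lebesgue \<rightarrow>\<^sub>M lebesgue"
  using lebesgue_affine_measurable[where c = "\<lambda>_::real. 1" and t = t] by (simp add: add.commute)

lemma AE_shift_lebesgue:
  fixes t :: real
  assumes "AE x in lebesgue. P x"
  shows "AE x in lebesgue. P (x + t)"
proof -
  have "negligible {x. \<not> P x}"
    using assms by (simp add: negligible_iff_null_sets AE_iff_null_sets eventually_ae_filter
      flip: completion.AE_iff_null_sets)
       (metis (mono_tags, lifting) completion.complete2 mem_Collect_eq)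
  then have "negligible ((\<lambda>x. - t + x) ` {x. \<not> P x})"
    by (rule negligible_translation)
  moreover have "(\<lambda>x. - t + x) ` {x. \<not> P x} = {x. \<not> P (x + t)}"
    by (auto simp: image_iff algebra_simps intro!: exI[of _ "_ + t"])
  ultimately show ?thesis
    by (simp add: negligible_iff_null_sets AE_I' [of "{x. \<not> P (x + t)}"])
qed

lift_definition translation :: "real \<Rightarrow> aefun \<Rightarrow> aefun" is "\<lambda>t f x. f (x + t)"
proof -
  fix t :: real and f g :: "real \<Rightarrow> real"
  assume "ae_eq f g"
  then show "ae_eq (\<lambda>x. f (x + t)) (\<lambda>x. g (x + t))"
    unfolding ae_eq_def
    using AE_shift_lebesgue[of "\<lambda>x. f x = g x" t] measurable_compose[OF measurable_shift_lebesgue]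
    by blast
qed


section \<open>Weighted \<open>L\<^sub>p\<close> spaces\<close>

definition admissible_weight :: "(real \<Rightarrow> real) \<Rightarrow> bool" where
  "admissible_weight \<rho> \<longleftrightarrow>
     \<rho> \<in> borel_measurable lebesgue \<and> (\<forall>\<tau>. 0 < \<rho> \<tau>) \<and>
     (\<exists>M \<omega>. 1 \<le> M \<and> (\<forall>\<tau>. \<forall>t>0. \<rho> \<tau> \<le> M * exp (\<omega> * t) * \<rho> (\<tau> + t)))"

text \<open>The integral \<open>\<integral> |u|\<^sup>p \<rho>\<close>, possibly infinite.\<close>

lift_definition weighted_integral :: "real \<Rightarrow> (real \<Rightarrow> real) \<Rightarrow> aefun \<Rightarrow> ennreal" is
  "\<lambda>p \<rho> u. \<integral>\<^sup>+ t. ennreal (\<bar>u t\<bar> powr p * \<rho> t) \<partial>lebesgue"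
  unfolding ae_eq_def by (rule nn_integral_cong_AE) auto

definition Lp :: "real \<Rightarrow> (real \<Rightarrow> real) \<Rightarrow> aefun set" where
  "Lp p \<rho> = {u. weighted_integral p \<rho> u < \<infinity>}"

definition Lp_norm :: "real \<Rightarrow> (real \<Rightarrow> real) \<Rightarrow> aefun \<Rightarrow> real" where
  "Lp_norm p \<rho> u = enn2real (weighted_integral p \<rho> u) powr (1 / p)"


section \<open>Dynamics of semigroups on a normed space given by a carrier and a norm\<close>

text \<open>As \<open>L\<^sub>p\<^sup>\<rho>\<close> depends on \<open>p\<close> and \<open>\<rho>\<close> it is not a type. Below, a Banach space is a linear subspace
  \<open>X\<close> of a vector space together with its norm \<open>N\<close> on \<open>X\<close>, and a semigroup is a family
  \<open>T\<close> of maps with \<open>T t ` X \<subseteq> X\<close> for \<open>t \<ge> 0\<close>. The definitions are intended for \<open>C\<^sub>0\<close>-semigroups.\<close>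

definition norm_topology :: "'a::real_vector set \<Rightarrow> ('a \<Rightarrow> real) \<Rightarrow> 'a topology" where
  "norm_topology X N = Metric_space.mtopology X (\<lambda>x y. N (x - y))"

definition dense_subset :: "'a::real_vector set \<Rightarrow> ('a \<Rightarrow> real) \<Rightarrow> 'a set \<Rightarrow> bool" where
  "dense_subset X N A \<longleftrightarrow> A \<subseteq> X \<and> norm_topology X N closure_of A = X"

definition lower_density :: "real set \<Rightarrow> ereal" where
  "lower_density S =
     Liminf at_top (\<lambda>N::real. ereal (measure lebesgue (S \<inter> {0..N}) / N))"

definition frequently_hypercyclic ::
  "'a::real_vector set \<Rightarrow> ('a \<Rightarrow> real) \<Rightarrow> (real \<Rightarrow> 'a \<Rightarrow> 'a) \<Rightarrow> bool" where
  "frequently_hypercyclic X N T \<longleftrightarrow>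
     (\<exists>x\<in>X. \<forall>U. openin (norm_topology X N) U \<and> U \<noteq> {} \<longrightarrow>
        lower_density {t. 0 \<le> t \<and> T t x \<in> U} > 0)"

definition hypercyclic ::
  "'a::real_vector set \<Rightarrow> ('a \<Rightarrow> real) \<Rightarrow> (real \<Rightarrow> 'a \<Rightarrow> 'a) \<Rightarrow> bool" where
  "hypercyclic X N T \<longleftrightarrow> (\<exists>x\<in>X. dense_subset X N {T t x |t. 0 \<le> t})"

definition periodic_points :: "'a set \<Rightarrow> (real \<Rightarrow> 'a \<Rightarrow> 'a) \<Rightarrow> 'a set" where
  "periodic_points X T = {x \<in> X. \<exists>t>0. T t x = x}"

definition chaotic ::
  "'a::real_vector set \<Rightarrow> ('a \<Rightarrow> real) \<Rightarrow> (real \<Rightarrow> 'a \<Rightarrow> 'a) \<Rightarrow> bool" where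
  "chaotic X N T \<longleftrightarrow> hypercyclic X N T \<and> dense_subset X N (periodic_points X T)"

text \<open>Only the values on \<open>X\<close> of a functional matter.\<close>

definition dual_space :: "'a::real_vector set \<Rightarrow> ('a \<Rightarrow> real) \<Rightarrow> ('a \<Rightarrow> real) set" where
  "dual_space X N =
     {\<phi>. (\<forall>x\<in>X. \<forall>y\<in>X. \<phi> (x + y) = \<phi> x + \<phi> y) \<and> (\<forall>c. \<forall>x\<in>X. \<phi> (c *\<^sub>R x) = c * \<phi> x) \<and>
         continuous_map (norm_topology X N) euclideanreal \<phi>}"

definition pettis_integrable ::
  "'a::real_vector set \<Rightarrow> ('a \<Rightarrow> real) \<Rightarrow> 'b measure \<Rightarrow> ('b \<Rightarrow> 'a) \<Rightarrow> bool" where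
  "pettis_integrable X N M f \<longleftrightarrow>
     f \<in> space M \<rightarrow> X \<and>
     (\<forall>\<phi>\<in>dual_space X N. integrable M (\<lambda>t. \<phi> (f t))) \<and>
     (\<forall>E\<in>sets M. \<exists>y\<in>X. \<forall>\<phi>\<in>dual_space X N. \<phi> y = (LINT t:E|M. \<phi> (f t)))"

text \<open>The maps \<open>S t\<close> are only given for \<open>t > 0\<close>; their Pettis integrability on \<open>[0,\<infinity>[\<close> is stated on
  \<open>]0,\<infinity>[\<close>, which differs by a null set.\<close>

definition frequent_hypercyclicity_criterion ::
  "'a::real_vector set \<Rightarrow> ('a \<Rightarrow> real) \<Rightarrow> (real \<Rightarrow> 'a \<Rightarrow> 'a) \<Rightarrow> bool" where
  "frequent_hypercyclicity_criterion X N T \<longleftrightarrow>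
     (\<exists>X0 S. dense_subset X N X0 \<and>
        (\<forall>t>0. S t \<in> X0 \<rightarrow> X0) \<and>
        (\<forall>x\<in>X0. \<forall>t>0. T t (S t x) = x) \<and>
        (\<forall>x\<in>X0. \<forall>t>0. \<forall>r>t. T t (S r x) = S (r - t) x) \<and>
        (\<forall>x\<in>X0. pettis_integrable X N (lebesgue_on {0..}) (\<lambda>t. T t x)) \<and>
        (\<forall>x\<in>X0. pettis_integrable X N (lebesgue_on {0<..}) (\<lambda>t. S t x)))"

end

theory Submission
  imports Defs
begin

text \<open>If some nonzero \<open>y \<in> L\<^sub>p\<^sup>\<rho>\<close> is \<open>\<tau>\<close>-periodic, comparing \<open>\<rho>\<close> with its values on \<open>\<tau>\<int>\<close> gives \<open>\<integral> \<rho> < \<infinity>\<close>. Chaos provides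
  such a \<open>y\<close> at once; under the criterion, the Pettis integral over a \<open>\<tau>\<close>-periodic set \<open>E \<subseteq> \<real>\<close> of the full
  orbit \<open>t \<mapsto> u(\<cdot> + t)\<close>, \<open>u \<in> X\<^sub>0\<close>, is \<open>\<tau>\<close>-periodic, and it is nonzero for suitable \<open>u\<close> and \<open>E\<close>.

  For a frequently hypercyclic \<open>u\<close>, let \<open>A\<close> be the integer parts of the times at which the orbit is close
  to the indicator of \<open>[0,2]\<close>. Then \<open>u\<close> carries mass near every point of \<open>A\<close>, and the norm estimate at time
  \<open>m \<in> A\<close> bounds \<open>\<Sum>\<^sub>n\<^sub>\<in>\<^sub>A \<rho>(n - m)\<close> uniformly in \<open>m\<close>. As \<open>A\<close> has positive lower density, every integer is a
  difference that \<open>A\<close> realises often, up to finitely many shifts, whence \<open>\<Sum>\<^sub>k \<rho>(k) < \<infinity>\<close>.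

  Conversely let \<open>\<integral> \<rho> < \<infinity>\<close>. Continuous functions with compact support are dense; they are approximated by
  their periodic extensions and have Pettis integrable orbits, since \<open>\<integral> \<epsilon>(t) f(\<cdot> + t) dt\<close> is bounded for
  \<open>\<bar>\<epsilon>\<bar> \<le> 1\<close>. A frequently hypercyclic function is put together from translates of a countable dense
  family, the pieces being placed along the ruler sequence and their size being limited by an unbounded
  factor \<open>H\<close> for which \<open>\<integral> H \<rho>\<close> is still finite.\<close>

section \<open>Classes of functions\<close>

text \<open>Admissibility controls \<rho> along right shifts only: \<open>\<rho> x\<close> is at
  most a constant times \<open>\<rho> (x + t)\<close>. So the left end of an interval bounds \<rho>
  on it from below, the right end from above, and translations by negative times need not preserve
  the space. A frequently hypercyclic vector yields bounds on \<rho> only at differences of elements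
  of A, and these may miss many integers; passing to all integers is a combinatorial statement about
  shifts of A. Pettis integrability cannot be replaced by absolute integrability: for p > 1 the
  norms of the translates of a compactly supported function need not be integrable in t. The weak
  version survives because its integrals against any bounded \<epsilon> are bounded functions, and a
  finite weight puts all bounded functions into the space. In the construction the pieces are
  unbounded in size, yet the error at a time of level v has to vanish as v grows. A piece of level r
  has p-th power at most \<open>H r\<close> and stays at distance at least r from the origin at all
  times belonging to other pieces, so its p-th power is bounded by the value of H at |x|, and the
  error is a tail integral of \<open>H * \<rho>\<close>.\<close>

abbreviation cls :: "(real \<Rightarrow> real) \<Rightarrow> aefun" where
  "cls \<equiv> abs_aefun"

abbreviation lmeas :: "(real \<Rightarrow> real) \<Rightarrow> bool" where
  "lmeas f \<equiv> f \<in> borel_measurable lebesgue"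

lemma ae_eq_refl: "lmeas f \<Longrightarrow> ae_eq f f"
  by (simp add: ae_eq_def)

lemma cls_eqI:
  assumes "lmeas f" "lmeas g" "AE x in lebesgue. f x = g x"
  shows "cls f = cls g"
  using assms by (intro Quotient3_rel_abs[OF Quotient3_aefun]) (simp add: ae_eq_def)

lemma cls_eqD:
  assumes "cls f = cls g" "lmeas f" "lmeas g"
  shows "AE x in lebesgue. f x = g x"
  using assms Quotient3_rel[OF Quotient3_aefun, of f g]
  by (auto simp: ae_eq_refl) (simp add: ae_eq_def)

lemma cls_cases:
  obtains f where "lmeas f" "u = cls f"
  using Quotient3_abs_rep[OF Quotient3_aefun, of u] Quotient3_rep_reflp[OF Quotient3_aefun, of u]
  by (metis ae_eq_def)

lemma cls_add: "lmeas f \<Longrightarrow> lmeas g \<Longrightarrow> cls f + cls g = cls (\<lambda>x. f x + g x)"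
  by (simp add: plus_aefun.abs_eq ae_eq_refl)

lemma cls_diff: "lmeas f \<Longrightarrow> lmeas g \<Longrightarrow> cls f - cls g = cls (\<lambda>x. f x - g x)"
  by (simp add: minus_aefun.abs_eq ae_eq_refl)

lemma cls_scaleR: "lmeas f \<Longrightarrow> c *\<^sub>R cls f = cls (\<lambda>x. c * f x)"
  by (simp add: scaleR_aefun.abs_eq ae_eq_refl)

lemma cls_zero: "0 = cls (\<lambda>_. 0)"
  by (simp add: zero_aefun_def)

lemma translation_cls: "lmeas f \<Longrightarrow> translation t (cls f) = cls (\<lambda>x. f (x + t))"
  by (simp add: translation.abs_eq ae_eq_refl)

lemma cls_sum:
  assumes "finite I" "\<And>i. i \<in> I \<Longrightarrow> lmeas (f i)"
  shows "(\<Sum>i\<in>I. cls (f i)) = cls (\<lambda>x. \<Sum>i\<in>I. f i x)"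
  using assms by (induction I rule: finite_induct) (auto simp: cls_zero cls_add)

lemma lmeas_shift: "f \<in> borel_measurable lebesgue \<Longrightarrow> (\<lambda>x::real. f (x + t)) \<in> borel_measurable lebesgue"
  using measurable_compose[OF measurable_shift_lebesgue] by blast

lemma lmeas_borel: "f \<in> borel_measurable borel \<Longrightarrow> f \<in> borel_measurable lebesgue"
  using borel_measurable_subalgebra[of borel lebesgue]
  by (simp add: measurable_completion)

lemma lmeas_continuous: "continuous_on UNIV f \<Longrightarrow> lmeas f"
  by (intro lmeas_borel borel_measurable_continuous_onI)

lemma nn_integral_lebesgue_shift:
  fixes t :: real
  assumes "f \<in> borel_measurable lebesgue"
  shows "(\<integral>\<^sup>+x. f (x + t) \<partial>lebesgue) = (\<integral>\<^sup>+x. f x \<partial>lebesgue)"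
  using nn_integral_real_affine_lebesgue[OF assms, of 1 t] by (simp add: add.commute)

lemma translation_add: "translation s (translation t u) = translation (s + t) u"
proof -
  obtain f where f: "lmeas f" "u = cls f" by (rule cls_cases)
  show ?thesis using f lmeas_shift[OF f(1)] by (simp add: translation_cls add.assoc)
qed

lemma translation_0 [simp]: "translation 0 u = u"
proof -
  obtain f where f: "lmeas f" "u = cls f" by (rule cls_cases)
  then show ?thesis by (simp add: translation_cls)
qed

lemma translation_diff: "translation t (u - v) = translation t u - translation t v"
proof -
  obtain f where f: "lmeas f" "u = cls f" by (rule cls_cases)
  obtain g where g: "lmeas g" "v = cls g" by (rule cls_cases)
  have "translation t (u - v) = cls (\<lambda>x. f (x + t) - g (x + t))"
    unfolding f g by (simp only: cls_diff[OF f(1) g(1)] translation_cls[OF borel_measurable_diff[OF f(1) g(1)]])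
  also have "\<dots> = translation t u - translation t v"
    unfolding f g translation_cls[OF f(1)] translation_cls[OF g(1)]
    by (rule cls_diff[OF lmeas_shift[OF f(1)] lmeas_shift[OF g(1)], symmetric])
  finally show ?thesis .
qed

section \<open>Integrals over blocks\<close>

lemma lmeas_block:
  fixes f :: "real \<Rightarrow> ennreal"
  assumes "f \<in> borel_measurable lebesgue"
  shows "(\<lambda>x. f x * indicator {a..<b} x) \<in> borel_measurable lebesgue"
  by (intro borel_measurable_times_ennreal assms borel_measurable_indicator) simp

abbreviation block :: "real \<Rightarrow> int \<Rightarrow> real set" where
  "block \<tau> k \<equiv> {of_int k * \<tau>..<of_int (k + 1) * \<tau>}"

lemma indicator_block:
  assumes "0 < \<tau>"
  shows "indicator (block \<tau> k) x = (if k = \<lfloor>x / \<tau>\<rfloor> then 1 else 0::ennreal)"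
proof -
  have "x \<in> block \<tau> k \<longleftrightarrow> of_int k \<le> x / \<tau> \<and> x / \<tau> < of_int k + 1"
    using assms by (simp add: field_simps)
  also have "\<dots> \<longleftrightarrow> k = \<lfloor>x / \<tau>\<rfloor>"
    by (metis floor_eq_iff)
  finally show ?thesis by (simp add: indicator_def)
qed

text \<open>Monotone convergence along symmetric ranges of block indices. With a bound on finite
  sums as hypothesis, no series of block integrals has to be formed.\<close>

lemma nn_integral_blocks:
  fixes f :: "real \<Rightarrow> ennreal"
  assumes f: "f \<in> borel_measurable lebesgue" and "0 < \<tau>"
    and K: "\<And>n::nat. (\<Sum>k\<in>{-int n..<int n}. \<integral>\<^sup>+x. f x * indicator (block \<tau> k) x \<partial>lebesgue) \<le> K"
  shows "(\<integral>\<^sup>+x. f x \<partial>lebesgue) \<le> K"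
proof -
  define F where "F n x = (\<Sum>k\<in>{-int n..<int n}. f x * indicator (block \<tau> k) x)" for n x
  have ind: "F n x = (if \<lfloor>x / \<tau>\<rfloor> \<in> {-int n..<int n} then f x else 0)" for n x
  proof -
    have "F n x = (\<Sum>k\<in>{-int n..<int n}. if k = \<lfloor>x / \<tau>\<rfloor> then f x else 0)"
      unfolding F_def indicator_block[OF \<open>0 < \<tau>\<close>] by (intro sum.cong) auto
    then show ?thesis by (simp add: sum.delta')
  qed
  have Fm: "F n \<in> borel_measurable lebesgue" for n
    unfolding F_def by (intro borel_measurable_sum lmeas_block f)
  have inc: "incseq F"
    by (auto simp: incseq_def le_fun_def ind)
  have sup: "(SUP n. F n x) = f x" for x
  proof (rule antisym)
    show "(SUP n. F n x) \<le> f x" by (rule SUP_least) (auto simp: ind)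
    have "F (nat (\<bar>\<lfloor>x / \<tau>\<rfloor>\<bar> + 1)) x = f x" by (auto simp: ind)
    then show "f x \<le> (SUP n. F n x)" by (metis SUP_upper UNIV_I)
  qed
  have "(\<integral>\<^sup>+x. f x \<partial>lebesgue) = (\<integral>\<^sup>+x. (SUP n. F n x) \<partial>lebesgue)" by (simp add: sup)
  also have "\<dots> = (SUP n. \<integral>\<^sup>+x. F n x \<partial>lebesgue)"
    by (rule nn_integral_monotone_convergence_SUP[OF inc Fm])
  also have "\<dots> \<le> K"
  proof (rule SUP_least)
    fix n :: nat
    have "(\<integral>\<^sup>+x. F n x \<partial>lebesgue) = (\<Sum>k\<in>{-int n..<int n}. \<integral>\<^sup>+x. f x * indicator (block \<tau> k) x \<partial>lebesgue)"
      unfolding F_def by (intro nn_integral_sum lmeas_block f)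
    then show "(\<integral>\<^sup>+x. F n x \<partial>lebesgue) \<le> K" using K[of n] by simp
  qed
  finally show ?thesis .
qed

lemma nn_integral_blocks_ge:
  fixes f :: "real \<Rightarrow> ennreal"
  assumes f: "f \<in> borel_measurable lebesgue" and "0 < \<tau>" and "finite F"
  shows "(\<Sum>k\<in>F. \<integral>\<^sup>+x. f x * indicator (block \<tau> k) x \<partial>lebesgue) \<le> (\<integral>\<^sup>+x. f x \<partial>lebesgue)"
proof -
  have "(\<Sum>k\<in>F. \<integral>\<^sup>+x. f x * indicator (block \<tau> k) x \<partial>lebesgue)
      = (\<integral>\<^sup>+x. (\<Sum>k\<in>F. f x * indicator (block \<tau> k) x) \<partial>lebesgue)"
    by (intro nn_integral_sum[symmetric] lmeas_block f)
  also have "\<dots> \<le> (\<integral>\<^sup>+x. f x \<partial>lebesgue)"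
  proof (rule nn_integral_mono)
    fix x
    have "(\<Sum>k\<in>F. f x * indicator (block \<tau> k) x) = (\<Sum>k\<in>F. if k = \<lfloor>x / \<tau>\<rfloor> then f x else 0)"
      unfolding indicator_block[OF \<open>0 < \<tau>\<close>] by (intro sum.cong) auto
    then show "(\<Sum>k\<in>F. f x * indicator (block \<tau> k) x) \<le> f x"
      using \<open>finite F\<close> by (simp add: sum.delta')
  qed
  finally show ?thesis .
qed

section \<open>The weighted space\<close>

locale weighted_Lp =
  fixes p :: real and \<rho> :: "real \<Rightarrow> real"
  assumes p_ge_1: "1 \<le> p" and admissible: "admissible_weight \<rho>"
begin

abbreviation X :: "aefun set" where "X \<equiv> Lp p \<rho>"
abbreviation N :: "aefun \<Rightarrow> real" where "N \<equiv> Lp_norm p \<rho>"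

text \<open>The p-th power of the norm, left in \<open>ennreal\<close> so that membership in
  \<open>X\<close> and norm bounds become plain inequalities without a prior proof of
  finiteness.\<close>

definition mass :: "(real \<Rightarrow> real) \<Rightarrow> ennreal" where
  "mass f = (\<integral>\<^sup>+ t. ennreal (\<bar>f t\<bar> powr p * \<rho> t) \<partial>lebesgue)"

lemma p_pos: "0 < p" using p_ge_1 by simp

lemma rho_meas [measurable]: "\<rho> \<in> borel_measurable lebesgue"
  using admissible by (simp add: admissible_weight_def)

lemma rho_pos [simp]: "0 < \<rho> t"
  using admissible by (simp add: admissible_weight_def)

lemma rho_nonneg [simp]: "0 \<le> \<rho> t"
  by (rule less_imp_le) simp

lemma rho_growth:
  obtains C where "1 \<le> C" "\<And>\<tau> t. 0 \<le> t \<Longrightarrow> t \<le> b \<Longrightarrow> \<rho> \<tau> \<le> C * \<rho> (\<tau> + t)"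
proof -
  obtain M \<omega> where M: "1 \<le> M" and le: "\<And>\<tau> t. 0 < t \<Longrightarrow> \<rho> \<tau> \<le> M * exp (\<omega> * t) * \<rho> (\<tau> + t)"
    using admissible unfolding admissible_weight_def by blast
  \<comment> \<open>The absolute values make the exponential factor at least 1 and an upper bound
    for all t between 0 and b, whatever the sign of \<omega>.\<close>
  define C where "C = M * exp (\<bar>\<omega>\<bar> * \<bar>b\<bar>)"
  have "1 \<le> C" using M mult_mono[of 1 M 1 "exp (\<bar>\<omega>\<bar> * \<bar>b\<bar>)"] by (simp add: C_def)
  moreover have "\<rho> \<tau> \<le> C * \<rho> (\<tau> + t)" if "0 \<le> t" "t \<le> b" for \<tau> t
  proof (cases "t = 0")
    case True
    then show ?thesis using \<open>1 \<le> C\<close> mult_right_mono[of 1 C "\<rho> \<tau>"] by simp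
  next
    case False
    have "\<omega> * t \<le> \<bar>\<omega>\<bar> * \<bar>b\<bar>"
      using that mult_mono[of \<omega> "\<bar>\<omega>\<bar>" t "\<bar>b\<bar>"] by simp
    then have "M * exp (\<omega> * t) * \<rho> (\<tau> + t) \<le> C * \<rho> (\<tau> + t)"
      using M by (auto simp: C_def intro!: mult_right_mono mult_left_mono)
    moreover have "\<rho> \<tau> \<le> M * exp (\<omega> * t) * \<rho> (\<tau> + t)" using le[of t \<tau>] that False by simp
    ultimately show ?thesis by (rule order.trans[rotated])
  qed
  ultimately show ?thesis using that by blast
qed

lemma weighted_integral_cls: "lmeas f \<Longrightarrow> weighted_integral p \<rho> (cls f) = mass f"
  by (simp add: weighted_integral.abs_eq ae_eq_refl mass_def)

lemma mem_X: "lmeas f \<Longrightarrow> cls f \<in> X \<longleftrightarrow> mass f < \<infinity>"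
  by (simp add: Lp_def weighted_integral_cls)

lemma N_cls: "lmeas f \<Longrightarrow> N (cls f) = enn2real (mass f) powr (1 / p)"
  by (simp add: Lp_norm_def weighted_integral_cls)

lemma N_nonneg [simp]: "0 \<le> N u"
  by (simp add: Lp_norm_def)

lemma N_powr: "lmeas f \<Longrightarrow> cls f \<in> X \<Longrightarrow> ennreal (N (cls f) powr p) = mass f"
  using p_pos by (simp add: N_cls mem_X powr_powr)

lemma N_le_iff:
  assumes "lmeas f" "cls f \<in> X" "0 \<le> a"
  shows "N (cls f) \<le> a \<longleftrightarrow> mass f \<le> ennreal (a powr p)"
  using p_pos assms by (simp flip: N_powr[OF assms(1,2)])
    (metis N_nonneg linorder_not_less powr_less_mono2 powr_mono2 order.strict_implies_order)

lemma mem_X_I: "lmeas f \<Longrightarrow> mass f \<le> ennreal c \<Longrightarrow> cls f \<in> X"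
  by (simp add: mem_X le_less_trans)

lemma N_leI: "lmeas f \<Longrightarrow> 0 \<le> a \<Longrightarrow> mass f \<le> ennreal (a powr p) \<Longrightarrow> N (cls f) \<le> a"
  using N_le_iff mem_X_I by blast

lemma N_less_iff:
  assumes "lmeas f" "cls f \<in> X" "0 < a"
  shows "N (cls f) < a \<longleftrightarrow> mass f < ennreal (a powr p)"
  using p_pos assms by (simp flip: N_powr[OF assms(1,2)] add: ennreal_less_iff)
    (metis N_nonneg linorder_not_less powr_less_mono2 powr_mono2 order.strict_implies_order)

lemma mass_integrand_meas:
  "lmeas f \<Longrightarrow> (\<lambda>t. ennreal (\<bar>f t\<bar> powr p * \<rho> t)) \<in> borel_measurable lebesgue"
  by (intro measurable_compose[OF _ measurable_ennreal] borel_measurable_times measurable_abs_powr rho_meas)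

lemma mass_cmult: "lmeas f \<Longrightarrow> mass (\<lambda>x. c * f x) = ennreal (\<bar>c\<bar> powr p) * mass f"
  unfolding mass_def by (subst nn_integral_cmult[symmetric])
    (auto simp: abs_mult powr_mult mult.assoc ennreal_mult intro!: nn_integral_cong)

lemma mass_eq_0: "lmeas f \<Longrightarrow> mass f = 0 \<longleftrightarrow> (AE x in lebesgue. f x = 0)"
proof -
  assume "lmeas f"
  have "\<bar>f x\<bar> powr p * \<rho> x \<le> 0 \<longleftrightarrow> f x = 0" for x
    using rho_pos[of x] by (simp add: mult_le_0_iff not_le[symmetric] del: rho_pos)
  then show ?thesis
    unfolding mass_def using mass_integrand_meas[OF \<open>lmeas f\<close>]
    by (subst nn_integral_0_iff_AE) (auto simp: ennreal_eq_0_iff)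
qed

lemma N_eq_0: "u \<in> X \<Longrightarrow> N u = 0 \<longleftrightarrow> u = 0"
proof -
  assume "u \<in> X"
  obtain f where f: "lmeas f" "u = cls f" by (rule cls_cases)
  have "N u = 0 \<longleftrightarrow> mass f = 0"
    using N_powr[of f] \<open>u \<in> X\<close> f N_cls[of f] by (cases "N u = 0") auto
  also have "\<dots> \<longleftrightarrow> u = 0"
    unfolding mass_eq_0[OF f(1)] f(2) cls_zero using cls_eqI[OF f(1)] cls_eqD[OF _ f(1)] by auto
  finally show ?thesis .
qed

lemma N_scaleR: "N (c *\<^sub>R u) = \<bar>c\<bar> * N u"
proof -
  obtain f where f: "lmeas f" "u = cls f" by (rule cls_cases)
  have "N (c *\<^sub>R u) = enn2real (mass (\<lambda>x. c * f x)) powr (1/p)"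
    using f by (simp add: cls_scaleR N_cls)
  also have "\<dots> = \<bar>c\<bar> * N u"
    using f p_pos by (simp add: mass_cmult enn2real_mult powr_mult powr_powr N_cls)
  finally show ?thesis .
qed

lemma scaleR_mem_X: "u \<in> X \<Longrightarrow> c *\<^sub>R u \<in> X"
proof -
  assume "u \<in> X"
  obtain f where f: "lmeas f" "u = cls f" by (rule cls_cases)
  then show ?thesis using \<open>u \<in> X\<close> by (simp add: cls_scaleR mem_X mass_cmult ennreal_mult_less_top)
qed

text \<open>For positive x and y this is convexity of the power function. The end point 0 is added
  by hand; there it amounts to \<open>l powr p \<le> l\<close> for l between 0 and 1.\<close>

lemma powr_convex_combination:
  assumes "0 \<le> x" "0 \<le> y" "0 \<le> l" "l \<le> 1"
  shows "(l * x + (1 - l) * y) powr p \<le> l * x powr p + (1 - l) * y powr p"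
proof -
  consider "x = 0" "y = 0" | "l = 0" | "l = 1" | "x = 0" "0 < y" | "y = 0" "0 < x" | "0 < x" "0 < y" 
    using assms by linarith
  then show ?thesis
  proof cases
    case 4
    have "(1 - l) powr p \<le> 1 - l" using powr_mono'[of 1 p "1 - l"] assms p_ge_1 by simp
    then show ?thesis using assms 4 p_pos by (simp add: powr_mult mult_right_mono)
  next
    case 5
    have "l powr p \<le> l" using powr_mono'[of 1 p "l"] assms p_ge_1 by simp
    then show ?thesis using assms 5 p_pos by (simp add: powr_mult mult_right_mono)
  next
    case 6
    then show ?thesis using convex_onD[OF powr_convex[OF p_ge_1], of "1 - l" x y] assms by simp
  qed (use p_pos in auto)
qed

text \<open>Minkowski's inequality from convexity. With a and b the two norms, |f| + |g| is (a + b)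
  times a convex combination of |f| / a and |g| / b with weights a / (a + b) and b / (a + b). Both
  quotients have norm 1, so the p-th power of the combination has mass at most 1. A vanishing norm
  is treated apart because of the division.\<close>

lemma N_triangle:
  assumes "u \<in> X" "v \<in> X"
  shows "u + v \<in> X" "N (u + v) \<le> N u + N v"
proof -
  obtain f where f: "lmeas f" "u = cls f" by (rule cls_cases)
  obtain g where g: "lmeas g" "v = cls g" by (rule cls_cases)
  have "u + v \<in> X \<and> N (u + v) \<le> N u + N v"
  proof (cases "N u = 0 \<or> N v = 0")
    case True
    then show ?thesis using assms N_eq_0[of u] N_eq_0[of v] by auto
  next
    case False
    define a b where "a = N u" and "b = N v"
    have ab: "0 < a" "0 < b" using False N_nonneg[of u] N_nonneg[of v] by (auto simp: a_def b_def less_le)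
    define l where "l = a / (a + b)"
    have l: "0 \<le> l" "l \<le> 1" "1 - l = b / (a + b)" using ab by (auto simp: l_def field_simps)
    have pw: "\<bar>f x + g x\<bar> powr p * \<rho> x \<le> (a + b) powr p * (l / a powr p) * (\<bar>f x\<bar> powr p * \<rho> x)
        + (a + b) powr p * ((1 - l) / b powr p) * (\<bar>g x\<bar> powr p * \<rho> x)" for x
    proof -
      have "(a + b) * (l * (\<bar>f x\<bar> / a) + (1 - l) * (\<bar>g x\<bar> / b)) = \<bar>f x\<bar> + \<bar>g x\<bar>"
        unfolding l(3) unfolding l_def using ab by (simp add: distrib_left)
      then have "\<bar>f x + g x\<bar> powr p \<le> ((a + b) * (l * (\<bar>f x\<bar> / a) + (1 - l) * (\<bar>g x\<bar> / b))) powr p"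
        using p_pos by (intro powr_mono2) auto
      also have "\<dots> = (a + b) powr p * (l * (\<bar>f x\<bar> / a) + (1 - l) * (\<bar>g x\<bar> / b)) powr p"
        using ab l by (intro powr_mult) 
      also have "\<dots> \<le> (a + b) powr p * (l * (\<bar>f x\<bar> / a) powr p + (1 - l) * (\<bar>g x\<bar> / b) powr p)"
        using ab l by (intro mult_left_mono powr_convex_combination) auto
      also have "\<dots> = (a + b) powr p * (l / a powr p) * \<bar>f x\<bar> powr p + (a + b) powr p * ((1 - l) / b powr p) * \<bar>g x\<bar> powr p"
        using ab by (simp add: powr_divide algebra_simps)
      finally have "\<bar>f x + g x\<bar> powr p * \<rho> x \<le> \<dots> * \<rho> x" by (rule mult_right_mono) simp
      then show ?thesis by (simp add: algebra_simps)
    qed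
    have fg: "lmeas (\<lambda>x. f x + g x)" using f g by measurable
    have "mass (\<lambda>x. f x + g x) \<le> (\<integral>\<^sup>+x. ennreal ((a + b) powr p * (l / a powr p)) * ennreal (\<bar>f x\<bar> powr p * \<rho> x)
        + ennreal ((a + b) powr p * ((1 - l) / b powr p)) * ennreal (\<bar>g x\<bar> powr p * \<rho> x) \<partial>lebesgue)"
      unfolding mass_def
    proof (rule nn_integral_mono)
      fix x
      have "ennreal (\<bar>f x + g x\<bar> powr p * \<rho> x) \<le> ennreal ((a + b) powr p * (l / a powr p) * (\<bar>f x\<bar> powr p * \<rho> x)
        + (a + b) powr p * ((1 - l) / b powr p) * (\<bar>g x\<bar> powr p * \<rho> x))"
        by (rule ennreal_leI[OF pw])
      then show "ennreal (\<bar>f x + g x\<bar> powr p * \<rho> x) \<le> ennreal ((a + b) powr p * (l / a powr p)) * ennreal (\<bar>f x\<bar> powr p * \<rho> x)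
        + ennreal ((a + b) powr p * ((1 - l) / b powr p)) * ennreal (\<bar>g x\<bar> powr p * \<rho> x)"
        using l(1,2) by (subst (asm) ennreal_plus) (auto simp del: times_divide_eq_right simp: ennreal_mult)
    qed
    also have "\<dots> = ennreal ((a + b) powr p * (l / a powr p)) * mass f
        + ennreal ((a + b) powr p * ((1 - l) / b powr p)) * mass g"
      unfolding mass_def using mass_integrand_meas[OF f(1)] mass_integrand_meas[OF g(1)]
      by (subst nn_integral_add) (auto simp: nn_integral_cmult)
    also have "\<dots> = ennreal ((a + b) powr p * (l / a powr p)) * ennreal (a powr p)
        + ennreal ((a + b) powr p * ((1 - l) / b powr p)) * ennreal (b powr p)"
      using N_powr[OF f(1)] N_powr[OF g(1)] assms f g by (simp add: a_def b_def)
    also have "\<dots> = ennreal ((a + b) powr p)"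
      using ab l(1,2) by (simp flip: ennreal_mult ennreal_plus) (simp add: algebra_simps)
    finally have le: "mass (\<lambda>x. f x + g x) \<le> ennreal ((a + b) powr p)" .
    show ?thesis using mem_X_I[OF fg le] N_leI[OF fg _ le] ab f g by (simp add: cls_add a_def b_def)
  qed
  then show "u + v \<in> X" "N (u + v) \<le> N u + N v" by auto
qed

lemma diff_mem_X: "u \<in> X \<Longrightarrow> v \<in> X \<Longrightarrow> u - v \<in> X"
  using N_triangle(1)[of u "(-1) *\<^sub>R v"] scaleR_mem_X[of v "-1"] by simp

lemma zero_mem_X [simp]: "0 \<in> X"
  by (simp add: cls_zero mem_X mass_def)

lemma N_zero [simp]: "N 0 = 0"
  using N_eq_0[of 0] by simp

lemma N_minus_commute: "N (u - v) = N (v - u)"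
  using N_scaleR[of "-1" "u - v"] by simp

lemma N_triangle_diff: "u \<in> X \<Longrightarrow> v \<in> X \<Longrightarrow> w \<in> X \<Longrightarrow> N (u - w) \<le> N (u - v) + N (v - w)"
  using N_triangle(2)[of "u - v" "v - w"] by (simp add: diff_mem_X)

lemma sum_mem_X: "(\<And>i. i \<in> I \<Longrightarrow> u i \<in> X) \<Longrightarrow> sum u I \<in> X"
  by (induction I rule: infinite_finite_induct) (auto intro: N_triangle(1))

sublocale Metric_space X "\<lambda>u v. N (u - v)"
proof
  show "N (u - v) = N (v - u)" for u v by (rule N_minus_commute)
  show "N (u - v) = 0 \<longleftrightarrow> u = v" if "u \<in> X" "v \<in> X" for u v
    using N_eq_0[OF diff_mem_X[OF that]] by simp
qed (auto intro: N_triangle_diff)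

lemma dense_subset_iff:
  "dense_subset X N A \<longleftrightarrow> A \<subseteq> X \<and> (\<forall>u\<in>X. \<forall>e>0. \<exists>a\<in>A. N (u - a) < e)"
proof (cases "A \<subseteq> X")
  case True
  then have "(\<exists>a\<in>A. a \<in> mball u e) \<longleftrightarrow> (\<exists>a\<in>A. N (u - a) < e)" if "u \<in> X" for u e
    using that by (auto simp add: subset_iff)
  then have "(norm_topology X N closure_of A = X) \<longleftrightarrow> (\<forall>u\<in>X. \<forall>e>0. \<exists>a\<in>A. N (u - a) < e)"
    unfolding norm_topology_def metric_closure_of set_eq_iff mem_Collect_eq by meson
  then show ?thesis using True by (simp add: dense_subset_def)
qed (simp add: dense_subset_def)

lemma openin_norm_iff:
  "openin (norm_topology X N) U \<longleftrightarrow> U \<subseteq> X \<and> (\<forall>u\<in>U. \<exists>e>0. \<forall>v\<in>X. N (u - v) < e \<longrightarrow> v \<in> U)"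
proof (cases "U \<subseteq> X")
  case True
  then have "mball u e \<subseteq> U \<longleftrightarrow> (\<forall>v\<in>X. N (u - v) < e \<longrightarrow> v \<in> U)" if "u \<in> U" for u e
    using that by (auto simp add: subset_iff)
  then show ?thesis
    unfolding norm_topology_def openin_mtopology Ball_def using True by meson
qed (simp add: norm_topology_def openin_mtopology)

section \<open>Continuous functionals as bounded linear ones\<close>

lemma dual_bound:
  assumes "\<phi> \<in> dual_space X N"
  obtains K where "0 < K" "\<And>u. u \<in> X \<Longrightarrow> \<bar>\<phi> u\<bar> \<le> K * N u"
proof -
  have cont: "continuous_map (norm_topology X N) euclideanreal \<phi>"
    and scale: "\<And>c u. u \<in> X \<Longrightarrow> \<phi> (c *\<^sub>R u) = c * \<phi> u" using assms by (auto simp: dual_space_def)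
  have \<phi>0: "\<phi> 0 = 0" using scale[of 0 0] by simp
  have "openin (norm_topology X N) {u \<in> topspace (norm_topology X N). \<phi> u \<in> ball 0 1}"
    using cont by (intro openin_continuous_map_preimage) auto
  then obtain e where e: "e > 0" "\<And>u. u \<in> X \<Longrightarrow> N u < e \<Longrightarrow> \<bar>\<phi> u\<bar> < 1"
  proof -
    assume *: "\<And>e. e > 0 \<Longrightarrow> (\<And>u. u \<in> X \<Longrightarrow> N u < e \<Longrightarrow> \<bar>\<phi> u\<bar> < 1) \<Longrightarrow> thesis"
    assume "openin (norm_topology X N) {u \<in> topspace (norm_topology X N). \<phi> u \<in> ball 0 1}"
    moreover have "0 \<in> {u \<in> topspace (norm_topology X N). \<phi> u \<in> ball 0 1}"
      by (simp add: \<phi>0 norm_topology_def)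
    ultimately obtain e where "e > 0"
      "\<And>v. v \<in> X \<Longrightarrow> N (0 - v) < e \<Longrightarrow> v \<in> {u \<in> topspace (norm_topology X N). \<phi> u \<in> ball 0 1}"
      unfolding openin_norm_iff by meson
    then show thesis
      using *[of e] N_minus_commute[of _ 0] by simp
  qed
  have "\<bar>\<phi> u\<bar> \<le> 2 / e * N u" if u: "u \<in> X" for u
  proof (cases "N u = 0")
    case True
    then show ?thesis using N_eq_0[OF u] \<phi>0 by simp
  next
    case False
    then have Nu: "0 < N u" using N_nonneg[of u] by linarith
    define c where "c = e / (2 * N u)"
    have c: "0 < c" using Nu e by (simp add: c_def)
    have "N (c *\<^sub>R u) < e" using Nu e by (simp add: N_scaleR c_def)
    then have "\<bar>\<phi> (c *\<^sub>R u)\<bar> < 1" using e(2) u scaleR_mem_X by blast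
    then have "c * \<bar>\<phi> u\<bar> < 1" using c u by (simp add: scale abs_mult)
    then show ?thesis using c Nu e by (simp add: c_def field_simps)
  qed
  then show ?thesis using that[of "2 / e"] e by simp
qed

lemma dualI:
  assumes "\<And>u v. u \<in> X \<Longrightarrow> v \<in> X \<Longrightarrow> \<phi> (u + v) = \<phi> u + \<phi> v"
    and "\<And>c u. u \<in> X \<Longrightarrow> \<phi> (c *\<^sub>R u) = c * \<phi> u"
    and "\<And>u. u \<in> X \<Longrightarrow> \<bar>\<phi> u\<bar> \<le> K * N u"
  shows "\<phi> \<in> dual_space X N"
proof -
  have diff: "\<phi> (u - v) = \<phi> u - \<phi> v" if "u \<in> X" "v \<in> X" for u v
    using assms(1)[of u "(-1) *\<^sub>R v"] assms(2)[of v "-1"] that scaleR_mem_X[of v "-1"] by simp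
  have Lip: "\<bar>\<phi> u - \<phi> v\<bar> \<le> \<bar>K\<bar> * N (u - v)" if "u \<in> X" "v \<in> X" for u v
  proof -
    have "\<bar>\<phi> u - \<phi> v\<bar> \<le> K * N (u - v)" using assms(3)[of "u - v"] diff[OF that] diff_mem_X[OF that] by simp
    also have "\<dots> \<le> \<bar>K\<bar> * N (u - v)" by (intro mult_right_mono) auto
    finally show ?thesis .
  qed
  have "continuous_map (norm_topology X N) euclideanreal \<phi>"
    unfolding continuous_map_def
  proof (intro conjI allI impI)
    fix V :: "real set" assume "openin euclideanreal V"
    then have "open V" by simp
    show "openin (norm_topology X N) {u \<in> topspace (norm_topology X N). \<phi> u \<in> V}"
      unfolding openin_norm_iff
    proof (intro conjI ballI)
      fix u assume "u \<in> {u \<in> topspace (norm_topology X N). \<phi> u \<in> V}"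
      then have u: "u \<in> X" "\<phi> u \<in> V" by (auto simp: norm_topology_def)
      obtain e where e: "e > 0" "\<And>y. \<bar>y - \<phi> u\<bar> < e \<Longrightarrow> y \<in> V"
        using \<open>open V\<close> u(2) unfolding open_dist by (auto simp: dist_real_def)
      show "\<exists>e>0. \<forall>v\<in>X. N (u - v) < e \<longrightarrow> v \<in> {u \<in> topspace (norm_topology X N). \<phi> u \<in> V}"
      \<comment> \<open>Adding 1 to |K| keeps the denominator positive whatever K is.\<close>
      proof (intro exI[of _ "e / (\<bar>K\<bar> + 1)"] conjI ballI impI)
        show "0 < e / (\<bar>K\<bar> + 1)" using e by (simp add: add_nonneg_pos)
        fix v assume v: "v \<in> X" "N (u - v) < e / (\<bar>K\<bar> + 1)"
        have "\<bar>\<phi> v - \<phi> u\<bar> \<le> \<bar>K\<bar> * N (u - v)" using Lip[OF u(1) v(1)] by (simp add: abs_minus_commute)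
        also have "\<dots> \<le> (\<bar>K\<bar> + 1) * N (u - v)" by (intro mult_right_mono) auto
        also have "\<dots> < e" using v(2) by (simp add: field_simps add_nonneg_pos)
        finally show "v \<in> {u \<in> topspace (norm_topology X N). \<phi> u \<in> V}"
          using e(2) v(1) by (simp add: norm_topology_def)
      qed
    qed (auto simp: norm_topology_def)
  qed auto
  then show ?thesis using assms(1,2) by (auto simp: dual_space_def)
qed

end

section \<open>Lattice sums of the weight, and what a nonzero periodic point says about them\<close>

lemma translation_periodic:
  assumes "translation \<tau> u = u"
  shows "translation (of_int k * \<tau>) u = u"
proof -
  have nat: "translation (of_nat n * \<tau>) u = u" for n
  proof (induction n)
    case (Suc n)
    have "translation (of_nat (Suc n) * \<tau>) u = translation (of_nat n * \<tau>) (translation \<tau> u)"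
      by (simp add: translation_add distrib_right add.commute)
    then show ?case using assms Suc by simp
  qed simp
  show ?thesis
  proof (cases k)
    case (nonneg n)
    then show ?thesis using nat[of n] by simp
  next
    case (neg n)
    have "translation (of_int k * \<tau>) u = translation (of_int k * \<tau>) (translation (of_nat (Suc n) * \<tau>) u)"
      by (simp only: nat)
    also have "\<dots> = u" unfolding translation_add using neg by (simp flip: distrib_right)
    finally show ?thesis .
  qed
qed

context weighted_Lp begin

text \<open>As growth is one-sided, the value at the left end of a block serves as a lower bound for
  \<rho> on the block; an upper bound needs the right end, hence the index k + 1 in
  \<open>rho_block_upper\<close>.\<close>

lemma rho_block_lower:
  assumes "0 < \<tau>" and C: "\<And>x t. 0 \<le> t \<Longrightarrow> t \<le> \<tau> \<Longrightarrow> \<rho> x \<le> C * \<rho> (x + t)"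
    and h: "h \<in> borel_measurable lebesgue" and "0 \<le> C"
  shows "ennreal (\<rho> (of_int k * \<tau>)) * (\<integral>\<^sup>+x. h x * indicator (block \<tau> k) x \<partial>lebesgue)
    \<le> ennreal C * (\<integral>\<^sup>+x. h x * ennreal (\<rho> x) * indicator (block \<tau> k) x \<partial>lebesgue)"
proof -
  have m: "(\<lambda>x. h x * ennreal (\<rho> x)) \<in> borel_measurable lebesgue"
    by (intro borel_measurable_times_ennreal h measurable_compose[OF rho_meas measurable_ennreal])
  have "ennreal (\<rho> (of_int k * \<tau>)) * (h x * indicator (block \<tau> k) x)
      \<le> ennreal C * (h x * ennreal (\<rho> x) * indicator (block \<tau> k) x)" for x
  proof (cases "x \<in> block \<tau> k")
    case True
    then have "\<rho> (of_int k * \<tau>) \<le> C * \<rho> x"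
      using C[of "x - of_int k * \<tau>" "of_int k * \<tau>"] by (simp add: algebra_simps)
    then have "ennreal (\<rho> (of_int k * \<tau>)) \<le> ennreal C * ennreal (\<rho> x)"
      using \<open>0 \<le> C\<close> by (simp add: ennreal_leI flip: ennreal_mult)
    from mult_right_mono[OF this, of "h x"] show ?thesis using True by (simp add: mult_ac)
  qed simp
  then show ?thesis
    unfolding nn_integral_cmult[OF lmeas_block[OF h], symmetric] nn_integral_cmult[OF lmeas_block[OF m], symmetric]
    by (rule nn_integral_mono)
qed

lemma rho_block_upper:
  assumes "0 < \<tau>" and C: "\<And>x t. 0 \<le> t \<Longrightarrow> t \<le> \<tau> \<Longrightarrow> \<rho> x \<le> C * \<rho> (x + t)" and "0 \<le> C"
  shows "(\<integral>\<^sup>+x. ennreal (\<rho> x) * indicator (block \<tau> k) x \<partial>lebesgue)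
    \<le> ennreal (C * \<tau> * \<rho> (of_int (k+1) * \<tau>))"
proof -
  have "(\<integral>\<^sup>+x. ennreal (\<rho> x) * indicator (block \<tau> k) x \<partial>lebesgue)
      \<le> (\<integral>\<^sup>+x. ennreal (C * \<rho> (of_int (k+1) * \<tau>)) * indicator (block \<tau> k) x \<partial>lebesgue)"
  proof (rule nn_integral_mono)
    fix x
    show "ennreal (\<rho> x) * indicator (block \<tau> k) x
      \<le> ennreal (C * \<rho> (of_int (k+1) * \<tau>)) * indicator (block \<tau> k) x"
      using C[of "of_int (k+1) * \<tau> - x" x] by (auto simp: indicator_def algebra_simps intro!: ennreal_leI)
  qed
  also have "\<dots> = ennreal (C * \<rho> (of_int (k+1) * \<tau>)) * ennreal \<tau>"
    using \<open>0 < \<tau>\<close> by (subst nn_integral_cmult_indicator) (auto simp: algebra_simps)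
  also have "\<dots> = ennreal (C * \<tau> * \<rho> (of_int (k+1) * \<tau>))"
    using \<open>0 < \<tau>\<close> \<open>0 \<le> C\<close> by (simp flip: ennreal_mult add: mult_ac)
  finally show ?thesis .
qed

lemma integral_finite_if_lattice_sums_bounded:
  assumes "0 < \<tau>" and S: "\<And>F. finite F \<Longrightarrow> (\<Sum>k\<in>F. \<rho> (of_int k * \<tau>)) \<le> S"
  shows "(\<integral>\<^sup>+x. ennreal (\<rho> x) \<partial>lebesgue) < \<infinity>"
proof -
  obtain C where C: "1 \<le> C" "\<And>x t. 0 \<le> t \<Longrightarrow> t \<le> \<tau> \<Longrightarrow> \<rho> x \<le> C * \<rho> (x + t)"
    using rho_growth[of \<tau>] by blast
  have "(\<integral>\<^sup>+x. ennreal (\<rho> x) \<partial>lebesgue) \<le> ennreal (C * \<tau> * S)"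
  proof (rule nn_integral_blocks[OF _ \<open>0 < \<tau>\<close>])
    show "(\<lambda>x. ennreal (\<rho> x)) \<in> borel_measurable lebesgue"
      by (intro measurable_compose[OF rho_meas measurable_ennreal])
    fix n :: nat
    have "(\<Sum>k\<in>{-int n..<int n}. \<integral>\<^sup>+x. ennreal (\<rho> x) * indicator (block \<tau> k) x \<partial>lebesgue)
        \<le> (\<Sum>k\<in>{-int n..<int n}. ennreal (C * \<tau> * \<rho> (of_int (k+1) * \<tau>)))"
      using C by (intro sum_mono rho_block_upper \<open>0 < \<tau>\<close>) auto
    also have "\<dots> = ennreal (C * \<tau> * (\<Sum>k\<in>{-int n..<int n}. \<rho> (of_int (k+1) * \<tau>)))"
      using C \<open>0 < \<tau>\<close> by (subst sum_ennreal) (auto simp: sum_distrib_left)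
    also have "(\<Sum>k\<in>{-int n..<int n}. \<rho> (of_int (k+1) * \<tau>)) = (\<Sum>k\<in>(\<lambda>k. k+1) ` {-int n..<int n}. \<rho> (of_int k * \<tau>))"
      by (subst sum.reindex) (auto simp: inj_on_def)
    also have "ennreal (C * \<tau> * \<dots>) \<le> ennreal (C * \<tau> * S)"
      using C \<open>0 < \<tau>\<close> by (intro ennreal_leI mult_left_mono S) auto
    finally show "(\<Sum>k\<in>{-int n..<int n}. \<integral>\<^sup>+x. ennreal (\<rho> x) * indicator (block \<tau> k) x \<partial>lebesgue)
        \<le> ennreal (C * \<tau> * S)" .
  qed
  then show ?thesis by (simp add: le_less_trans)
qed

lemma summable_iff_integral_finite:
  "(\<lambda>k::int. \<rho> (of_int k)) summable_on UNIV \<longleftrightarrow> (\<integral>\<^sup>+x. ennreal (\<rho> x) \<partial>lebesgue) < \<infinity>"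
proof
  assume "(\<lambda>k::int. \<rho> (of_int k)) summable_on UNIV"
  then have "(\<Sum>k\<in>F. \<rho> (of_int k * 1)) \<le> (\<Sum>\<^sub>\<infinity>k::int. \<rho> (of_int k))" if "finite F" for F
    using that by (simp add: finite_sum_le_infsum)
  then show "(\<integral>\<^sup>+x. ennreal (\<rho> x) \<partial>lebesgue) < \<infinity>"
    by (rule integral_finite_if_lattice_sums_bounded[rotated]) simp_all
next
  assume fin: "(\<integral>\<^sup>+x. ennreal (\<rho> x) \<partial>lebesgue) < \<infinity>"
  then obtain I where I: "(\<integral>\<^sup>+x. ennreal (\<rho> x) \<partial>lebesgue) = ennreal I" "0 \<le> I"
    by (metis ennreal_cases less_irrefl infinity_ennreal_def)
  obtain C where C: "1 \<le> C" "\<And>x t. 0 \<le> t \<Longrightarrow> t \<le> 1 \<Longrightarrow> \<rho> x \<le> C * \<rho> (x + t)"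
    using rho_growth[of 1] by blast
  have m: "(\<lambda>x. ennreal (\<rho> x)) \<in> borel_measurable lebesgue"
    by (intro measurable_compose[OF rho_meas measurable_ennreal])
  have "(\<Sum>k\<in>F. \<rho> (of_int k)) \<le> C * I" if "finite F" for F :: "int set"
  proof -
    have "ennreal (\<Sum>k\<in>F. \<rho> (of_int k)) = (\<Sum>k\<in>F. ennreal (\<rho> (of_int k * 1)) * (\<integral>\<^sup>+x. 1 * indicator (block 1 k) x \<partial>lebesgue))"
      by (simp add: sum_ennreal nn_integral_indicator)
    also have "\<dots> \<le> (\<Sum>k\<in>F. ennreal C * (\<integral>\<^sup>+x. 1 * ennreal (\<rho> x) * indicator (block 1 k) x \<partial>lebesgue))"
      using C by (intro sum_mono rho_block_lower) auto
    also have "\<dots> = ennreal C * (\<Sum>k\<in>F. \<integral>\<^sup>+x. ennreal (\<rho> x) * indicator (block 1 k) x \<partial>lebesgue)"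
      by (simp add: sum_distrib_left)
    also have "\<dots> \<le> ennreal C * (\<integral>\<^sup>+x. ennreal (\<rho> x) \<partial>lebesgue)"
      by (intro mult_left_mono nn_integral_blocks_ge m that) auto
    also have "\<dots> = ennreal (C * I)" using C I by (simp add: ennreal_mult)
    finally show ?thesis using C I by (subst (asm) ennreal_le_iff) auto
  qed
  then show "(\<lambda>k::int. \<rho> (of_int k)) summable_on UNIV"
    by (intro nonneg_bdd_above_summable_on bdd_aboveI[of _ "C * I"]) auto
qed

text \<open>By periodicity |f|^p has the same integral a over every block. Weighting block k by
  \<rho> at its left end shows that a times any finite lattice sum is at most C times the mass of f.
  It remains to see that a is neither 0, since f would vanish on all blocks, nor infinite.\<close>

lemma periodic_imp_integral_finite:
  assumes y: "u \<in> X" "u \<noteq> 0" and \<tau>: "0 < \<tau>" and per: "translation \<tau> u = u"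
  shows "(\<integral>\<^sup>+x. ennreal (\<rho> x) \<partial>lebesgue) < \<infinity>"
proof -
  obtain f where f: "lmeas f" "u = cls f" by (rule cls_cases)
  define h where "h x = ennreal (\<bar>f x\<bar> powr p)" for x
  have h: "h \<in> borel_measurable lebesgue"
    unfolding h_def by (intro measurable_compose[OF _ measurable_ennreal] measurable_abs_powr f)
  obtain C where C: "1 \<le> C" "\<And>x t. 0 \<le> t \<Longrightarrow> t \<le> \<tau> \<Longrightarrow> \<rho> x \<le> C * \<rho> (x + t)"
    using rho_growth[of \<tau>] by blast
  define a where "a = (\<integral>\<^sup>+x. h x * indicator {0..<\<tau>} x \<partial>lebesgue)"
  have a: "(\<integral>\<^sup>+x. h x * indicator (block \<tau> k) x \<partial>lebesgue) = a" for k
  proof -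
    have "cls (\<lambda>x. f (x + of_int k * \<tau>)) = cls f"
      using translation_periodic[OF per, of k] f by (simp add: translation_cls)
    then have ae: "AE x in lebesgue. f (x + of_int k * \<tau>) = f x"
      by (rule cls_eqD) (auto intro: lmeas_shift f)
    have "(\<integral>\<^sup>+x. h x * indicator (block \<tau> k) x \<partial>lebesgue)
        = (\<integral>\<^sup>+x. h (x + of_int k * \<tau>) * indicator (block \<tau> k) (x + of_int k * \<tau>) \<partial>lebesgue)"
      by (rule nn_integral_lebesgue_shift[OF lmeas_block[OF h], symmetric])
    also have "\<dots> = a" unfolding a_def
    proof (rule nn_integral_cong_AE, use ae in eventually_elim)
      fix x assume "f (x + of_int k * \<tau>) = f x"
      then show "h (x + of_int k * \<tau>) * indicator (block \<tau> k) (x + of_int k * \<tau>) = h x * indicator {0..<\<tau>} x"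
        by (auto simp: h_def indicator_def algebra_simps)
    qed
    finally show ?thesis .
  qed
  have mass: "mass f = (\<integral>\<^sup>+x. h x * ennreal (\<rho> x) \<partial>lebesgue)"
    by (simp add: mass_def h_def ennreal_mult)
  have hr: "(\<lambda>x. h x * ennreal (\<rho> x)) \<in> borel_measurable lebesgue"
    by (intro borel_measurable_times_ennreal h measurable_compose[OF rho_meas measurable_ennreal])
  obtain m where m: "mass f = ennreal m" "0 \<le> m"
    using y(1) f by (metis ennreal_cases less_irrefl infinity_ennreal_def mem_X)
  have le: "ennreal (\<Sum>k\<in>F. \<rho> (of_int k * \<tau>)) * a \<le> ennreal (C * m)" if "finite F" for F
  proof -
    have "ennreal (\<Sum>k\<in>F. \<rho> (of_int k * \<tau>)) * a = (\<Sum>k\<in>F. ennreal (\<rho> (of_int k * \<tau>)) * (\<integral>\<^sup>+x. h x * indicator (block \<tau> k) x \<partial>lebesgue))"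
      unfolding a by (simp add: sum_distrib_right flip: sum_ennreal)
    also have "\<dots> \<le> (\<Sum>k\<in>F. ennreal C * (\<integral>\<^sup>+x. h x * ennreal (\<rho> x) * indicator (block \<tau> k) x \<partial>lebesgue))"
      using C by (intro sum_mono rho_block_lower \<tau> h) auto
    also have "\<dots> = ennreal C * (\<Sum>k\<in>F. (\<integral>\<^sup>+x. h x * ennreal (\<rho> x) * indicator (block \<tau> k) x \<partial>lebesgue))"
      by (simp add: sum_distrib_left)
    also have "\<dots> \<le> ennreal C * mass f" unfolding mass
      by (intro mult_left_mono nn_integral_blocks_ge hr \<tau> that) auto
    also have "\<dots> = ennreal (C * m)" using C m by (simp add: ennreal_mult)
    finally show ?thesis .
  qed
  have "a \<noteq> 0"
  proof
    assume "a = 0"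
    then have "(\<integral>\<^sup>+x. h x \<partial>lebesgue) \<le> 0" by (intro nn_integral_blocks[OF h \<tau>]) (simp only: a, simp)
    then have "AE x in lebesgue. h x = 0" using nn_integral_0_iff_AE[OF h] by simp
    then have "AE x in lebesgue. f x = 0" by (rule eventually_mono) (simp add: h_def ennreal_eq_0_iff)
    then have "cls f = 0" unfolding cls_zero by (intro cls_eqI f) auto
    then show False using y(2) f by simp
  qed
  \<comment> \<open>The single index 0 suffices: \<open>\<rho> 0 * a\<close> is bounded and
    \<open>\<rho> 0\<close> is positive.\<close>
  moreover have "a \<noteq> top"
    using le[of "{0}"] less_imp_neq[OF rho_pos[of 0]] by (auto simp: ennreal_mult_top top_unique)
  ultimately obtain b where b: "a = ennreal b" "0 < b"
    by (metis ennreal_cases ennreal_0 less_le)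
  have "(\<Sum>k\<in>F. \<rho> (of_int k * \<tau>)) \<le> C * m / b" if "finite F" for F
  proof -
    have "(\<Sum>k\<in>F. \<rho> (of_int k * \<tau>)) * b \<le> C * m"
      using le[OF that] b C m by (simp add: sum_nonneg flip: ennreal_mult)
    then show ?thesis using b by (simp add: field_simps)
  qed
  then show ?thesis by (rule integral_finite_if_lattice_sums_bounded[OF \<tau>])
qed

text \<open>With \<rho> merely measurable, local bounds come from growth alone:
  \<open>\<rho> (-R)\<close> controls the window from below and \<open>\<rho> R\<close> from
  above.\<close>

lemma rho_bounds:
  obtains c c' where "0 < c" "\<And>x. \<bar>x\<bar> \<le> R \<Longrightarrow> c \<le> \<rho> x" "\<And>x. \<bar>x\<bar> \<le> R \<Longrightarrow> \<rho> x \<le> c'"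
proof -
  obtain C where C: "1 \<le> C" "\<And>x t. 0 \<le> t \<Longrightarrow> t \<le> 2 * R \<Longrightarrow> \<rho> x \<le> C * \<rho> (x + t)"
    using rho_growth[of "2 * R"] by blast
  have "\<rho> (-R) / C \<le> \<rho> x" "\<rho> x \<le> C * \<rho> R" if "\<bar>x\<bar> \<le> R" for x
    using that C(1) C(2)[of "x + R" "-R"] C(2)[of "R - x" x] by (auto simp: field_simps abs_le_iff)
  then show ?thesis using that[of "\<rho> (-R) / C" "C * \<rho> R"] C(1) by simp
qed

lemma mass_bounded_support:
  assumes "0 \<le> B" "0 \<le> R" "\<And>x. \<bar>f x\<bar> \<le> B" "\<And>x. R < \<bar>x\<bar> \<Longrightarrow> f x = 0" "\<And>x. \<bar>x\<bar> \<le> R \<Longrightarrow> \<rho> x \<le> c"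
  shows "mass f \<le> ennreal (B powr p * c * (2 * R))"
proof -
  have c: "0 \<le> c" using order.trans[OF rho_nonneg assms(5)[of 0]] assms(2) by simp
  have "mass f \<le> (\<integral>\<^sup>+x. ennreal (B powr p * c) * indicator {-R..R} x \<partial>lebesgue)"
    unfolding mass_def
  proof (rule nn_integral_mono)
    fix x show "ennreal (\<bar>f x\<bar> powr p * \<rho> x) \<le> ennreal (B powr p * c) * indicator {-R..R} x"
      using assms(3)[of x] assms(4)[of x] assms(5)[of x] assms(1) c p_pos
      by (cases "\<bar>x\<bar> \<le> R") (auto simp: abs_le_iff intro!: ennreal_leI mult_mono powr_mono2)
  qed
  also have "\<dots> = ennreal (B powr p * c) * ennreal (2 * R)"
    using assms(2) by (subst nn_integral_cmult_indicator) auto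
  also have "\<dots> = ennreal (B powr p * c * (2 * R))"
    using c assms(2) by (simp flip: ennreal_mult)
  finally show ?thesis .
qed

lemma bounded_support_mem_X:
  assumes "lmeas f" "\<And>x. \<bar>f x\<bar> \<le> B" "\<And>x. R < \<bar>x\<bar> \<Longrightarrow> f x = 0"
  shows "cls f \<in> X"
proof -
  obtain c c' where "\<And>x. \<bar>x\<bar> \<le> \<bar>R\<bar> \<Longrightarrow> \<rho> x \<le> c'" using rho_bounds[of "\<bar>R\<bar>"] by metis
  then have "mass f \<le> ennreal (B powr p * c' * (2 * \<bar>R\<bar>))"
    using assms(2)[of 0] by (intro mass_bounded_support assms) auto
  then show ?thesis using mem_X_I assms(1) by blast
qed

section \<open>Pairing with bounded functions of bounded support\<close>

text \<open>Bounding \<open>\<bar>f\<bar>\<close> by \<open>a * (1 + \<bar>f / a\<bar> powr p)\<close> with \<open>a\<close> the norm of \<open>f\<close> replaces Hoelder's inequality.\<close>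

lemma local_L1_bound:
  obtains K where "0 < K" "\<And>f. lmeas f \<Longrightarrow> cls f \<in> X \<Longrightarrow>
     (\<integral>\<^sup>+x. ennreal (\<bar>f x\<bar> * indicator {-R..R} x) \<partial>lebesgue) \<le> ennreal (K * N (cls f))"
proof -
  obtain c c' where c: "0 < c" "\<And>x. \<bar>x\<bar> \<le> R \<Longrightarrow> c \<le> \<rho> x" using rho_bounds[of R] by metis
  \<comment> \<open>After scaling f to norm 1, the constant 1 contributes the length of the window
    and the p-th power at most 1 / c, because \<rho> is at least c on the window.\<close>
  define K where "K = 2 * \<bar>R\<bar> + 1 / c"
  have K: "0 < K" using c by (simp add: K_def add_nonneg_pos)
  moreover have "(\<integral>\<^sup>+x. ennreal (\<bar>f x\<bar> * indicator {-R..R} x) \<partial>lebesgue) \<le> ennreal (K * N (cls f))"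
    if f: "lmeas f" "cls f \<in> X" for f
  proof (cases "N (cls f) = 0")
    case True
    then have "cls f = cls (\<lambda>_. 0)" using N_eq_0[OF f(2)] by (simp flip: cls_zero)
    then have ae: "AE x in lebesgue. f x = 0" by (rule cls_eqD) (auto intro: f)
    from ae have "AE x in lebesgue. ennreal (\<bar>f x\<bar> * indicator {-R..R} x) = 0"
      by (rule eventually_mono) simp
    then have "(\<integral>\<^sup>+x. ennreal (\<bar>f x\<bar> * indicator {-R..R} x) \<partial>lebesgue) = (\<integral>\<^sup>+x. 0 \<partial>(lebesgue :: real measure))"
      by (rule nn_integral_cong_AE)
    then show ?thesis by simp
  next
    case False
    define a where "a = N (cls f)"
    have a: "0 < a" using False N_nonneg[of "cls f"] by (simp add: a_def less_le)
    have le: "\<bar>f x\<bar> * indicator {-R..R} x \<le> a * indicator {-R..R} x + a / (a powr p * c) * (\<bar>f x\<bar> powr p * \<rho> x)" for x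
    proof (cases "x \<in> {-R..R}")
      case True
      have "\<bar>f x\<bar> / a \<le> 1 + (\<bar>f x\<bar> / a) powr p"
      proof (cases "\<bar>f x\<bar> / a \<le> 1")
        case True
        then show ?thesis by (metis add_increasing2 powr_ge_zero)
      next
        case False
        then have "(\<bar>f x\<bar> / a) powr 1 \<le> (\<bar>f x\<bar> / a) powr p" using p_ge_1 by (intro powr_mono) auto
        then show ?thesis using False a by (simp del: divide_le_eq_1_pos)
      qed
      then have "\<bar>f x\<bar> \<le> a + a / a powr p * \<bar>f x\<bar> powr p"
        using a by (simp add: powr_divide field_simps)
      also have "a / a powr p * \<bar>f x\<bar> powr p = a / (a powr p * c) * (\<bar>f x\<bar> powr p * c)"
        using c by simp
      also have "\<dots> \<le> a / (a powr p * c) * (\<bar>f x\<bar> powr p * \<rho> x)"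
        using a c True by (intro mult_left_mono) auto
      finally show ?thesis using True by simp
    next
      case False
      then show ?thesis using a c by simp
    qed
    have "(\<integral>\<^sup>+x. ennreal (\<bar>f x\<bar> * indicator {-R..R} x) \<partial>lebesgue)
       \<le> (\<integral>\<^sup>+x. ennreal a * indicator {-R..R} x + ennreal (a / (a powr p * c)) * ennreal (\<bar>f x\<bar> powr p * \<rho> x) \<partial>lebesgue)"
    proof (rule nn_integral_mono)
      fix x
      have "ennreal a * indicator {-R..R} x + ennreal (a / (a powr p * c)) * ennreal (\<bar>f x\<bar> powr p * \<rho> x)
         = ennreal (a * indicator {-R..R} x + a / (a powr p * c) * (\<bar>f x\<bar> powr p * \<rho> x))"
        using a c by (subst ennreal_plus) (auto simp flip: ennreal_mult simp: indicator_def)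
      then show "ennreal (\<bar>f x\<bar> * indicator {-R..R} x) \<le> ennreal a * indicator {-R..R} x + ennreal (a / (a powr p * c)) * ennreal (\<bar>f x\<bar> powr p * \<rho> x)"
        using ennreal_leI[OF le[of x]] by simp
    qed
    also have "\<dots> = ennreal a * emeasure lebesgue {-R..R} + ennreal (a / (a powr p * c)) * mass f"
      unfolding mass_def using mass_integrand_meas[OF f(1)]
      by (subst nn_integral_add)
        (auto simp: nn_integral_cmult nn_integral_cmult_indicator
          intro!: borel_measurable_times_ennreal borel_measurable_indicator)
    also have "\<dots> \<le> ennreal a * ennreal (2 * \<bar>R\<bar>) + ennreal (a / (a powr p * c)) * ennreal (a powr p)"
      using N_powr[OF f] by (intro add_mono mult_left_mono) (auto simp: a_def emeasure_lborel_Icc_eq ennreal_leI)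
    also have "\<dots> = ennreal (K * a)"
      using a c by (simp flip: ennreal_mult ennreal_plus) (simp add: K_def algebra_simps)
    finally show ?thesis by (simp add: a_def)
  qed
  ultimately show ?thesis using that by blast
qed

text \<open>A representative is chosen so that the functional is defined on classes;
  \<open>pairing_cls\<close> shows that the choice does not matter.\<close>

definition pairing :: "(real \<Rightarrow> real) \<Rightarrow> aefun \<Rightarrow> real" where
  "pairing h u = (LINT x|lebesgue. h x * rep_aefun u x)"

lemma pairing_cls:
  assumes "lmeas h" "lmeas f"
  shows "pairing h (cls f) = (LINT x|lebesgue. h x * f x)"
proof -
  have rep: "lmeas (rep_aefun (cls f))" "cls (rep_aefun (cls f)) = cls f"
    using Quotient3_abs_rep[OF Quotient3_aefun, of "cls f"] Quotient3_rep_reflp[OF Quotient3_aefun, of "cls f"]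
    by (auto simp: ae_eq_def)
  have ae: "AE x in lebesgue. rep_aefun (cls f) x = f x"
    using cls_eqD[OF rep(2) rep(1) assms(2)] .
  show ?thesis unfolding pairing_def
    using assms rep ae by (intro integral_cong_AE borel_measurable_times) (auto elim: eventually_mono)
qed

lemma pairing_integrable:
  assumes "lmeas h" "\<And>x. \<bar>h x\<bar> \<le> B" "\<And>x. R < \<bar>x\<bar> \<Longrightarrow> h x = 0" "lmeas f" "cls f \<in> X"
  shows "integrable lebesgue (\<lambda>x. h x * f x)"
proof -
  obtain K where "(\<integral>\<^sup>+x. ennreal (\<bar>f x\<bar> * indicator {-R..R} x) \<partial>lebesgue) \<le> ennreal (K * N (cls f))"
    using local_L1_bound[of R] assms(4,5) by metis
  then have fin: "(\<integral>\<^sup>+x. ennreal (norm (\<bar>f x\<bar> * indicator {-R..R} x)) \<partial>lebesgue) < \<infinity>"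
    by (simp add: abs_mult le_less_trans)
  have "integrable lebesgue (\<lambda>x. \<bar>f x\<bar> * indicator {-R..R} x)"
    using assms(4) fin by (intro integrableI_bounded borel_measurable_times borel_measurable_abs borel_measurable_indicator) auto
  then have "integrable lebesgue (\<lambda>x. B * (\<bar>f x\<bar> * indicator {-R..R} x))" by simp
  then show ?thesis
  proof (rule Bochner_Integration.integrable_bound)
    show "AE x in lebesgue. norm (h x * f x) \<le> norm (B * (\<bar>f x\<bar> * indicator {-R..R} x))"
    proof (rule AE_I2)
      fix x show "norm (h x * f x) \<le> norm (B * (\<bar>f x\<bar> * indicator {-R..R} x))"
        using assms(2)[of x] assms(3)[of x] by (cases "\<bar>x\<bar> \<le> R") (auto simp: abs_mult abs_le_iff intro!: mult_right_mono)
    qed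
  qed (intro borel_measurable_times assms)
qed

text \<open>K depends on R only and not on h, so that closeness of two elements controls the
  pairings with all test functions on the same window at once.\<close>

lemma pairing_bound:
  obtains K where "0 < K" "\<And>h B u. lmeas h \<Longrightarrow> (\<And>x. \<bar>h x\<bar> \<le> B) \<Longrightarrow> (\<And>x. R < \<bar>x\<bar> \<Longrightarrow> h x = 0) \<Longrightarrow>
    u \<in> X \<Longrightarrow> \<bar>pairing h u\<bar> \<le> B * K * N u"
proof -
  obtain K where K: "0 < K" "\<And>f. lmeas f \<Longrightarrow> cls f \<in> X \<Longrightarrow>
     (\<integral>\<^sup>+x. ennreal (\<bar>f x\<bar> * indicator {-R..R} x) \<partial>lebesgue) \<le> ennreal (K * N (cls f))"
    using local_L1_bound[of R] by metis
  have "\<bar>pairing h u\<bar> \<le> B * K * N u"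
    if h: "lmeas h" "\<And>x. \<bar>h x\<bar> \<le> B" "\<And>x. R < \<bar>x\<bar> \<Longrightarrow> h x = 0" and u: "u \<in> X" for h B u
  proof -
    have B: "0 \<le> B" using h(2)[of 0] by simp
    obtain f where f: "lmeas f" "u = cls f" by (rule cls_cases)
    have "ennreal \<bar>pairing h u\<bar> \<le> (\<integral>\<^sup>+x. norm (h x * f x) \<partial>lebesgue)"
      using integral_norm_bound_ennreal[OF pairing_integrable[OF h f(1)]] u f h(1) by (simp add: pairing_cls)
    also have "\<dots> \<le> (\<integral>\<^sup>+x. ennreal B * ennreal (\<bar>f x\<bar> * indicator {-R..R} x) \<partial>lebesgue)"
    proof (rule nn_integral_mono)
      fix x
      have "norm (h x * f x) \<le> B * (\<bar>f x\<bar> * indicator {-R..R} x)"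
        using h(2)[of x] h(3)[of x] by (cases "\<bar>x\<bar> \<le> R") (auto simp: abs_mult abs_le_iff intro!: mult_right_mono)
      then show "ennreal (norm (h x * f x)) \<le> ennreal B * ennreal (\<bar>f x\<bar> * indicator {-R..R} x)"
        using B by (simp flip: ennreal_mult add: ennreal_leI)
    qed
    also have "\<dots> = ennreal B * (\<integral>\<^sup>+x. ennreal (\<bar>f x\<bar> * indicator {-R..R} x) \<partial>lebesgue)"
      using f(1) by (intro nn_integral_cmult measurable_compose[OF _ measurable_ennreal] borel_measurable_times borel_measurable_abs borel_measurable_indicator) auto
    also have "\<dots> \<le> ennreal B * ennreal (K * N u)"
      using K(2)[OF f(1)] u f(2) by (intro mult_left_mono) auto
    also have "\<dots> = ennreal (B * K * N u)" using B K by (simp flip: ennreal_mult add: mult.assoc)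
    finally show ?thesis using B K by simp
  qed
  then show ?thesis using that K(1) by blast
qed

lemma pairing_dual:
  assumes "lmeas h" "\<And>x. \<bar>h x\<bar> \<le> B" "\<And>x. R < \<bar>x\<bar> \<Longrightarrow> h x = 0"
  shows "pairing h \<in> dual_space X N"
proof -
  obtain K where K: "\<And>u. u \<in> X \<Longrightarrow> \<bar>pairing h u\<bar> \<le> B * K * N u"
    using pairing_bound[of R] assms by metis
  show ?thesis
  proof (rule dualI[OF _ _ K])
    fix u v assume uv: "u \<in> X" "v \<in> X"
    obtain f where f: "lmeas f" "u = cls f" by (rule cls_cases)
    obtain g where g: "lmeas g" "v = cls g" by (rule cls_cases)
    show "pairing h (u + v) = pairing h u + pairing h v"
      using pairing_integrable[OF assms f(1)] pairing_integrable[OF assms g(1)] uv f g assms(1)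
      by (simp add: cls_add pairing_cls distrib_left)
  next
    fix c u assume u: "u \<in> X"
    obtain f where f: "lmeas f" "u = cls f" by (rule cls_cases)
    have "(\<lambda>x. h x * (c * f x)) = (\<lambda>x. c * (h x * f x))" by auto
    then show "pairing h (c *\<^sub>R u) = c * pairing h u"
      using f assms(1) by (simp add: cls_scaleR pairing_cls)
  qed
qed

lemma pairing_translation:
  assumes "lmeas h"
  shows "pairing h (translation t u) = pairing (\<lambda>x. h (x - t)) u"
proof -
  obtain f where f: "lmeas f" "u = cls f" by (rule cls_cases)
  have "pairing h (translation t u) = (LINT x|lebesgue. h x * f (x + t))"
    unfolding f translation_cls[OF f(1)] by (rule pairing_cls[OF assms lmeas_shift[OF f(1)]])
  also have "\<dots> = (LINT x|lebesgue. h (x - t) * f x)"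
    using lebesgue_integral_real_affine[of 1 "\<lambda>x. h x * f (x + t)" "-t"] by simp
  also have "\<dots> = pairing (\<lambda>x. h (x - t)) u"
    unfolding f using pairing_cls[OF lmeas_shift[OF assms, of "-t"] f(1)] by simp
  finally show ?thesis .
qed

section \<open>Translation on the weighted space, and separation of its points by pairings\<close>

lemma translation_bound:
  obtains C where "1 \<le> C" "\<And>t u. 0 \<le> t \<Longrightarrow> t \<le> b \<Longrightarrow> u \<in> X \<Longrightarrow> translation t u \<in> X \<and> N (translation t u) \<le> C * N u"
proof -
  obtain C where C: "1 \<le> C" "\<And>x t. 0 \<le> t \<Longrightarrow> t \<le> b \<Longrightarrow> \<rho> x \<le> C * \<rho> (x + t)"
    using rho_growth[of b] by blast
  have "translation t u \<in> X \<and> N (translation t u) \<le> C * N u" if t: "0 \<le> t" "t \<le> b" and u: "u \<in> X" for t u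
  proof -
    obtain f where f: "lmeas f" "u = cls f" by (rule cls_cases)
    have m: "(\<lambda>x. ennreal (\<bar>f x\<bar> powr p * \<rho> x)) \<in> borel_measurable lebesgue"
      by (rule mass_integrand_meas[OF f(1)])
    have "mass (\<lambda>x. f (x + t)) \<le> (\<integral>\<^sup>+x. ennreal C * ennreal (\<bar>f (x + t)\<bar> powr p * \<rho> (x + t)) \<partial>lebesgue)"
      unfolding mass_def
    proof (rule nn_integral_mono)
      fix x
      have "\<bar>f (x + t)\<bar> powr p * \<rho> x \<le> \<bar>f (x + t)\<bar> powr p * (C * \<rho> (x + t))"
        by (intro mult_left_mono C t) auto
      then show "ennreal (\<bar>f (x + t)\<bar> powr p * \<rho> x) \<le> ennreal C * ennreal (\<bar>f (x + t)\<bar> powr p * \<rho> (x + t))"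
        using C(1) by (subst ennreal_mult[symmetric]) (auto intro!: ennreal_leI simp: mult_ac)
    qed
    also have "\<dots> = ennreal C * (\<integral>\<^sup>+x. ennreal (\<bar>f (x + t)\<bar> powr p * \<rho> (x + t)) \<partial>lebesgue)"
      by (intro nn_integral_cmult measurable_compose[OF measurable_shift_lebesgue m])
    also have "\<dots> = ennreal C * mass f"
      unfolding mass_def by (simp only: nn_integral_lebesgue_shift[OF m])
    also have "\<dots> = ennreal (C * N u powr p)" using N_powr[OF f(1)] u f C(1) by (simp add: ennreal_mult)
    \<comment> \<open>C is at least 1 and p is at least 1, so C may be replaced by its p-th power
      and no root of C appears in the norm bound.\<close>
    also have "\<dots> \<le> ennreal ((C * N u) powr p)"
      using powr_mono[of 1 p C] p_ge_1 C(1) by (intro ennreal_leI) (auto simp: powr_mult intro!: mult_right_mono)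
    finally have le: "mass (\<lambda>x. f (x + t)) \<le> ennreal ((C * N u) powr p)" .
    show ?thesis
      using mem_X_I[OF lmeas_shift[OF f(1)] le] N_leI[OF lmeas_shift[OF f(1)] _ le] C(1)
      unfolding f translation_cls[OF f(1)] by simp
  qed
  then show ?thesis using that C(1) by blast
qed

lemma translation_mem_X: "0 \<le> t \<Longrightarrow> u \<in> X \<Longrightarrow> translation t u \<in> X"
  using translation_bound[of t] by (metis order_refl)

text \<open>Testing with the sign of f - g, cut off to [-n, n], returns the integral of |f - g| over
  that interval.\<close>

lemma dual_separates:
  assumes "u \<in> X" "v \<in> X"
    and eq: "\<And>h B R. lmeas h \<Longrightarrow> (\<And>x. \<bar>h x\<bar> \<le> B) \<Longrightarrow> (\<And>x. R < \<bar>x\<bar> \<Longrightarrow> h x = 0) \<Longrightarrow> pairing h u = pairing h v"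
  shows "u = v"
proof -
  obtain f where f: "lmeas f" "u = cls f" by (rule cls_cases)
  obtain g where g: "lmeas g" "v = cls g" by (rule cls_cases)
  have "AE x in lebesgue. \<bar>x\<bar> \<le> real n \<longrightarrow> f x = g x" for n
  proof -
    define h where "h x = sgn (f x - g x) * indicator {-real n..real n} x" for x :: real
    have h: "lmeas h" unfolding h_def using f(1) g(1)
      by (intro borel_measurable_times borel_measurable_indicator measurable_compose[OF _ borel_measurable_sgn]) auto
    have hB: "\<bar>h x\<bar> \<le> 1" for x by (auto simp: h_def indicator_def sgn_if)
    have hR: "real n < \<bar>x\<bar> \<Longrightarrow> h x = 0" for x by (auto simp: h_def indicator_def)
    note int = pairing_integrable[OF h hB hR f(1)] pairing_integrable[OF h hB hR g(1)]
    have hfg: "h x * f x - h x * g x = \<bar>f x - g x\<bar> * indicator {-real n..real n} x" for x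
      by (auto simp: h_def indicator_def sgn_if algebra_simps)
    have int': "integrable lebesgue (\<lambda>x. \<bar>f x - g x\<bar> * indicator {-real n..real n} x)"
      using Bochner_Integration.integrable_diff[OF int] assms(1,2) f g unfolding hfg by simp
    have "(LINT x|lebesgue. \<bar>f x - g x\<bar> * indicator {-real n..real n} x) = (LINT x|lebesgue. h x * f x) - (LINT x|lebesgue. h x * g x)"
      using Bochner_Integration.integral_diff[OF int] assms(1,2) f g unfolding hfg by simp
    also have "\<dots> = 0" using eq[OF h hB hR] f g h by (simp add: pairing_cls)
    finally have "AE x in lebesgue. \<bar>f x - g x\<bar> * indicator {-real n..real n} x = 0"
      using integral_nonneg_eq_0_iff_AE[OF int'] by (simp add: indicator_def)
    then show ?thesis by (rule eventually_mono) (auto simp: indicator_def abs_le_iff split: if_splits)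
  qed
  then have "AE x in lebesgue. \<forall>n. \<bar>x\<bar> \<le> real n \<longrightarrow> f x = g x" unfolding AE_all_countable by blast
  then have "AE x in lebesgue. f x = g x" by (rule eventually_mono) (meson real_arch_simple)
  then show ?thesis using f g cls_eqI by metis
qed

end

section \<open>Periodic functions from chaos and from the criterion\<close>

abbreviation outside :: "nat \<Rightarrow> real set" where
  "outside n \<equiv> {x. real n \<le> \<bar>x\<bar>}"

lemma outside_measurable: "outside n \<in> sets lebesgue"
  by (intro sets_completionI_sets) (simp add: sets_lborel)

lemma integral_tail_tendsto_0:
  fixes g :: "real \<Rightarrow> real"
  assumes "integrable lebesgue g"
  shows "(\<lambda>n::nat. LINT t|lebesgue. \<bar>g t\<bar> * indicator (outside n) t) \<longlonglongrightarrow> 0"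
proof -
  have "(\<lambda>n::nat. LINT t|lebesgue. \<bar>g t\<bar> * indicator (outside n) t) \<longlonglongrightarrow> (LINT t|(lebesgue::real measure). 0)"
  proof (rule integral_dominated_convergence[where w = "\<lambda>t. \<bar>g t\<bar>"])
    show "(\<lambda>t. \<bar>g t\<bar> * indicator (outside n) t) \<in> borel_measurable lebesgue" for n
      using assms by (intro borel_measurable_times borel_measurable_abs borel_measurable_indicator outside_measurable) auto
    show "AE x in lebesgue. (\<lambda>n. \<bar>g x\<bar> * indicator (outside n) x) \<longlonglongrightarrow> 0"
    proof (rule AE_I2)
      fix x :: real
      obtain m :: nat where "\<bar>x\<bar> < real m" using reals_Archimedean2 by blast
      then have "\<forall>\<^sub>F n in sequentially. \<bar>g x\<bar> * indicator (outside n) x = 0"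
        by (intro eventually_sequentiallyI[of m]) auto
      then show "(\<lambda>n. \<bar>g x\<bar> * indicator (outside n) x) \<longlonglongrightarrow> 0"
        by (rule tendsto_eventually)
    qed
    show "AE x in lebesgue. norm (\<bar>g x\<bar> * indicator (outside n) x) \<le> \<bar>g x\<bar>" for n
      by (auto simp: indicator_def)
  qed (use assms in auto)
  then show ?thesis by simp
qed

context weighted_Lp begin

lemma dual_add: "\<phi> \<in> dual_space X N \<Longrightarrow> u \<in> X \<Longrightarrow> v \<in> X \<Longrightarrow> \<phi> (u + v) = \<phi> u + \<phi> v"
  by (simp add: dual_space_def)

lemma dual_scaleR: "\<phi> \<in> dual_space X N \<Longrightarrow> u \<in> X \<Longrightarrow> \<phi> (c *\<^sub>R u) = c * \<phi> u"
  by (simp add: dual_space_def)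

lemma dual_zero: "\<phi> \<in> dual_space X N \<Longrightarrow> \<phi> 0 = 0"
  using dual_scaleR[of \<phi> 0 0] by simp

lemma dual_diff: "\<phi> \<in> dual_space X N \<Longrightarrow> u \<in> X \<Longrightarrow> v \<in> X \<Longrightarrow> \<phi> (u - v) = \<phi> u - \<phi> v"
  using dual_add[of \<phi> "u - v" v] by (simp add: diff_mem_X)

lemma lmeas_indicator_Icc: "lmeas (indicator {a..b::real})"
  by (rule borel_measurable_indicator) simp

lemma indicator_mem_X: "A \<in> sets lebesgue \<Longrightarrow> A \<subseteq> {-R..R} \<Longrightarrow> cls (indicator A) \<in> X"
  by (rule bounded_support_mem_X[where B = 1 and R = R]) (auto simp: indicator_def abs_if subset_iff split: if_splits)

lemma indicator_nonzero: "0 < a \<Longrightarrow> cls (indicator {0..a::real}) \<noteq> 0"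
proof
  assume a: "0 < a" and "cls (indicator {0..a}) = 0"
  have "AE x in lebesgue. indicator {0..a} x = (0::real)"
    by (rule cls_eqD[OF \<open>cls (indicator {0..a}) = 0\<close>[unfolded cls_zero]]) (auto intro: borel_measurable_indicator)
  then have "AE x in lebesgue. x \<notin> {0..a}" by (rule eventually_mono) (auto simp: indicator_def split: if_splits)
  then have "emeasure lebesgue {0..a} = 0" by (subst (asm) AE_iff_measurable[where N = "{0..a}"]) auto
  then show False using a by simp
qed

text \<open>A periodic point that is nearer to \<open>u\<close> than 0 is cannot be 0.\<close>

lemma chaotic_imp_integral_finite:
  assumes "chaotic X N translation"
  shows "(\<integral>\<^sup>+x. ennreal (\<rho> x) \<partial>lebesgue) < \<infinity>"
proof -
  define u where "u = cls (indicator {0..1})"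
  have u: "u \<in> X" "u \<noteq> 0"
    using indicator_mem_X[of "{0..1}" 1] indicator_nonzero[of 1] by (auto simp: u_def)
  then have "0 < N u" using N_eq_0[OF u(1)] N_nonneg[of u] by linarith
  moreover have "dense_subset X N (periodic_points X translation)" using assms by (simp add: chaotic_def)
  ultimately obtain v where v: "v \<in> periodic_points X translation" "N (u - v) < N u"
    unfolding dense_subset_iff using u(1) by blast
  then obtain t where "v \<in> X" "0 < t" "translation t v = v" by (auto simp: periodic_points_def)
  moreover have "v \<noteq> 0" using v(2) by auto
  ultimately show ?thesis using periodic_imp_integral_finite by blast
qed

text \<open>The forward orbit and the maps S are glued to one orbit over the whole line. That
  \<open>translation (-t) u\<close> lies in X for t > 0 is information supplied by the criterion,
  since X need not be invariant under such translations. Time 0 is counted with the forward half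
  only.\<close>

lemma full_orbit_pettis:
  assumes S: "\<forall>t>0. S t = translation (-t) u"
    and P1: "pettis_integrable X N (lebesgue_on {0..}) (\<lambda>t. translation t u)"
    and P2: "pettis_integrable X N (lebesgue_on {0<..}) S"
  shows "translation t u \<in> X"
    and "\<phi> \<in> dual_space X N \<Longrightarrow> integrable lebesgue (\<lambda>t. \<phi> (translation t u))"
    and "E \<in> sets lebesgue \<Longrightarrow> \<exists>y\<in>X. \<forall>\<phi>\<in>dual_space X N. \<phi> y = (LINT t|lebesgue. indicator E t * \<phi> (translation t u))"
proof -
  show "translation t u \<in> X"
  proof (cases "0 \<le> t")
    case True
    then show ?thesis using P1 by (auto simp: pettis_integrable_def)
  next
    case False
    then have "S (-t) \<in> X" using P2 by (auto simp: pettis_integrable_def)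
    then show ?thesis using S False by simp
  qed
  have pos: "integrable lebesgue (\<lambda>t. indicator {0..} t * \<phi> (translation t u))" if "\<phi> \<in> dual_space X N" for \<phi>
    using P1 that by (auto simp: pettis_integrable_def integrable_restrict_space)
  have neg: "integrable lebesgue (\<lambda>t. indicator {..<0} t * \<phi> (translation t u))" if "\<phi> \<in> dual_space X N" for \<phi>
  proof -
    have "integrable lebesgue (\<lambda>t. indicator {0<..} t * \<phi> (S t))"
      using P2 that by (auto simp: pettis_integrable_def integrable_restrict_space)
    moreover have "indicator {0<..} t * \<phi> (S t) = indicator {..<0} (0 + -1 * t) * \<phi> (translation (0 + -1 * t) u)" for t
      by (auto simp: S indicator_def)
    ultimately show ?thesis
      using lebesgue_integrable_real_affine_iff[of "-1" "\<lambda>t. indicator {..<0} t * \<phi> (translation t u)" 0] by simp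
  qed
  show "integrable lebesgue (\<lambda>t. \<phi> (translation t u))" if "\<phi> \<in> dual_space X N" for \<phi>
  proof -
    have "indicator {0..} t * \<phi> (translation t u) + indicator {..<0} t * \<phi> (translation t u) = \<phi> (translation t u)" for t
      by (auto simp: indicator_def)
    then show ?thesis using Bochner_Integration.integrable_add[OF pos[OF that] neg[OF that]] by simp
  qed
  assume E: "E \<in> sets lebesgue"
  define E1 where "E1 = E \<inter> {0..}"
  \<comment> \<open>The negative part of E, reflected, because the backward orbit is parametrised by
    positive times.\<close>
  define E2 where "E2 = (\<lambda>t. - t) -` E \<inter> {0<..}"
  have neg_meas: "(\<lambda>t::real. - t) \<in> lebesgue \<rightarrow>\<^sub>M lebesgue"
  proof -
    have "(*\<^sub>R) (-1) = (\<lambda>t::real. - t)" by auto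
    then show ?thesis using lebesgue_measurable_scaling[of "-1", where 'a = real] by simp
  qed
  have E2': "(\<lambda>t::real. - t) -` E \<in> sets lebesgue" using measurable_sets[OF neg_meas E] by simp
  have sets: "E1 \<in> sets (lebesgue_on {0..})" "E2 \<in> sets (lebesgue_on {0<..})"
    using E E2' by (auto simp: E1_def E2_def sets_restrict_space_iff)
  obtain y1 where y1: "y1 \<in> X" "\<And>\<phi>. \<phi> \<in> dual_space X N \<Longrightarrow> \<phi> y1 = (LINT t:E1|lebesgue_on {0..}. \<phi> (translation t u))"
    using P1 sets unfolding pettis_integrable_def by blast
  obtain y2 where y2: "y2 \<in> X" "\<And>\<phi>. \<phi> \<in> dual_space X N \<Longrightarrow> \<phi> y2 = (LINT t:E2|lebesgue_on {0<..}. \<phi> (S t))"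
    using P2 sets unfolding pettis_integrable_def by blast
  show "\<exists>y\<in>X. \<forall>\<phi>\<in>dual_space X N. \<phi> y = (LINT t|lebesgue. indicator E t * \<phi> (translation t u))"
  proof (intro bexI[of _ "y1 + y2"] ballI N_triangle(1) y1(1) y2(1))
    fix \<phi> assume \<phi>: "\<phi> \<in> dual_space X N"
    have 1: "\<phi> y1 = (LINT t|lebesgue. indicator E t * (indicator {0..} t * \<phi> (translation t u)))"
    proof -
      have "\<phi> y1 = (LINT t|lebesgue. indicator {0..} t * (indicator E1 t * \<phi> (translation t u)))"
        by (simp add: y1(2)[OF \<phi>] set_lebesgue_integral_def integral_restrict_space)
      also have "(\<lambda>t. indicator {0..} t * (indicator E1 t * \<phi> (translation t u))) = (\<lambda>t. indicator E t * (indicator {0..} t * \<phi> (translation t u)))"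
        by (auto simp: E1_def indicator_def)
      finally show ?thesis .
    qed
    have 2: "\<phi> y2 = (LINT t|lebesgue. indicator E t * (indicator {..<0} t * \<phi> (translation t u)))"
    proof -
      have "\<phi> y2 = (LINT t|lebesgue. indicator {0<..} t * (indicator E2 t * \<phi> (S t)))"
        by (simp add: y2(2)[OF \<phi>] set_lebesgue_integral_def integral_restrict_space)
      also have "(\<lambda>t. indicator {0<..} t * (indicator E2 t * \<phi> (S t))) = (\<lambda>t. indicator E (0 + -1 * t) * (indicator {..<0} (0 + -1 * t) * \<phi> (translation (0 + -1 * t) u)))"
        by (auto simp: E2_def indicator_def S)
      finally show ?thesis
        using lebesgue_integral_real_affine[of "-1" "\<lambda>t. indicator E t * (indicator {..<0} t * \<phi> (translation t u))" 0] by simp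
    qed
    have "integrable lebesgue (\<lambda>t. indicator E t * (indicator {0..} t * \<phi> (translation t u)))"
      "integrable lebesgue (\<lambda>t. indicator E t * (indicator {..<0} t * \<phi> (translation t u)))"
      using integrable_mult_indicator[OF E pos[OF \<phi>]] integrable_mult_indicator[OF E neg[OF \<phi>]] by simp_all
    then have "\<phi> y1 + \<phi> y2 = (LINT t|lebesgue. indicator E t * (indicator {0..} t * \<phi> (translation t u)) + indicator E t * (indicator {..<0} t * \<phi> (translation t u)))"
      unfolding 1 2 by (rule Bochner_Integration.integral_add[symmetric])
    also have "(\<lambda>t. indicator E t * (indicator {0..} t * \<phi> (translation t u)) + indicator E t * (indicator {..<0} t * \<phi> (translation t u))) = (\<lambda>t. indicator E t * \<phi> (translation t u))"
      by (auto simp: indicator_def)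
    finally show "\<phi> (y1 + y2) = (LINT t|lebesgue. indicator E t * \<phi> (translation t u))"
      using \<phi> y1(1) y2(1) by (simp add: dual_space_def)
  qed
qed

text \<open>The inverse relation alone forces \<open>S t\<close> to be translation by -t. Let g t be
  the integral of x over [t, t + 1]. The indicator of [0, 2] gives the value 1 for all t in [0, 1],
  and the distance 1 / (2 * K) of x from it costs at most 1/2. Integrating g over a set that
  consists of [0, 1] and far away pieces therefore gives a positive number, which is a functional of
  the Pettis integral y; so y is not 0.\<close>

lemma criterion_imp_integral_finite:
  assumes "frequent_hypercyclicity_criterion X N translation"
  shows "(\<integral>\<^sup>+x. ennreal (\<rho> x) \<partial>lebesgue) < \<infinity>"
proof -
  obtain X0 S where dense: "dense_subset X N X0"
    and inv: "\<And>x t. x \<in> X0 \<Longrightarrow> 0 < t \<Longrightarrow> translation t (S t x) = x"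
    and P1: "\<And>x. x \<in> X0 \<Longrightarrow> pettis_integrable X N (lebesgue_on {0..}) (\<lambda>t. translation t x)"
    and P2: "\<And>x. x \<in> X0 \<Longrightarrow> pettis_integrable X N (lebesgue_on {0<..}) (\<lambda>t. S t x)"
    using assms unfolding frequent_hypercyclicity_criterion_def by metis
  have S: "\<forall>t>0. S t x = translation (-t) x" if "x \<in> X0" for x
  proof (intro allI impI)
    fix t :: real assume "0 < t"
    then have "translation (-t) x = translation (-t) (translation t (S t x))" using inv that by simp
    then show "S t x = translation (-t) x" by (simp add: translation_add)
  qed
  define u where "u = cls (indicator {0..2})"
  have u: "u \<in> X" using indicator_mem_X[of "{0..2}" 2] by (simp add: u_def)
  obtain K where K: "0 < K" "\<And>h B u. lmeas h \<Longrightarrow> (\<And>x. \<bar>h x\<bar> \<le> B) \<Longrightarrow> (\<And>x. 2 < \<bar>x\<bar> \<Longrightarrow> h x = 0) \<Longrightarrow>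
    u \<in> X \<Longrightarrow> \<bar>pairing h u\<bar> \<le> B * K * N u"
    using pairing_bound[of 2] by metis
  obtain x where x: "x \<in> X0" "N (u - x) < 1 / (2 * K)"
  proof -
    have "0 < 1 / (2 * K)" using K(1) by simp
    then show ?thesis using that dense u unfolding dense_subset_iff by blast
  qed
  have xX: "x \<in> X" using x(1) dense by (auto simp: dense_subset_iff)
  note full = full_orbit_pettis[OF S[OF x(1)] P1[OF x(1)] P2[OF x(1)]]
  define \<phi> where "\<phi> = pairing (indicator {0..1})"
  have \<phi>: "\<phi> \<in> dual_space X N"
    unfolding \<phi>_def by (rule pairing_dual[OF lmeas_indicator_Icc, where B = 1 and R = 1]) (auto simp: indicator_def)
  define g where "g t = \<phi> (translation t x)" for t
  have g_int: "integrable lebesgue g" unfolding g_def by (rule full(2)[OF \<phi>])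
  have g_ge: "1/2 \<le> g t" if t: "t \<in> {0..1}" for t
  proof -
    have sh: "(\<lambda>x. indicator {0..1} (x - t)) = (indicator {t..t+1} :: real \<Rightarrow> real)" by (rule ext) (auto simp: indicator_def)
    have g: "g t = pairing (indicator {t..t+1}) x"
      unfolding g_def \<phi>_def unfolding pairing_translation[OF lmeas_indicator_Icc] sh ..
    have d: "pairing (indicator {t..t+1}) \<in> dual_space X N"
      by (rule pairing_dual[OF lmeas_indicator_Icc, where B = 1 and R = "\<bar>t\<bar> + 1"]) (auto simp: indicator_def)
    have "pairing (indicator {t..t+1}) (u - x) = pairing (indicator {t..t+1}) u - pairing (indicator {t..t+1}) x"
      by (rule dual_diff[OF d u xX])
    moreover have "\<bar>pairing (indicator {t..t+1}) (u - x)\<bar> \<le> 1 * K * N (u - x)"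
      by (rule K(2)[OF lmeas_indicator_Icc]) (use t u xX in \<open>auto simp: indicator_def intro: diff_mem_X\<close>)
    moreover have "1 * K * N (u - x) \<le> 1/2" using x(2) K(1) by (simp add: field_simps)
    moreover have "pairing (indicator {t..t+1}) u = 1"
    proof -
      have "pairing (indicator {t..t+1}) u = (LINT x|lebesgue. indicator {t..t+1} x * indicator {0..2} x)"
        unfolding u_def by (rule pairing_cls[OF lmeas_indicator_Icc lmeas_indicator_Icc])
      also have "(\<lambda>x. indicator {t..t+1} x * indicator {0..2} x :: real) = indicator {t..t+1}"
        using t by (auto simp: indicator_def)
      finally show ?thesis by simp
    qed
    ultimately show ?thesis unfolding g by linarith
  qed
  have "\<forall>\<^sub>F n in sequentially. (LINT t|lebesgue. \<bar>g t\<bar> * indicator (outside n) t) < 1/2"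
    by (rule order_tendstoD(2)[OF integral_tail_tendsto_0[OF g_int]]) simp
  then obtain n :: nat where n: "(LINT t|lebesgue. \<bar>g t\<bar> * indicator (outside n) t) < 1/2"
    using eventually_happens'[OF sequentially_bot] by blast
  \<comment> \<open>With this period the pieces [k\<tau>, k\<tau> + 1], k nonzero, all lie in
    \<open>outside n\<close>; the critical one is k = -1, whose right end is 1 - \<tau> =
    -n.\<close>
  define \<tau> where "\<tau> = real n + 1"
  have \<tau>: "0 < \<tau>" by (simp add: \<tau>_def)
  \<comment> \<open>The union of the intervals [k\<tau>, k\<tau> + 1] over all integers k: the left
    side is the remainder of t modulo \<tau>.\<close>
  define E where "E = {t. t - \<tau> * of_int \<lfloor>t / \<tau>\<rfloor> \<le> 1}"
  have E: "E \<in> sets lebesgue"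
    unfolding E_def by (intro sets_completionI_sets) (simp add: sets_lborel)
  have E_per: "t + \<tau> \<in> E \<longleftrightarrow> t \<in> E" for t
  proof -
    have "(t + \<tau>) / \<tau> = t / \<tau> + 1" using \<tau> by (simp add: field_simps)
    then show ?thesis by (simp add: E_def algebra_simps)
  qed
  have E_cases: "t \<in> {0..1} \<or> real n \<le> \<bar>t\<bar>" if "t \<in> E" for t
  proof (cases "\<lfloor>t / \<tau>\<rfloor> = 0")
    case True
    then have "0 \<le> t / \<tau>" using zero_le_floor[of "t / \<tau>"] by linarith
    then show ?thesis using that True \<tau> by (simp add: E_def zero_le_divide_iff)
  next
    case False
    then consider "1 \<le> \<lfloor>t / \<tau>\<rfloor>" | "\<lfloor>t / \<tau>\<rfloor> \<le> -1" by linarith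
    then show ?thesis
    proof cases
      case 1
      then have "\<tau> \<le> t" using \<tau> by (simp add: le_floor_iff field_simps)
      then show ?thesis by (simp add: \<tau>_def)
    next
      case 2
      have "\<tau> * of_int \<lfloor>t / \<tau>\<rfloor> \<le> \<tau> * (-1)" using 2 \<tau> by (intro mult_left_mono) auto
      then have "t \<le> 1 - \<tau>" using that by (simp add: E_def)
      then show ?thesis by (simp add: \<tau>_def)
    qed
  qed
  have E01: "t \<in> E" if "t \<in> {0..1}" for t
  proof -
    have "0 \<le> \<lfloor>t / \<tau>\<rfloor>" using that \<tau> by (simp add: zero_le_floor)
    then have "0 \<le> \<tau> * of_int \<lfloor>t / \<tau>\<rfloor>" using \<tau> by simp
    then show ?thesis using that by (simp add: E_def)
  qed
  obtain y where y: "y \<in> X" "\<And>\<phi>. \<phi> \<in> dual_space X N \<Longrightarrow> \<phi> y = (LINT t|lebesgue. indicator E t * \<phi> (translation t x))"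
    using full(3)[OF E] by blast
  \<comment> \<open>On the level of pairings: the translation moves to the test function, from there
    into the time variable of the orbit, and is absorbed by the \<tau>-periodic set E.\<close>
  have per: "translation \<tau> y = y"
  proof (rule dual_separates)
    show "translation \<tau> y \<in> X" using translation_mem_X y(1) \<tau> by simp
    fix h :: "real \<Rightarrow> real" and B R
    assume h: "lmeas h" "\<And>x. \<bar>h x\<bar> \<le> B" "\<And>x. R < \<bar>x\<bar> \<Longrightarrow> h x = 0"
    have d: "pairing h \<in> dual_space X N" by (rule pairing_dual[OF h])
    have d': "pairing (\<lambda>x. h (x - \<tau>)) \<in> dual_space X N"
      by (rule pairing_dual[where B = B and R = "R + \<tau>"])
        (use h lmeas_shift[OF h(1), of "-\<tau>"] \<tau> in \<open>auto intro!: h(3)\<close>)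
    have "pairing h (translation \<tau> y) = (LINT t|lebesgue. indicator E t * pairing (\<lambda>x. h (x - \<tau>)) (translation t x))"
      by (simp only: pairing_translation[OF h(1)] y(2)[OF d'])
    also have "\<dots> = (LINT t|lebesgue. indicator E (\<tau> + 1 * t) * pairing h (translation (\<tau> + 1 * t) x))"
      by (simp add: indicator_def E_per add.commute translation_add flip: pairing_translation[OF h(1)])
    also have "\<dots> = pairing h y"
      using lebesgue_integral_real_affine[of 1 "\<lambda>t. indicator E t * pairing h (translation t x)" \<tau>] by (simp add: y(2)[OF d])
    finally show "pairing h (translation \<tau> y) = pairing h y" .
  qed (rule y(1))
  have "y \<noteq> 0"
  proof
    assume "y = 0"
    then have "\<phi> y = 0" using dual_zero[OF \<phi>] by simp
    then have 0: "(LINT t|lebesgue. indicator E t * g t) = 0" using y(2)[OF \<phi>] by (simp add: g_def)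
    have i1: "integrable lebesgue (\<lambda>t. \<bar>g t\<bar> * indicator (outside n) t)"
      using integrable_mult_indicator[OF outside_measurable integrable_abs[OF g_int]] by (simp add: mult.commute)
    have i2: "integrable lebesgue (\<lambda>t::real. 1/2 * indicator {0..1} t :: real)" 
      by (intro integrable_mult_right integrable_real_indicator) auto
    \<comment> \<open>On [0, 1] the integrand is at least 1/2, and all other points of E lie in
      \<open>outside n\<close>, where |g| has integral below 1/2. The integral over E is therefore
      positive.\<close>
    have "(LINT t|lebesgue. 1/2 * indicator {0..1} t - \<bar>g t\<bar> * indicator (outside n) t) \<le> (LINT t|lebesgue. indicator E t * g t)"
    proof (rule integral_mono)
      show "integrable lebesgue (\<lambda>t. indicator E t * g t)"
        using integrable_mult_indicator[OF E g_int] by simp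
      fix t
      show "1/2 * indicator {0..1} t - \<bar>g t\<bar> * indicator (outside n) t \<le> indicator E t * g t"
        using g_ge[of t] E01[of t] E_cases[of t]
        by (cases "t \<in> {0..1}"; cases "t \<in> E"; cases "real n \<le> \<bar>t\<bar>") auto
    qed (intro Bochner_Integration.integrable_diff i1 i2)
    moreover have "(LINT t|lebesgue. 1/2 * indicator {0..1} t - \<bar>g t\<bar> * indicator (outside n) t) = 1/2 - (LINT t|lebesgue. \<bar>g t\<bar> * indicator (outside n) t)"
      by (subst Bochner_Integration.integral_diff[OF i2 i1]) simp
    ultimately show False using n 0 by linarith
  qed
  then show ?thesis using periodic_imp_integral_finite[OF y(1) _ \<tau> per] by blast
qed

end

section \<open>Continuous functions with compact support\<close>

definition Cc :: "(real \<Rightarrow> real) set" where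
  "Cc = {f. continuous_on UNIV f \<and> (\<exists>R. \<forall>x. R < \<bar>x\<bar> \<longrightarrow> f x = 0)}"

lemma Cc_lmeas: "f \<in> Cc \<Longrightarrow> lmeas f"
  by (auto simp: Cc_def intro: lmeas_continuous)

lemma Cc_bounded:
  assumes "f \<in> Cc"
  obtains B and R :: nat where "0 < B" "\<And>x. \<bar>f x\<bar> \<le> B" "\<And>x. real R < \<bar>x\<bar> \<Longrightarrow> f x = 0"
proof -
  obtain R where cont: "continuous_on UNIV f" and R: "\<And>x. R < \<bar>x\<bar> \<Longrightarrow> f x = 0" using assms by (auto simp: Cc_def)
  obtain n :: nat where n: "R \<le> real n" using real_arch_simple by blast
  have "compact (f ` {-real n..real n})"
    by (intro compact_continuous_image continuous_on_subset[OF cont]) auto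
  then obtain B where B: "0 < B" "\<And>x. x \<in> {-real n..real n} \<Longrightarrow> \<bar>f x\<bar> \<le> B"
    using compact_imp_bounded bounded_pos by (metis imageI real_norm_def)
  have f0: "f x = 0" if "real n < \<bar>x\<bar>" for x using R n that by simp
  moreover have "\<bar>f x\<bar> \<le> B" for x
    using B f0[of x] by (cases "\<bar>x\<bar> \<le> real n") (auto simp: abs_le_iff)
  ultimately show ?thesis using that B(1) by blast
qed

lemma Cc_uniform:
  assumes "f \<in> Cc" "0 < e"
  obtains d where "0 < d" "\<And>x y. \<bar>x - y\<bar> < d \<Longrightarrow> \<bar>f x - f y\<bar> < e"
proof -
  obtain R where cont: "continuous_on UNIV f" and R: "\<And>x. R < \<bar>x\<bar> \<Longrightarrow> f x = 0" using assms by (auto simp: Cc_def)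
  \<comment> \<open>The interval exceeds the support by 1, so two points at distance below 1 are
    either both inside it or both off the support.\<close>
  have "uniformly_continuous_on {-R-1..R+1} f"
    by (intro compact_uniformly_continuous continuous_on_subset[OF cont]) auto
  then obtain d where d: "0 < d" "\<And>x y. x \<in> {-R-1..R+1} \<Longrightarrow> y \<in> {-R-1..R+1} \<Longrightarrow> \<bar>x - y\<bar> < d \<Longrightarrow> \<bar>f x - f y\<bar> < e"
    using \<open>0 < e\<close> unfolding uniformly_continuous_on_def dist_real_def by (metis abs_minus_commute)
  have "\<bar>f x - f y\<bar> < e" if "\<bar>x - y\<bar> < min d 1" for x y
  proof (cases "x \<in> {-R-1..R+1} \<and> y \<in> {-R-1..R+1}")
    case True
    then show ?thesis using d that by simp
  next
    case False
    then have "R < \<bar>x\<bar>" "R < \<bar>y\<bar>" using that by auto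
    then show ?thesis using R \<open>0 < e\<close> by simp
  qed
  then show ?thesis using that[of "min d 1"] d(1) by simp
qed

context weighted_Lp begin

lemma N_dominated_convergence:
  assumes F: "\<And>n. lmeas (F n)" and G: "mass G < \<infinity>" "lmeas G"
    and le: "\<And>n x. \<bar>F n x\<bar> \<le> G x" and lim: "AE x in lebesgue. (\<lambda>n. F n x) \<longlonglongrightarrow> 0" and e: "0 < e"
  shows "\<forall>\<^sub>F n in sequentially. N (cls (F n)) < e"
proof -
  have "(\<lambda>n. \<integral>\<^sup>+x. ennreal (\<bar>F n x\<bar> powr p * \<rho> x) \<partial>lebesgue) \<longlonglongrightarrow> (\<integral>\<^sup>+x. 0 \<partial>(lebesgue :: real measure))"
  proof (rule nn_integral_dominated_convergence[where w = "\<lambda>x. ennreal (\<bar>G x\<bar> powr p * \<rho> x)"])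
    show "AE x in lebesgue. ennreal (\<bar>F n x\<bar> powr p * \<rho> x) \<le> ennreal (\<bar>G x\<bar> powr p * \<rho> x)" for n
      using order.trans[OF le abs_ge_self] p_pos
      by (intro AE_I2 ennreal_leI mult_right_mono powr_mono2) auto
    show "AE x in lebesgue. (\<lambda>n. ennreal (\<bar>F n x\<bar> powr p * \<rho> x)) \<longlonglongrightarrow> 0"
      using lim
    proof eventually_elim
      fix x assume "(\<lambda>n. F n x) \<longlonglongrightarrow> 0"
      then have "(\<lambda>n. \<bar>F n x\<bar> powr p) \<longlonglongrightarrow> 0 powr p"
        using p_pos by (intro tendsto_powr') (auto intro: tendsto_rabs_zero)
      then have "(\<lambda>n. \<bar>F n x\<bar> powr p * \<rho> x) \<longlonglongrightarrow> 0"
        by (intro tendsto_mult_left_zero) simp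
      then show "(\<lambda>n. ennreal (\<bar>F n x\<bar> powr p * \<rho> x)) \<longlonglongrightarrow> 0"
        using tendsto_ennrealI by fastforce
    qed
    show "(\<integral>\<^sup>+x. ennreal (\<bar>G x\<bar> powr p * \<rho> x) \<partial>lebesgue) < \<infinity>" using G(1) by (simp add: mass_def)
  qed (rule mass_integrand_meas[OF F] mass_integrand_meas[OF G(2)] borel_measurable_const)+
  then have "(\<lambda>n. mass (F n)) \<longlonglongrightarrow> 0" by (simp add: mass_def)
  then have "\<forall>\<^sub>F n in sequentially. mass (F n) < ennreal (e powr p)"
    using e by (intro order_tendstoD(2)) auto
  then show ?thesis
  proof eventually_elim
    case (elim n)
    then have "cls (F n) \<in> X" by (intro mem_X_I[OF F, where c = "e powr p"]) simp
    then show ?case using elim e N_less_iff[OF F] by simp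
  qed
qed

end

section \<open>Approximation and strong continuity when the weight has finite integral\<close>

locale finite_weighted_Lp = weighted_Lp +
  assumes rho_finite: "(\<integral>\<^sup>+x. ennreal (\<rho> x) \<partial>lebesgue) < \<infinity>"
begin

lemma rho_integrable: "integrable lebesgue \<rho>"
  using rho_finite by (intro integrableI_bounded rho_meas) simp

text \<open>The norm of a bounded function is controlled by the weight of a set carrying it; the two
  cases in use are the whole line, giving \<open>W\<close>, and \<open>outside n\<close>, giving
  \<open>tail_norm n\<close>.\<close>

lemma N_bounded:
  assumes f: "lmeas f" and A: "A \<in> sets lebesgue" and B: "\<And>x. \<bar>f x\<bar> \<le> B" and 0: "\<And>x. x \<notin> A \<Longrightarrow> f x = 0"
  shows "cls f \<in> X" "N (cls f) \<le> B * (LINT x|lebesgue. \<rho> x * indicator A x) powr (1 / p)"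
proof -
  have B0: "0 \<le> B" using B[of 0] by simp
  have int: "integrable lebesgue (\<lambda>x. \<rho> x * indicator A x)"
    using integrable_mult_indicator[OF A rho_integrable] by (simp add: mult.commute)
  have nonneg: "0 \<le> (LINT x|lebesgue. \<rho> x * indicator A x)" by (rule Bochner_Integration.integral_nonneg) simp
  have "mass f \<le> (\<integral>\<^sup>+x. ennreal (B powr p * (\<rho> x * indicator A x)) \<partial>lebesgue)"
    unfolding mass_def
  proof (rule nn_integral_mono)
    fix x show "ennreal (\<bar>f x\<bar> powr p * \<rho> x) \<le> ennreal (B powr p * (\<rho> x * indicator A x))"
      using B[of x] 0[of x] p_pos by (cases "x \<in> A") (auto intro!: ennreal_leI mult_right_mono powr_mono2)
  qed
  also have "\<dots> = ennreal (LINT x|lebesgue. B powr p * (\<rho> x * indicator A x))"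
    by (rule nn_integral_eq_integral) (use int in auto)
  also have "\<dots> = ennreal ((B * (LINT x|lebesgue. \<rho> x * indicator A x) powr (1 / p)) powr p)"
    using B0 nonneg p_pos by (simp add: powr_mult powr_powr)
  finally have le: "mass f \<le> ennreal ((B * (LINT x|lebesgue. \<rho> x * indicator A x) powr (1 / p)) powr p)" .
  show "cls f \<in> X" by (rule mem_X_I[OF f le])
  show "N (cls f) \<le> B * (LINT x|lebesgue. \<rho> x * indicator A x) powr (1 / p)"
    by (rule N_leI[OF f _ le]) (use B0 in auto)
qed

definition W :: real where
  "W = (LINT x|lebesgue. \<rho> x) powr (1 / p)"

definition tail_norm :: "nat \<Rightarrow> real" where
  "tail_norm n = (LINT x|lebesgue. \<rho> x * indicator (outside n) x) powr (1 / p)"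

lemma W_nonneg [simp]: "0 \<le> W"
  by (simp add: W_def)

lemma bounded_mem_X: "lmeas f \<Longrightarrow> (\<And>x. \<bar>f x\<bar> \<le> B) \<Longrightarrow> cls f \<in> X"
  by (rule N_bounded(1)[of _ UNIV]) auto

lemma N_bounded_le: "lmeas f \<Longrightarrow> (\<And>x. \<bar>f x\<bar> \<le> B) \<Longrightarrow> N (cls f) \<le> B * W"
  using N_bounded(2)[of f UNIV B] by (simp add: W_def)

lemma N_tail_le:
  "lmeas f \<Longrightarrow> (\<And>x. \<bar>f x\<bar> \<le> B) \<Longrightarrow> (\<And>x. \<bar>x\<bar> < real n \<Longrightarrow> f x = 0) \<Longrightarrow> N (cls f) \<le> B * tail_norm n"
  unfolding tail_norm_def by (rule N_bounded(2)[OF _ outside_measurable]) auto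

lemma tail_norm_tendsto: "tail_norm \<longlonglongrightarrow> 0"
proof -
  have "(\<lambda>n. LINT x|lebesgue. \<rho> x * indicator (outside n) x) \<longlonglongrightarrow> 0"
    using integral_tail_tendsto_0[OF rho_integrable] by simp
  then have "(\<lambda>n. (LINT x|lebesgue. \<rho> x * indicator (outside n) x) powr (1/p)) \<longlonglongrightarrow> 0 powr (1/p)"
    using p_pos by (intro tendsto_powr') (auto intro!: always_eventually Bochner_Integration.integral_nonneg)
  then show ?thesis by (simp add: tail_norm_def[abs_def])
qed

lemma Cc_mem_X: "f \<in> Cc \<Longrightarrow> cls f \<in> X"
  by (metis Cc_bounded Cc_lmeas bounded_mem_X)

text \<open>f is first truncated in height and cut off in space, with f itself as dominating
  function. Then f is an almost everywhere limit of continuous functions, and these pass through the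
  same truncation and cutoff. Doing so before taking limits provides compact support and the
  constant dominating function 2m, which lies in X because the weight is finite.\<close>

lemma Cc_dense:
  assumes u: "u \<in> X" and e: "0 < e"
  obtains f where "f \<in> Cc" "N (u - cls f) < e"
proof -
  obtain f where f: "lmeas f" "u = cls f" by (rule cls_cases)
  define \<psi> where "\<psi> m x = max 0 (min 1 (real m + 1 - \<bar>x\<bar>))" for m :: nat and x :: real
  define k where "k m y = max (- real m) (min (real m) y)" for m :: nat and y :: real
  have \<psi>: "0 \<le> \<psi> m x" "\<psi> m x \<le> 1" for m x by (auto simp: \<psi>_def)
  have k: "\<bar>k m y\<bar> \<le> \<bar>y\<bar>" "\<bar>k m y\<bar> \<le> real m" for m y by (auto simp: k_def)
  have cont_\<psi>: "continuous_on UNIV (\<psi> m)" for m unfolding \<psi>_def by (intro continuous_intros)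
  have cont_k: "continuous_on UNIV (k m)" for m unfolding k_def by (intro continuous_intros)
  have \<psi>_meas: "lmeas (\<psi> m)" for m by (rule lmeas_continuous[OF cont_\<psi>])
  have k_meas: "lmeas (\<lambda>x. k m (g x))" if "lmeas g" for g m
    by (rule measurable_compose[OF that borel_measurable_continuous_onI[OF cont_k]])
  define h where "h m x = \<psi> m x * k m (f x)" for m x
  have h_meas: "lmeas (h m)" for m unfolding h_def by (intro borel_measurable_times \<psi>_meas k_meas f)
  have "\<forall>\<^sub>F m in sequentially. N (cls (\<lambda>x. f x - h m x)) < e / 2"
  proof (rule N_dominated_convergence[where G = "\<lambda>x. 2 * \<bar>f x\<bar>"])
    show "lmeas (\<lambda>x. f x - h m x)" for m by (intro borel_measurable_diff f h_meas)
    show "mass (\<lambda>x. 2 * \<bar>f x\<bar>) < \<infinity>"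
      using u f mass_cmult[OF borel_measurable_abs[OF f(1)], of 2]
      by (simp add: mem_X mass_def ennreal_mult_less_top)
    show "lmeas (\<lambda>x. 2 * \<bar>f x\<bar>)" using f(1) by (intro borel_measurable_times borel_measurable_abs) auto
    show "\<bar>f x - h m x\<bar> \<le> 2 * \<bar>f x\<bar>" for m x
    proof -
      have "\<bar>h m x\<bar> \<le> 1 * \<bar>f x\<bar>" unfolding h_def abs_mult
        using \<psi>[of m x] k[of m "f x"] by (intro mult_mono) auto
      then show ?thesis by linarith
    qed
    show "AE x in lebesgue. (\<lambda>m. f x - h m x) \<longlonglongrightarrow> 0"
    proof (rule AE_I2)
      fix x
      obtain M :: nat where M: "max \<bar>x\<bar> \<bar>f x\<bar> \<le> real M" using real_arch_simple by blast
      have "f x - h m x = 0" if "M \<le> m" for m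
      proof -
        have "real M \<le> real m" using that by simp
        then have "\<psi> m x = 1" "k m (f x) = f x" using M by (auto simp: \<psi>_def k_def)
        then show ?thesis by (simp add: h_def)
      qed
      then have "\<forall>\<^sub>F m in sequentially. f x - h m x = 0" by (rule eventually_sequentiallyI)
      then show "(\<lambda>m. f x - h m x) \<longlonglongrightarrow> 0" by (rule tendsto_eventually)
    qed
  qed (use e in auto)
  then obtain m where m: "N (cls (\<lambda>x. f x - h m x)) < e / 2"
    using eventually_happens'[OF sequentially_bot] by blast
  have "f measurable_on UNIV" by (rule lebesgue_measurable_imp_measurable_on[OF f(1)]) simp
  then obtain Z g where g: "negligible Z" "\<And>n. continuous_on UNIV (g n)" "\<And>x. x \<notin> Z \<Longrightarrow> (\<lambda>n. g n x) \<longlonglongrightarrow> f x"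
    unfolding measurable_on_def by auto
  define r where "r n x = \<psi> m x * k m (g n x)" for n :: nat and x
  have r_cont: "continuous_on UNIV (r n)" for n
    unfolding r_def by (intro continuous_on_mult cont_\<psi> continuous_on_compose2[OF cont_k g(2)]) auto
  have r_Cc: "r n \<in> Cc" for n
    unfolding Cc_def using r_cont by (auto simp: r_def \<psi>_def intro!: exI[of _ "real m + 1"])
  have bound: "\<bar>\<psi> m x * k m y\<bar> \<le> real m" for x y
    unfolding abs_mult using mult_mono[of "\<bar>\<psi> m x\<bar>" 1 "\<bar>k m y\<bar>" "real m"] \<psi>[of m x] k(2)[of m y] by simp
  have "\<forall>\<^sub>F n in sequentially. N (cls (\<lambda>x. h m x - r n x)) < e / 2"
  proof (rule N_dominated_convergence[where G = "\<lambda>x. 2 * real m"])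
    show "lmeas (\<lambda>x. h m x - r n x)" for n by (intro borel_measurable_diff h_meas lmeas_continuous[OF r_cont])
    show "mass (\<lambda>x. 2 * real m) < \<infinity>"
      using bounded_mem_X[of "\<lambda>x. 2 * real m" "2 * real m"] mem_X[of "\<lambda>x. 2 * real m"] by simp
    show "\<bar>h m x - r n x\<bar> \<le> 2 * real m" for n x
      using bound[of x "f x"] bound[of x "g n x"] unfolding h_def r_def by linarith
    have "AE x in lebesgue. x \<notin> Z" using g(1) by (simp add: negligible_iff_null_sets AE_not_in)
    then show "AE x in lebesgue. (\<lambda>n. h m x - r n x) \<longlonglongrightarrow> 0"
    proof eventually_elim
      fix x assume "x \<notin> Z"
      then have "(\<lambda>n. g n x) \<longlonglongrightarrow> f x" by (rule g(3))
      then have "(\<lambda>n. k m (g n x)) \<longlonglongrightarrow> k m (f x)"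
        using cont_k[of m] by (intro isCont_tendsto_compose[of "f x" "k m"]) (auto simp: continuous_on_eq_continuous_at)
      then have "(\<lambda>n. h m x - r n x) \<longlonglongrightarrow> h m x - h m x" unfolding r_def h_def by (intro tendsto_intros)
      then show "(\<lambda>n. h m x - r n x) \<longlonglongrightarrow> 0" by simp
    qed
  qed (use e in auto)
  then obtain n where n: "N (cls (\<lambda>x. h m x - r n x)) < e / 2"
    using eventually_happens'[OF sequentially_bot] by blast
  have hX: "cls (h m) \<in> X" by (rule bounded_mem_X[OF h_meas]) (use bound in \<open>auto simp: h_def\<close>)
  have "N (u - cls (r n)) \<le> N (u - cls (h m)) + N (cls (h m) - cls (r n))"
    by (rule N_triangle_diff[OF u hX Cc_mem_X[OF r_Cc]])
  also have "\<dots> < e / 2 + e / 2"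
    using m n by (simp add: f cls_diff h_meas Cc_lmeas[OF r_Cc])
  finally show ?thesis using that[OF r_Cc] by simp
qed

lemma Cc_translation_uniform:
  assumes "f \<in> Cc" "0 < e"
  obtains d where "0 < d" "\<And>s t. \<bar>s - t\<bar> < d \<Longrightarrow> N (translation s (cls f) - translation t (cls f)) \<le> e * W"
proof -
  obtain d where d: "0 < d" "\<And>x y. \<bar>x - y\<bar> < d \<Longrightarrow> \<bar>f x - f y\<bar> < e"
    using Cc_uniform[OF assms] by blast
  have f: "lmeas f" by (rule Cc_lmeas[OF assms(1)])
  have "N (translation s (cls f) - translation t (cls f)) \<le> e * W" if "\<bar>s - t\<bar> < d" for s t
  proof -
    have "translation s (cls f) - translation t (cls f) = cls (\<lambda>x. f (x + s) - f (x + t))"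
      unfolding translation_cls[OF f] by (rule cls_diff) (intro lmeas_shift f)+
    also have "N \<dots> \<le> e * W"
    proof (rule N_bounded_le)
      show "lmeas (\<lambda>x. f (x + s) - f (x + t))" by (intro borel_measurable_diff lmeas_shift f)
      show "\<bar>f (x + s) - f (x + t)\<bar> \<le> e" for x using d(2)[of "x + s" "x + t"] that by simp
    qed
    finally show ?thesis .
  qed
  then show ?thesis using that d(1) by blast
qed

lemma Cc_translation_mem_X: "f \<in> Cc \<Longrightarrow> translation t (cls f) \<in> X"
proof -
  assume f: "f \<in> Cc"
  obtain B R where "\<And>x. \<bar>f x\<bar> \<le> B" using Cc_bounded[OF f] by metis
  then show ?thesis unfolding translation_cls[OF Cc_lmeas[OF f]]
    by (intro bounded_mem_X[where B = B] lmeas_shift Cc_lmeas f)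
qed

lemma translation_strongly_continuous:
  assumes u: "u \<in> X" and e: "0 < e" and t: "0 \<le> t"
  obtains d where "0 < d" "\<And>s. 0 \<le> s \<Longrightarrow> \<bar>s - t\<bar> < d \<Longrightarrow> N (translation s u - translation t u) < e"
proof -
  obtain C where C: "1 \<le> C" "\<And>s v. 0 \<le> s \<Longrightarrow> s \<le> t + 1 \<Longrightarrow> v \<in> X \<Longrightarrow> translation s v \<in> X \<and> N (translation s v) \<le> C * N v"
    using translation_bound[of "t + 1"] by metis
  obtain f where f: "f \<in> Cc" "N (u - cls f) < e / (3 * C)" using Cc_dense[OF u, of "e / (3 * C)"] e C(1) by auto
  \<comment> \<open>W + 1 instead of W avoids showing that W is nonzero; C in the choice of f
    absorbs the operator norms for times up to t + 1.\<close>
  obtain d where d: "0 < d" "\<And>s t. \<bar>s - t\<bar> < d \<Longrightarrow> N (translation s (cls f) - translation t (cls f)) \<le> e / (3 * (W + 1)) * W"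
    using Cc_translation_uniform[OF f(1), of "e / (3 * (W + 1))"] e by (auto simp: add_nonneg_pos)
  have "N (translation s u - translation t u) < e" if s: "0 \<le> s" "\<bar>s - t\<bar> < min d 1" for s
  proof -
    have cf: "cls f \<in> X" by (rule Cc_mem_X[OF f(1)])
    have 1: "N (translation r u - translation r (cls f)) < e / 3" if "0 \<le> r" "r \<le> t + 1" for r
    proof -
      have "N (translation r u - translation r (cls f)) \<le> C * N (u - cls f)"
        using C(2)[OF that diff_mem_X[OF u cf]] by (simp add: translation_diff)
      also have "\<dots> < e / 3" using f(2) C(1) by (simp add: field_simps)
      finally show ?thesis .
    qed
    have "e / (3 * (W + 1)) * W \<le> e / 3"
    proof -
      have "W / (W + 1) \<le> 1" using W_nonneg by (simp add: divide_le_eq_1 add_nonneg_pos)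
      then have "e / 3 * (W / (W + 1)) \<le> e / 3 * 1" using e by (intro mult_left_mono) auto
      then show ?thesis by simp
    qed
    then have 2: "N (translation s (cls f) - translation t (cls f)) \<le> e / 3" by (rule order.trans[rotated]) (rule d(2), use s in simp)
    have mem: "translation r u \<in> X" if "0 \<le> r" for r using translation_mem_X that u by blast
    have mem': "translation r (cls f) \<in> X" for r by (rule Cc_translation_mem_X[OF f(1)])
    have "N (translation s u - translation t u) \<le> N (translation s u - translation s (cls f)) + N (translation s (cls f) - translation t u)"
      by (rule N_triangle_diff) (use mem mem' s t in auto)
    also have "N (translation s (cls f) - translation t u) \<le> N (translation s (cls f) - translation t (cls f)) + N (translation t (cls f) - translation t u)"
      by (rule N_triangle_diff) (use mem mem' s t in auto)
    also have "N (translation t (cls f) - translation t u) = N (translation t u - translation t (cls f))" by (rule N_minus_commute)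
    finally have tri: "N (translation s u - translation t u) \<le> N (translation s u - translation s (cls f)) + (N (translation s (cls f) - translation t (cls f)) + N (translation t u - translation t (cls f)))" by simp
    have "s \<le> t + 1" using s(2) by linarith
    then show ?thesis using tri 1[OF s(1)] 1[OF t] 2 by simp
  qed
  then show ?thesis using that[of "min d 1"] d(1) by simp
qed

text \<open>The 2n-periodic extension of f from [-n, n[ agrees with f inside the window and differs
  from it by at most 2B elsewhere, so only the weight outside the window counts. The window is
  chosen by the tail of \<rho>; it need not contain the support of f.\<close>

lemma periodic_points_dense: "dense_subset X N (periodic_points X translation)"
  unfolding dense_subset_iff
proof (intro conjI ballI allI impI)
  show "periodic_points X translation \<subseteq> X" by (auto simp: periodic_points_def)
  fix u e assume u: "u \<in> X" and e: "(0::real) < e"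
  obtain f where f: "f \<in> Cc" "N (u - cls f) < e / 2" using Cc_dense[OF u, of "e/2"] e by auto
  have fm: "lmeas f" by (rule Cc_lmeas[OF f(1)])
  obtain B R where B: "0 < B" "\<And>x. \<bar>f x\<bar> \<le> B" using Cc_bounded[OF f(1)] by metis
  have "(\<lambda>n. 2 * B * tail_norm n) \<longlonglongrightarrow> 2 * B * 0" by (intro tendsto_intros tail_norm_tendsto)
  then have "\<forall>\<^sub>F n in sequentially. 2 * B * tail_norm n < e / 2" using e by (intro order_tendstoD(2)) auto
  then have "\<forall>\<^sub>F n in sequentially. 2 * B * tail_norm n < e / 2 \<and> 1 \<le> n"
    using eventually_ge_at_top by (rule eventually_conj)
  then obtain n where n: "2 * B * tail_norm n < e / 2" "1 \<le> n"
    using eventually_happens'[OF sequentially_bot] by blast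
  define P where "P = 2 * real n"
  have P: "0 < P" using n by (simp add: P_def)
  define y where "y x = f (x - P * of_int \<lfloor>(x + real n) / P\<rfloor>)" for x
  have "f \<in> borel_measurable borel" using f(1) by (auto simp: Cc_def intro: borel_measurable_continuous_onI)
  then have y_meas: "lmeas y" unfolding y_def by (intro lmeas_borel) simp
  have yX: "cls y \<in> X" by (rule bounded_mem_X[OF y_meas]) (use B in \<open>auto simp: y_def\<close>)
  have "translation P (cls y) = cls y"
  proof -
    have "(x + P + real n) / P = (x + real n) / P + 1" for x using P by (simp add: field_simps)
    then have "x + P - P * of_int \<lfloor>(x + P + real n) / P\<rfloor> = x - P * of_int \<lfloor>(x + real n) / P\<rfloor>" for x
      by (simp add: distrib_left)
    then have "y (x + P) = y x" for x by (simp only: y_def)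
    \<comment> \<open>Equality holds pointwise and not only almost everywhere, because the argument
      of f in y is the representative of x modulo P in [-n, n[.\<close>
    then show ?thesis by (simp add: translation_cls[OF y_meas])
  qed
  then have "cls y \<in> periodic_points X translation" using yX P by (auto simp: periodic_points_def)
  moreover have "N (u - cls y) < e"
  proof -
    have "N (cls f - cls y) \<le> 2 * B * tail_norm n"
      unfolding cls_diff[OF fm y_meas]
    proof (rule N_tail_le)
      show "lmeas (\<lambda>x. f x - y x)" by (intro borel_measurable_diff fm y_meas)
      show "\<bar>f x - y x\<bar> \<le> 2 * B" for x
        using B(2)[of x] B(2)[of "x - P * of_int \<lfloor>(x + real n) / P\<rfloor>"] unfolding y_def by linarith
      fix x assume "\<bar>x\<bar> < real n"
      then have "\<lfloor>(x + real n) / P\<rfloor> = 0" using P by (intro floor_unique) (auto simp: P_def field_simps)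
      then show "f x - y x = 0" by (simp add: y_def)
    qed
    moreover have "N (u - cls y) \<le> N (u - cls f) + N (cls f - cls y)"
      by (rule N_triangle_diff[OF u Cc_mem_X[OF f(1)] yX])
    ultimately show ?thesis using f(2) n(1) by linarith
  qed
  ultimately show "\<exists>a\<in>periodic_points X translation. N (u - a) < e" by blast
qed

end

section \<open>Pettis integrability of orbits\<close>

lemma Cc_integrable:
  assumes "f \<in> Cc"
  shows "integrable lebesgue f"
proof -
  obtain B and R :: nat where B: "0 < B" "\<And>x. \<bar>f x\<bar> \<le> B" "\<And>x. real R < \<bar>x\<bar> \<Longrightarrow> f x = 0"
    using Cc_bounded[OF assms] by blast
  have "integrable lebesgue (\<lambda>x::real. B * indicator {-real R..real R} x)"
    by (intro integrable_mult_right integrable_real_indicator) auto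
  then show ?thesis
  proof (rule Bochner_Integration.integrable_bound[OF _ Cc_lmeas[OF assms]])
    show "AE x in lebesgue. norm (f x) \<le> norm (B * indicator {-real R..real R} x)"
    proof (rule AE_I2)
      fix x show "norm (f x) \<le> norm (B * indicator {-real R..real R} x)"
        using B(1) B(2)[of x] B(3)[of x] by (cases "\<bar>x\<bar> \<le> real R") (auto simp: abs_le_iff)
    qed
  qed
qed

lemma integrable_mult_bounded:
  assumes "integrable lebesgue g" "lmeas \<epsilon>" "\<And>t. \<bar>\<epsilon> t\<bar> \<le> 1"
  shows "integrable lebesgue (\<lambda>t. \<epsilon> t * g t)"
proof (rule Bochner_Integration.integrable_bound[OF assms(1)])
  show "lmeas (\<lambda>t. \<epsilon> t * g t)" using assms by (intro borel_measurable_times) auto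
  show "AE t in lebesgue. norm (\<epsilon> t * g t) \<le> norm (g t)"
    using assms(3) by (intro AE_I2) (simp add: abs_mult mult_left_le_one_le)
qed

text \<open>A function of the integer part of kt takes finitely many values where \<epsilon> lives,
  so its integral is a finite sum. The coefficients do not involve \<Phi>; the same ones serve for
  values of f and for values of a functional along the orbit, and thus the functional can be taken
  through the integral.\<close>

lemma integral_floor_step:
  fixes n k :: nat
  assumes k: "0 < k" and \<epsilon>: "lmeas \<epsilon>" "\<And>t. \<bar>\<epsilon> t\<bar> \<le> 1" "\<And>t. t \<notin> {-real n..<real n} \<Longrightarrow> \<epsilon> t = 0"
  shows "integrable lebesgue (\<lambda>t. \<epsilon> t * \<Phi> \<lfloor>real k * t\<rfloor>)"
    and "(LINT t|lebesgue. \<epsilon> t * \<Phi> \<lfloor>real k * t\<rfloor>) =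
      (\<Sum>j\<in>{-int (k*n)..<int (k*n)}. (LINT t|lebesgue. \<epsilon> t * (if \<lfloor>real k * t\<rfloor> = j then 1 else 0)) * \<Phi> j)"
proof -
  let ?J = "{-int (k*n)..<int (k*n)}"
  have eq: "\<epsilon> t * \<Phi> \<lfloor>real k * t\<rfloor> = (\<Sum>j\<in>?J. \<epsilon> t * (if \<lfloor>real k * t\<rfloor> = j then 1 else 0) * \<Phi> j)" for t
  proof (cases "t \<in> {-real n..<real n}")
    case True
    then have "- (real k * real n) \<le> real k * t" "real k * t < real k * real n"
      using k mult_left_mono[of "- real n" t "real k"] by auto
    then have "\<lfloor>real k * t\<rfloor> \<in> ?J" by (auto simp: le_floor_iff floor_less_iff)
    moreover have "(\<Sum>j\<in>?J. \<epsilon> t * (if \<lfloor>real k * t\<rfloor> = j then 1 else 0) * \<Phi> j) = (\<Sum>j\<in>?J. if j = \<lfloor>real k * t\<rfloor> then \<epsilon> t * \<Phi> j else 0)"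
      by (intro sum.cong) auto
    ultimately show ?thesis by (simp add: sum.delta')
  qed (simp add: \<epsilon>(3))
  have ind: "integrable lebesgue (\<lambda>t::real. indicator {-real n..<real n} t :: real)"
    by (intro integrable_real_indicator) auto
  have meas: "lmeas (\<lambda>t. if \<lfloor>real k * t\<rfloor> = j then 1 else 0)" for j
    by (rule lmeas_borel) simp
  have int: "integrable lebesgue (\<lambda>t. \<epsilon> t * (if \<lfloor>real k * t\<rfloor> = j then 1 else 0))" for j
  proof (rule Bochner_Integration.integrable_bound[OF ind])
    show "lmeas (\<lambda>t. \<epsilon> t * (if \<lfloor>real k * t\<rfloor> = j then 1 else 0))" by (intro borel_measurable_times \<epsilon> meas)
    show "AE t in lebesgue. norm (\<epsilon> t * (if \<lfloor>real k * t\<rfloor> = j then 1 else 0)) \<le> norm (indicator {-real n..<real n} t :: real)"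
    proof (rule AE_I2)
      fix t show "norm (\<epsilon> t * (if \<lfloor>real k * t\<rfloor> = j then 1 else 0)) \<le> norm (indicator {-real n..<real n} t :: real)"
        using \<epsilon>(2)[of t] \<epsilon>(3)[of t] by (cases "t \<in> {-real n..<real n}") auto
    qed
  qed
  show "integrable lebesgue (\<lambda>t. \<epsilon> t * \<Phi> \<lfloor>real k * t\<rfloor>)"
    unfolding eq by (intro Bochner_Integration.integrable_sum integrable_mult_left int)
  show "(LINT t|lebesgue. \<epsilon> t * \<Phi> \<lfloor>real k * t\<rfloor>) =
      (\<Sum>j\<in>?J. (LINT t|lebesgue. \<epsilon> t * (if \<lfloor>real k * t\<rfloor> = j then 1 else 0)) * \<Phi> j)"
    unfolding eq by (subst Bochner_Integration.integral_sum) (auto intro!: integrable_mult_left int)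
qed

lemma floor_div_near:
  assumes "0 < k"
  shows "\<bar>t - of_int \<lfloor>real k * t\<rfloor> / real k\<bar> \<le> 1 / real k"
proof -
  have "of_int \<lfloor>real k * t\<rfloor> \<le> real k * t" "real k * t \<le> of_int \<lfloor>real k * t\<rfloor> + 1" by linarith+
  then have "of_int \<lfloor>real k * t\<rfloor> / real k \<le> t" "t \<le> of_int \<lfloor>real k * t\<rfloor> / real k + 1 / real k"
    using assms by (simp_all add: field_simps)
  then show ?thesis by linarith
qed

lemma integral_abs_le_const:
  fixes n :: nat
  assumes "integrable lebesgue g" "\<And>t. \<bar>g t\<bar> \<le> c" "\<And>t. t \<notin> {-real n..<real n} \<Longrightarrow> g t = 0"
  shows "\<bar>LINT t|lebesgue. g t\<bar> \<le> c * (2 * real n)"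
proof -
  have "\<bar>LINT t|lebesgue. g t\<bar> \<le> (LINT t|lebesgue. c * indicator {-real n..<real n} t)"
  proof (rule order.trans[OF integral_abs_bound integral_mono])
    show "integrable lebesgue (\<lambda>t::real. c * indicator {-real n..<real n} t)"
      by (intro integrable_mult_right integrable_real_indicator) auto
    fix t show "\<bar>g t\<bar> \<le> c * indicator {-real n..<real n} t"
      using assms(2)[of t] assms(3)[of t] by (cases "t \<in> {-real n..<real n}") auto
  qed (use assms in auto)
  also have "\<dots> = c * (2 * real n)" by simp
  finally show ?thesis .
qed

text \<open>The sign \<sigma> treats both orbits at once: 1 for the semigroup and -1 for its right
  inverses.\<close>

locale orbit_in_Cc = finite_weighted_Lp +
  fixes f :: "real \<Rightarrow> real" and \<sigma> :: real
  assumes f_Cc: "f \<in> Cc" and \<sigma>: "\<bar>\<sigma>\<bar> = 1"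
begin

text \<open>Computed pointwise in x, this is the candidate for the vector integral of \<epsilon> t
  times the orbit of f at time t.\<close>

definition conv :: "(real \<Rightarrow> real) \<Rightarrow> real \<Rightarrow> real" where
  "conv \<epsilon> x = (LINT t|lebesgue. \<epsilon> t * f (x + \<sigma> * t))"

definition L :: real where
  "L = (LINT t|lebesgue. \<bar>f t\<bar>)"

lemma \<sigma>_nz: "\<sigma> \<noteq> 0"
  using \<sigma> by auto

lemma f_meas: "lmeas f"
  by (rule Cc_lmeas[OF f_Cc])

lemma orbit_integrable: "integrable lebesgue (\<lambda>t. f (x + \<sigma> * t))"
  using lebesgue_integrable_real_affine_iff[OF \<sigma>_nz] Cc_integrable[OF f_Cc] by blast

lemma conv_integrable:
  assumes "lmeas \<epsilon>" "\<And>t. \<bar>\<epsilon> t\<bar> \<le> 1"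
  shows "integrable lebesgue (\<lambda>t. \<epsilon> t * f (x + \<sigma> * t))"
  by (rule integrable_mult_bounded[OF orbit_integrable assms])

lemma conv_bounded:
  assumes "lmeas \<epsilon>" "\<And>t. \<bar>\<epsilon> t\<bar> \<le> 1"
  shows "\<bar>conv \<epsilon> x\<bar> \<le> L"
proof -
  have "\<bar>conv \<epsilon> x\<bar> \<le> (LINT t|lebesgue. \<bar>f (x + \<sigma> * t)\<bar>)"
    unfolding conv_def
  proof (rule order.trans[OF integral_abs_bound integral_mono])
    show "\<bar>\<epsilon> t * f (x + \<sigma> * t)\<bar> \<le> \<bar>f (x + \<sigma> * t)\<bar>" for t
      using assms(2) by (simp add: abs_mult mult_left_le_one_le)
  qed (intro integrable_abs conv_integrable assms orbit_integrable)+
  also have "\<dots> = L"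
    using lebesgue_integral_real_affine[OF \<sigma>_nz, of "\<lambda>t. \<bar>f t\<bar>" x] \<sigma> by (simp add: L_def)
  finally show ?thesis .
qed

lemma conv_meas:
  assumes "lmeas \<epsilon>" "\<And>t. \<bar>\<epsilon> t\<bar> \<le> 1"
  shows "lmeas (conv \<epsilon>)"
proof (rule lmeas_continuous)
  obtain B and R :: nat where B: "0 < B" "\<And>x. \<bar>f x\<bar> \<le> B" "\<And>x. real R < \<bar>x\<bar> \<Longrightarrow> f x = 0"
    using Cc_bounded[OF f_Cc] by blast
  show "continuous_on UNIV (conv \<epsilon>)"
    unfolding continuous_on_iff dist_real_def
  proof (intro ballI allI impI)
    fix x e :: real assume e: "0 < e"
    \<comment> \<open>The integrand changes only where x + \<sigma>t lies in an interval of length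
      2(R + 1), by at most \<eta>; the additional 1 makes the final inequality strict.\<close>
    define \<eta> where "\<eta> = e / (2 * (real R + 1) + 1)"
    have \<eta>: "0 < \<eta>" using e by (simp add: \<eta>_def add_nonneg_pos)
    obtain d where d: "0 < d" "\<And>x y. \<bar>x - y\<bar> < d \<Longrightarrow> \<bar>f x - f y\<bar> < \<eta>"
      using Cc_uniform[OF f_Cc \<eta>] by blast
    have "\<bar>conv \<epsilon> y - conv \<epsilon> x\<bar> < e" if y: "\<bar>y - x\<bar> < min d 1" for y
    proof -
      let ?g = "\<lambda>s. \<eta> * indicator {-(real R + 1)..real R + 1} s"
      have gint: "integrable lebesgue ?g"
        by (intro integrable_mult_right integrable_real_indicator) auto
      have "conv \<epsilon> y - conv \<epsilon> x = (LINT t|lebesgue. \<epsilon> t * f (y + \<sigma> * t) - \<epsilon> t * f (x + \<sigma> * t))"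
        unfolding conv_def by (rule Bochner_Integration.integral_diff[symmetric]) (rule conv_integrable[OF assms])+
      also have "\<bar>\<dots>\<bar> \<le> (LINT t|lebesgue. ?g (x + \<sigma> * t))"
      proof (rule order.trans[OF integral_abs_bound integral_mono])
        show "integrable lebesgue (\<lambda>t. \<bar>\<epsilon> t * f (y + \<sigma> * t) - \<epsilon> t * f (x + \<sigma> * t)\<bar>)"
          by (intro integrable_abs Bochner_Integration.integrable_diff conv_integrable[OF assms])
        show "integrable lebesgue (\<lambda>t. ?g (x + \<sigma> * t))"
          using lebesgue_integrable_real_affine_iff[OF \<sigma>_nz, of ?g x] gint by simp
        fix t
        have "\<bar>\<epsilon> t * f (y + \<sigma> * t) - \<epsilon> t * f (x + \<sigma> * t)\<bar> \<le> 1 * \<bar>f (y + \<sigma> * t) - f (x + \<sigma> * t)\<bar>"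
          unfolding right_diff_distrib[symmetric] abs_mult using assms(2)[of t] by (intro mult_right_mono) auto
        also have "\<dots> \<le> ?g (x + \<sigma> * t)"
        proof (cases "\<bar>x + \<sigma> * t\<bar> \<le> real R + 1")
          case True
          then show ?thesis using d(2)[of "y + \<sigma> * t" "x + \<sigma> * t"] y by (auto simp: abs_le_iff)
        next
          case False
          then have "f (y + \<sigma> * t) = 0" "f (x + \<sigma> * t) = 0" using y by (auto intro!: B(3))
          then show ?thesis using \<eta> by simp
        qed
        finally show "\<bar>\<epsilon> t * f (y + \<sigma> * t) - \<epsilon> t * f (x + \<sigma> * t)\<bar> \<le> ?g (x + \<sigma> * t)" .
      qed
      also have "\<dots> = (LINT s|lebesgue. ?g s)"
        by (subst lebesgue_integral_real_affine[OF \<sigma>_nz, of ?g x]) (simp only: \<sigma> scaleR_one)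
      also have "\<dots> = \<eta> * (2 * (real R + 1))" by simp
      also have "\<dots> < \<eta> * (2 * (real R + 1) + 1)" using \<eta> by (intro mult_strict_left_mono) auto
      also have "\<dots> = e" using of_nat_0_le_iff[of R] by (simp add: \<eta>_def add_nonneg_pos)
      finally show ?thesis .
    qed
    then show "\<exists>d>0. \<forall>y\<in>UNIV. \<bar>y - x\<bar> < d \<longrightarrow> \<bar>conv \<epsilon> y - conv \<epsilon> x\<bar> < e"
      using d(1) by (intro exI[of _ "min d 1"]) auto
  qed
qed

lemma conv_mem_X:
  assumes "lmeas \<epsilon>" "\<And>t. \<bar>\<epsilon> t\<bar> \<le> 1"
  shows "cls (conv \<epsilon>) \<in> X"
  by (rule bounded_mem_X[OF conv_meas conv_bounded]) (use assms in auto)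

context
  fixes \<phi> assumes \<phi>: "\<phi> \<in> dual_space X N"
begin

definition G :: "real \<Rightarrow> real" where
  "G t = \<phi> (translation (\<sigma> * t) (cls f))"

lemma G_bounded: "\<exists>c. \<forall>t. \<bar>G t\<bar> \<le> c"
proof -
  obtain K where K: "0 < K" "\<And>u. u \<in> X \<Longrightarrow> \<bar>\<phi> u\<bar> \<le> K * N u" using dual_bound[OF \<phi>] by blast
  obtain B R where B: "\<And>x. \<bar>f x\<bar> \<le> B" using Cc_bounded[OF f_Cc] by metis
  have "\<bar>G t\<bar> \<le> K * (B * W)" for t
  proof -
    have "\<bar>G t\<bar> \<le> K * N (translation (\<sigma> * t) (cls f))"
      unfolding G_def by (rule K(2)[OF Cc_translation_mem_X[OF f_Cc]])
    also have "\<dots> \<le> K * (B * W)"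
      unfolding translation_cls[OF f_meas] using K(1) B by (intro mult_left_mono N_bounded_le lmeas_shift f_meas) auto
    finally show ?thesis .
  qed
  then show ?thesis by blast
qed

text \<open>One d for G and for f, because the Riemann sums of both are formed with the same
  mesh.\<close>

lemma G_uniform:
  assumes "0 < e"
  obtains d where "0 < d" "\<And>s t. \<bar>s - t\<bar> < d \<Longrightarrow> \<bar>G s - G t\<bar> < e" "\<And>x y. \<bar>x - y\<bar> < d \<Longrightarrow> \<bar>f x - f y\<bar> < e"
proof -
  obtain K where K: "0 < K" "\<And>u. u \<in> X \<Longrightarrow> \<bar>\<phi> u\<bar> \<le> K * N u" using dual_bound[OF \<phi>] by blast
  define \<eta> where "\<eta> = e / (K * W + 1)"
  have KW: "0 < K * W + 1" using K(1) by (simp add: add_nonneg_pos)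
  have \<eta>: "0 < \<eta>" using assms KW by (simp add: \<eta>_def)
  obtain d where d: "0 < d" "\<And>s t. \<bar>s - t\<bar> < d \<Longrightarrow> N (translation s (cls f) - translation t (cls f)) \<le> \<eta> * W"
    using Cc_translation_uniform[OF f_Cc \<eta>] by blast
  obtain d' where d': "0 < d'" "\<And>x y. \<bar>x - y\<bar> < d' \<Longrightarrow> \<bar>f x - f y\<bar> < e"
    using Cc_uniform[OF f_Cc assms] by blast
  have "\<bar>G s - G t\<bar> < e" if "\<bar>s - t\<bar> < d" for s t
  proof -
    have "\<bar>\<sigma> * s - \<sigma> * t\<bar> < d" using that \<sigma> by (simp add: abs_mult flip: right_diff_distrib)
    note le = d(2)[OF this]
    have "\<bar>G s - G t\<bar> = \<bar>\<phi> (translation (\<sigma> * s) (cls f) - translation (\<sigma> * t) (cls f))\<bar>"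
      unfolding G_def by (subst dual_diff[OF \<phi>]) (rule Cc_translation_mem_X[OF f_Cc] refl)+
    also have "\<dots> \<le> K * N (translation (\<sigma> * s) (cls f) - translation (\<sigma> * t) (cls f))"
      by (rule K(2)[OF diff_mem_X]) (rule Cc_translation_mem_X[OF f_Cc])+
    also have "\<dots> \<le> K * (\<eta> * W)" using le K(1) by (intro mult_left_mono) auto
    also have "\<dots> = \<eta> * (K * W)" by simp
    also have "\<dots> < \<eta> * (K * W + 1)" using \<eta> by (intro mult_strict_left_mono) auto
    also have "\<dots> = e" using KW by (simp add: \<eta>_def)
    finally show ?thesis .
  qed
  then show ?thesis using that[of "min d d'"] d(1) d' by simp
qed

lemma G_meas: "lmeas G"
proof (rule lmeas_continuous)
  show "continuous_on UNIV G"
    unfolding continuous_on_iff dist_real_def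
  proof (intro ballI allI impI)
    fix x e :: real assume "0 < e"
    then obtain d where "0 < d" "\<And>s t. \<bar>s - t\<bar> < d \<Longrightarrow> \<bar>G s - G t\<bar> < e"
      using G_uniform by metis
    then show "\<exists>d>0. \<forall>y\<in>UNIV. \<bar>y - x\<bar> < d \<longrightarrow> \<bar>G y - G x\<bar> < e" by blast
  qed
qed

text \<open>For bounded times the identity follows by comparing both sides with Riemann sums.\<close>

lemma dual_conv_bounded_support:
  fixes n :: nat
  assumes \<epsilon>: "lmeas \<epsilon>" "\<And>t. \<bar>\<epsilon> t\<bar> \<le> 1" "\<And>t. t \<notin> {-real n..<real n} \<Longrightarrow> \<epsilon> t = 0"
  shows "\<phi> (cls (conv \<epsilon>)) = (LINT t|lebesgue. \<epsilon> t * G t)" "integrable lebesgue (\<lambda>t. \<epsilon> t * G t)"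
proof -
  obtain K where K: "0 < K" "\<And>u. u \<in> X \<Longrightarrow> \<bar>\<phi> u\<bar> \<le> K * N u" using dual_bound[OF \<phi>] by blast
  obtain c where c: "\<And>t. \<bar>G t\<bar> \<le> c" using G_bounded by blast
  have ind: "integrable lebesgue (\<lambda>t::real. c * indicator {-real n..<real n} t)"
    by (intro integrable_mult_right integrable_real_indicator) auto
  show int: "integrable lebesgue (\<lambda>t. \<epsilon> t * G t)"
  proof (rule Bochner_Integration.integrable_bound[OF ind])
    show "lmeas (\<lambda>t. \<epsilon> t * G t)" by (intro borel_measurable_times \<epsilon> G_meas)
    show "AE t in lebesgue. norm (\<epsilon> t * G t) \<le> norm (c * indicator {-real n..<real n} t)"
    proof (rule AE_I2)
      fix t
      have "\<bar>\<epsilon> t\<bar> * \<bar>G t\<bar> \<le> 1 * c" using \<epsilon>(2)[of t] c[of t] by (intro mult_mono) auto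
      then show "norm (\<epsilon> t * G t) \<le> norm (c * indicator {-real n..<real n} t)"
        using \<epsilon>(3)[of t] by (cases "t \<in> {-real n..<real n}") (auto simp: abs_mult)
    qed
  qed
  have "\<bar>\<phi> (cls (conv \<epsilon>)) - (LINT t|lebesgue. \<epsilon> t * G t)\<bar> \<le> e" if e: "0 < e" for e
  proof -
    \<comment> \<open>The two errors are at most \<eta> * 2n, from G, and K * \<eta> * 2n * W, from
      f. They add up to the product in the denominator, and the additional 1 keeps it
      positive.\<close>
    define \<eta> where "\<eta> = e / (2 * real n * (K * W + 1) + 1)"
    have pos: "0 < 2 * real n * (K * W + 1) + 1"
      using K(1) by (intro add_nonneg_pos mult_nonneg_nonneg add_nonneg_nonneg) auto
    have \<eta>: "0 < \<eta>" using e pos by (simp add: \<eta>_def)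
    obtain d where d: "0 < d" "\<And>s t. \<bar>s - t\<bar> < d \<Longrightarrow> \<bar>G s - G t\<bar> < \<eta>" "\<And>x y. \<bar>x - y\<bar> < d \<Longrightarrow> \<bar>f x - f y\<bar> < \<eta>"
      using G_uniform[OF \<eta>] by blast
    obtain k :: nat where k: "0 < k" "1 / real k < d"
      using d(1) by (metis reals_Archimedean inverse_eq_divide zero_less_Suc)
    define r where "r j = of_int j / real k" for j :: int
    have near: "\<bar>t - r \<lfloor>real k * t\<rfloor>\<bar> < d" for t
      using floor_div_near[OF k(1), of t] k(2) by (simp add: r_def)
    define a where "a j = (LINT t|lebesgue. \<epsilon> t * (if \<lfloor>real k * t\<rfloor> = j then 1 else 0))" for j
    define J where "J = {-int (k*n)..<int (k*n)}"
    \<comment> \<open>A finite combination of translates of f, to which \<phi> applies term by term.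
      The weights \<open>a j\<close> integrate \<epsilon> exactly over the cells, so only f and G
      are discretised.\<close>
    define y where "y x = (\<Sum>j\<in>J. a j * f (x + \<sigma> * r j))" for x
    note step1 = integral_floor_step(1)[OF k(1) \<epsilon>]
    have step2: "(LINT t|lebesgue. \<epsilon> t * \<Phi> \<lfloor>real k * t\<rfloor>) = (\<Sum>j\<in>J. a j * \<Phi> j)" for \<Phi>
      unfolding a_def J_def by (rule integral_floor_step(2)[OF k(1) \<epsilon>])
    have y: "y x = (LINT t|lebesgue. \<epsilon> t * f (x + \<sigma> * r \<lfloor>real k * t\<rfloor>))" for x
      unfolding y_def using step2[of "\<lambda>j. f (x + \<sigma> * r j)"] by simp
    have sh_meas: "lmeas (\<lambda>x. f (x + \<sigma> * r j))" for j by (rule lmeas_shift[OF f_meas])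
    have y_meas: "lmeas y" unfolding y_def[abs_def] by (intro borel_measurable_sum borel_measurable_times sh_meas) auto
    have y_cls: "cls y = (\<Sum>j\<in>J. a j *\<^sub>R translation (\<sigma> * r j) (cls f))"
    proof -
      have "(\<Sum>j\<in>J. a j *\<^sub>R translation (\<sigma> * r j) (cls f)) = (\<Sum>j\<in>J. cls (\<lambda>x. a j * f (x + \<sigma> * r j)))"
        by (simp only: translation_cls[OF f_meas] cls_scaleR[OF sh_meas])
      also have "\<dots> = cls y" unfolding y_def[abs_def]
        by (rule cls_sum) (auto simp: J_def intro!: borel_measurable_times sh_meas)
      finally show ?thesis ..
    qed
    have yX: "cls y \<in> X" unfolding y_cls by (intro sum_mem_X scaleR_mem_X Cc_translation_mem_X f_Cc)
    have "\<phi> (cls y) = (\<Sum>j\<in>J. a j * G (r j))"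
    proof -
      have "\<phi> (\<Sum>j\<in>J'. a j *\<^sub>R translation (\<sigma> * r j) (cls f)) = (\<Sum>j\<in>J'. a j * G (r j))" if "finite J'" for J'
        using that
      proof (induction J' rule: finite_induct)
        case empty
        then show ?case using dual_zero[OF \<phi>] by simp
      next
        case (insert j J')
        have "a j *\<^sub>R translation (\<sigma> * r j) (cls f) \<in> X" "(\<Sum>j\<in>J'. a j *\<^sub>R translation (\<sigma> * r j) (cls f)) \<in> X"
          by (intro sum_mem_X scaleR_mem_X Cc_translation_mem_X f_Cc)+
        then show ?case using insert
          by (simp add: dual_add[OF \<phi>] dual_scaleR[OF \<phi> Cc_translation_mem_X[OF f_Cc]] G_def)
      qed
      then show ?thesis unfolding y_cls by (simp add: J_def)
    qed
    also have "\<dots> = (LINT t|lebesgue. \<epsilon> t * G (r \<lfloor>real k * t\<rfloor>))"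
      using step2[of "\<lambda>j. G (r j)"] by simp
    finally have \<phi>y: "\<phi> (cls y) = (LINT t|lebesgue. \<epsilon> t * G (r \<lfloor>real k * t\<rfloor>))" .
    have 1: "\<bar>\<phi> (cls y) - (LINT t|lebesgue. \<epsilon> t * G t)\<bar> \<le> \<eta> * (2 * real n)"
    proof -
      have "\<phi> (cls y) - (LINT t|lebesgue. \<epsilon> t * G t) = (LINT t|lebesgue. \<epsilon> t * G (r \<lfloor>real k * t\<rfloor>) - \<epsilon> t * G t)"
        unfolding \<phi>y by (rule Bochner_Integration.integral_diff[symmetric, OF step1 int])
      also have "\<bar>\<dots>\<bar> \<le> \<eta> * (2 * real n)"
      proof (rule integral_abs_le_const)
        fix t
        have "\<bar>\<epsilon> t\<bar> * \<bar>G (r \<lfloor>real k * t\<rfloor>) - G t\<bar> \<le> 1 * \<eta>"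
          using \<epsilon>(2)[of t] d(2)[of "r \<lfloor>real k * t\<rfloor>" t] near[of t] by (intro mult_mono) (auto simp: abs_minus_commute)
        then show "\<bar>\<epsilon> t * G (r \<lfloor>real k * t\<rfloor>) - \<epsilon> t * G t\<bar> \<le> \<eta>" by (simp add: abs_mult flip: right_diff_distrib)
      qed (use \<epsilon>(3) in \<open>auto intro: Bochner_Integration.integrable_diff[OF step1 int]\<close>)
      finally show ?thesis .
    qed
    have 2: "\<bar>\<phi> (cls (conv \<epsilon>)) - \<phi> (cls y)\<bar> \<le> K * (\<eta> * (2 * real n) * W)"
    proof -
      have cX: "cls (conv \<epsilon>) \<in> X" by (rule conv_mem_X[OF \<epsilon>(1,2)])
      have "\<bar>\<phi> (cls (conv \<epsilon>)) - \<phi> (cls y)\<bar> \<le> K * N (cls (conv \<epsilon>) - cls y)"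
        using K(2)[OF diff_mem_X[OF cX yX]] by (simp add: dual_diff[OF \<phi> cX yX])
      also have "N (cls (conv \<epsilon>) - cls y) \<le> \<eta> * (2 * real n) * W"
        unfolding cls_diff[OF conv_meas[OF \<epsilon>(1,2)] y_meas]
      proof (rule N_bounded_le)
        show "lmeas (\<lambda>x. conv \<epsilon> x - y x)" by (intro borel_measurable_diff conv_meas \<epsilon> y_meas)
        fix x
        have "conv \<epsilon> x - y x = (LINT t|lebesgue. \<epsilon> t * f (x + \<sigma> * t) - \<epsilon> t * f (x + \<sigma> * r \<lfloor>real k * t\<rfloor>))"
          unfolding conv_def y by (rule Bochner_Integration.integral_diff[symmetric, OF conv_integrable[OF \<epsilon>(1,2)] step1])
        also have "\<bar>\<dots>\<bar> \<le> \<eta> * (2 * real n)"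
        proof (rule integral_abs_le_const)
          fix t
          have "\<bar>x + \<sigma> * t - (x + \<sigma> * r \<lfloor>real k * t\<rfloor>)\<bar> = \<bar>t - r \<lfloor>real k * t\<rfloor>\<bar>"
            using \<sigma> by (simp add: abs_mult flip: right_diff_distrib)
          then have "\<bar>\<epsilon> t\<bar> * \<bar>f (x + \<sigma> * t) - f (x + \<sigma> * r \<lfloor>real k * t\<rfloor>)\<bar> \<le> 1 * \<eta>"
            using \<epsilon>(2)[of t] d(3)[of "x + \<sigma> * t" "x + \<sigma> * r \<lfloor>real k * t\<rfloor>"] near[of t] by (intro mult_mono) auto
          then show "\<bar>\<epsilon> t * f (x + \<sigma> * t) - \<epsilon> t * f (x + \<sigma> * r \<lfloor>real k * t\<rfloor>)\<bar> \<le> \<eta>"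
            by (simp add: abs_mult flip: right_diff_distrib)
        qed (use \<epsilon>(3) in \<open>auto intro!: Bochner_Integration.integrable_diff conv_integrable[OF \<epsilon>(1,2)] step1\<close>)
        finally show "\<bar>conv \<epsilon> x - y x\<bar> \<le> \<eta> * (2 * real n)" .
      qed
      finally show ?thesis using K(1) by simp
    qed
    have "\<bar>\<phi> (cls (conv \<epsilon>)) - (LINT t|lebesgue. \<epsilon> t * G t)\<bar> \<le> \<eta> * (2 * real n * (K * W + 1))"
      using 1 2 by (simp add: algebra_simps)
    also have "\<dots> \<le> \<eta> * (2 * real n * (K * W + 1) + 1)" using \<eta> by (intro mult_left_mono) auto
    also have "\<dots> = e" using pos by (simp add: \<eta>_def)
    finally show ?thesis .
  qed
  then have "\<bar>\<phi> (cls (conv \<epsilon>)) - (LINT t|lebesgue. \<epsilon> t * G t)\<bar> \<le> 0" by (rule field_le_epsilon) simp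
  then show "\<phi> (cls (conv \<epsilon>)) = (LINT t|lebesgue. \<epsilon> t * G t)" by simp
qed

text \<open>Taking for \<epsilon> the sign of G, cut off to [-n, n[, turns the integral of |G| over
  that interval into \<phi> of \<open>conv \<epsilon>\<close>. This is at most K * L * W,
  independently of n.\<close>

lemma G_integrable: "integrable lebesgue G"
proof -
  obtain K where K: "0 < K" "\<And>u. u \<in> X \<Longrightarrow> \<bar>\<phi> u\<bar> \<le> K * N u" using dual_bound[OF \<phi>] by blast
  have Gabs: "(\<lambda>t. ennreal \<bar>G t\<bar>) \<in> borel_measurable lebesgue"
    by (intro measurable_compose[OF _ measurable_ennreal] borel_measurable_abs G_meas)
  have "(\<integral>\<^sup>+t. ennreal \<bar>G t\<bar> \<partial>lebesgue) \<le> ennreal (K * (L * W))"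
  proof (rule nn_integral_blocks[OF Gabs zero_less_one])
    fix n :: nat
    define \<epsilon> where "\<epsilon> t = sgn (G t) * indicator {-real n..<real n} t" for t
    have \<epsilon>: "lmeas \<epsilon>" "\<And>t. \<bar>\<epsilon> t\<bar> \<le> 1" "\<And>t. t \<notin> {-real n..<real n} \<Longrightarrow> \<epsilon> t = 0"
      unfolding \<epsilon>_def
      by (intro borel_measurable_times borel_measurable_indicator measurable_compose[OF G_meas borel_measurable_sgn])
        (auto simp: sgn_if indicator_def)
    have \<epsilon>G: "\<epsilon> t * G t = \<bar>G t\<bar> * indicator {-real n..<real n} t" for t
      by (simp add: \<epsilon>_def sgn_if)
    have m: "(\<lambda>t. ennreal (\<bar>G t\<bar> * indicator {-real n..<real n} t)) \<in> borel_measurable lebesgue"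
      by (intro measurable_compose[OF _ measurable_ennreal] borel_measurable_times borel_measurable_abs G_meas borel_measurable_indicator) simp
    have "(\<Sum>k\<in>{-int n..<int n}. \<integral>\<^sup>+t. ennreal \<bar>G t\<bar> * indicator (block 1 k) t \<partial>lebesgue)
       = (\<Sum>k\<in>{-int n..<int n}. \<integral>\<^sup>+t. ennreal (\<bar>G t\<bar> * indicator {-real n..<real n} t) * indicator (block 1 k) t \<partial>lebesgue)"
    proof (intro sum.cong refl nn_integral_cong)
      fix k t assume k: "k \<in> {-int n..<int n}"
      have "- real n \<le> real_of_int k" "real_of_int k + 1 \<le> real n" using k
        by (auto simp flip: of_int_le_iff[where ?'a = real])
      then show "ennreal \<bar>G t\<bar> * indicator (block 1 k) t = ennreal (\<bar>G t\<bar> * indicator {-real n..<real n} t) * indicator (block 1 k) t"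
        by (auto simp: indicator_def)
    qed
    also have "\<dots> \<le> (\<integral>\<^sup>+t. ennreal (\<bar>G t\<bar> * indicator {-real n..<real n} t) \<partial>lebesgue)"
      by (rule nn_integral_blocks_ge[OF m zero_less_one]) simp
    also have "\<dots> = ennreal (LINT t|lebesgue. \<epsilon> t * G t)"
      using dual_conv_bounded_support(2)[OF \<epsilon>] unfolding \<epsilon>G by (intro nn_integral_eq_integral) auto
    also have "(LINT t|lebesgue. \<epsilon> t * G t) = \<phi> (cls (conv \<epsilon>))" by (rule dual_conv_bounded_support(1)[OF \<epsilon>, symmetric])
    also have "ennreal \<dots> \<le> ennreal (K * (L * W))"
    proof (rule ennreal_leI)
      have "\<phi> (cls (conv \<epsilon>)) \<le> K * N (cls (conv \<epsilon>))" using K(2)[OF conv_mem_X[OF \<epsilon>(1,2)]] by simp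
      also have "\<dots> \<le> K * (L * W)"
        using K(1) by (intro mult_left_mono N_bounded_le conv_meas conv_bounded \<epsilon>) auto
      finally show "\<phi> (cls (conv \<epsilon>)) \<le> K * (L * W)" .
    qed
    finally show "(\<Sum>k\<in>{-int n..<int n}. \<integral>\<^sup>+t. ennreal \<bar>G t\<bar> * indicator (block 1 k) t \<partial>lebesgue) \<le> ennreal (K * (L * W))" .
  qed
  then show ?thesis by (intro integrableI_bounded G_meas) (simp add: le_less_trans)
qed

text \<open>The part of E within [-m, m[ is covered by \<open>dual_conv_bounded_support\<close>. For
  the rest, with m = n + R and R bounding the support of f, the convolution vanishes on ]-n, n[ and
  is bounded by L, so its norm is at most L times \<open>tail_norm n\<close>; on the other side
  remains a tail of the integrable function G.\<close>

lemma dual_conv_indicator: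
  assumes E: "E \<in> sets lebesgue"
  shows "\<phi> (cls (conv (indicator E))) = (LINT t|lebesgue. indicator E t * G t)"
proof -
  obtain K where K: "0 < K" "\<And>u. u \<in> X \<Longrightarrow> \<bar>\<phi> u\<bar> \<le> K * N u" using dual_bound[OF \<phi>] by blast
  obtain B and R :: nat where "0 < B" and B: "\<And>x. \<bar>f x\<bar> \<le> B" "\<And>x. real R < \<bar>x\<bar> \<Longrightarrow> f x = 0"
    using Cc_bounded[OF f_Cc] by blast
  define T where "T n = K * (L * tail_norm n) + (LINT t|lebesgue. \<bar>G t\<bar> * indicator (outside (n + R)) t)" for n
  have bound: "\<bar>\<phi> (cls (conv (indicator E))) - (LINT t|lebesgue. indicator E t * G t)\<bar> \<le> T n" for n
  proof -
    define m where "m = n + R"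
    define E1 where "E1 = E \<inter> {-real m..<real m}"
    define E2 where "E2 = E - {-real m..<real m}"
    have sets: "E1 \<in> sets lebesgue" "E2 \<in> sets lebesgue" using E by (auto simp: E1_def E2_def)
    have ind: "lmeas (indicator A)" "\<bar>indicator A t :: real\<bar> \<le> 1" if "A \<in> sets lebesgue" for A and t :: real
      using that by (simp_all add: indicator_def)
    have split: "indicator E t = indicator E1 t + (indicator E2 t :: real)" for t by (auto simp: E1_def E2_def indicator_def)
    have E1_supp: "t \<notin> {-real m..<real m} \<Longrightarrow> indicator E1 t = (0::real)" for t by (simp add: E1_def)
    have conv_split: "cls (conv (indicator E)) = cls (conv (indicator E1)) + cls (conv (indicator E2))"
    proof -
      have "conv (indicator E) x = conv (indicator E1) x + conv (indicator E2) x" for x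
        unfolding conv_def split distrib_right
        by (rule Bochner_Integration.integral_add) (intro conv_integrable ind sets)+
      then have "conv (indicator E) = (\<lambda>x. conv (indicator E1) x + conv (indicator E2) x)" by blast
      then show ?thesis by (simp only: cls_add[OF conv_meas[OF ind[OF sets(1)]] conv_meas[OF ind[OF sets(2)]]])
    qed
    have int: "integrable lebesgue (\<lambda>t. indicator A t * G t)" if "A \<in> sets lebesgue" for A
      using integrable_mult_bounded[OF G_integrable ind[OF that]] .
    have "\<phi> (cls (conv (indicator E))) = \<phi> (cls (conv (indicator E1))) + \<phi> (cls (conv (indicator E2)))"
      unfolding conv_split by (rule dual_add[OF \<phi>]) (intro conv_mem_X ind sets)+
    moreover have "\<phi> (cls (conv (indicator E1))) = (LINT t|lebesgue. indicator E1 t * G t)"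
      by (rule dual_conv_bounded_support(1)[OF ind(1)[OF sets(1)] ind(2)[OF sets(1)] E1_supp])
    moreover have "(LINT t|lebesgue. indicator E t * G t) = (LINT t|lebesgue. indicator E1 t * G t) + (LINT t|lebesgue. indicator E2 t * G t)"
      unfolding split distrib_right by (rule Bochner_Integration.integral_add) (intro int sets)+
    moreover have "\<bar>LINT t|lebesgue. indicator E2 t * G t\<bar> \<le> (LINT t|lebesgue. \<bar>G t\<bar> * indicator (outside m) t)"
    proof (rule order.trans[OF integral_abs_bound integral_mono])
      show "integrable lebesgue (\<lambda>t. \<bar>indicator E2 t * G t\<bar>)" using int[OF sets(2)] by simp
      show "integrable lebesgue (\<lambda>t. \<bar>G t\<bar> * indicator (outside m) t)"
        using integrable_mult_bounded[OF integrable_abs[OF G_integrable] ind[OF outside_measurable[of m]]] by (simp add: mult.commute)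
      show "\<bar>indicator E2 t * G t\<bar> \<le> \<bar>G t\<bar> * indicator (outside m) t" for t
        by (auto simp: E2_def indicator_def)
    qed
    moreover have "\<bar>\<phi> (cls (conv (indicator E2)))\<bar> \<le> K * (L * tail_norm n)"
    proof -
      have "\<bar>\<phi> (cls (conv (indicator E2)))\<bar> \<le> K * N (cls (conv (indicator E2)))"
        by (rule K(2)[OF conv_mem_X]) (intro ind sets)+
      also have "\<dots> \<le> K * (L * tail_norm n)"
      proof (intro mult_left_mono N_tail_le conv_meas conv_bounded ind sets)
        fix x assume x: "\<bar>x\<bar> < real n"
        have "indicator E2 t * f (x + \<sigma> * t) = 0" for t
        proof (cases "t \<in> E2")
          case True
          then have "real m \<le> \<bar>t\<bar>" by (auto simp: E2_def)
          then have "real m \<le> \<bar>\<sigma> * t\<bar>" using \<sigma> by (simp add: abs_mult)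
          then have "real R < \<bar>x + \<sigma> * t\<bar>" using x by (simp add: m_def)
          then show ?thesis by (simp add: B(2))
        qed simp
        then have "(\<lambda>t. indicator E2 t * f (x + \<sigma> * t)) = (\<lambda>t. 0)" by blast
        then show "conv (indicator E2) x = 0" unfolding conv_def by simp
      qed (use K in simp)
      finally show ?thesis .
    qed
    ultimately show ?thesis unfolding T_def m_def by linarith
  qed
  have "(\<lambda>n. LINT t|lebesgue. \<bar>G t\<bar> * indicator (outside (n + R)) t) \<longlonglongrightarrow> 0"
    using LIMSEQ_ignore_initial_segment[OF integral_tail_tendsto_0[OF G_integrable], of R] .
  then have "T \<longlonglongrightarrow> K * (L * 0) + 0" unfolding T_def[abs_def] by (intro tendsto_intros tail_norm_tendsto)
  then have "\<bar>\<phi> (cls (conv (indicator E))) - (LINT t|lebesgue. indicator E t * G t)\<bar> \<le> K * (L * 0) + 0"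
    using bound by (intro LIMSEQ_le_const) auto
  then show ?thesis by simp
qed

end

lemma orbit_pettis_integrable:
  assumes \<Omega>: "\<Omega> \<in> sets lebesgue"
  shows "pettis_integrable X N (lebesgue_on \<Omega>) (\<lambda>t. translation (\<sigma> * t) (cls f))"
  unfolding pettis_integrable_def
proof (intro conjI ballI)
  show "(\<lambda>t. translation (\<sigma> * t) (cls f)) \<in> space (lebesgue_on \<Omega>) \<rightarrow> X"
    by (intro Pi_I Cc_translation_mem_X f_Cc)
  show "integrable (lebesgue_on \<Omega>) (\<lambda>t. \<phi> (translation (\<sigma> * t) (cls f)))" if "\<phi> \<in> dual_space X N" for \<phi>
    using integrable_mult_indicator[OF \<Omega> G_integrable[OF that]] \<Omega>
    by (simp add: integrable_restrict_space G_def[OF that])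
  fix E assume "E \<in> sets (lebesgue_on \<Omega>)"
  then have E: "E \<in> sets lebesgue" "E \<subseteq> \<Omega>" using \<Omega> by (auto simp: sets_restrict_space_iff)
  show "\<exists>y\<in>X. \<forall>\<phi>\<in>dual_space X N. \<phi> y = (LINT t:E|lebesgue_on \<Omega>. \<phi> (translation (\<sigma> * t) (cls f)))"
  proof (intro bexI ballI)
    show "cls (conv (indicator E)) \<in> X"
      using E(1) by (intro conv_mem_X borel_measurable_indicator) (auto simp: indicator_def)
    fix \<phi> assume \<phi>: "\<phi> \<in> dual_space X N"
    have "(LINT t:E|lebesgue_on \<Omega>. \<phi> (translation (\<sigma> * t) (cls f))) = (LINT t|lebesgue. indicator \<Omega> t * (indicator E t * G \<phi> t))"
      using \<Omega> by (simp add: set_lebesgue_integral_def integral_restrict_space G_def[OF \<phi>])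
    also have "(\<lambda>t. indicator \<Omega> t * (indicator E t * G \<phi> t)) = (\<lambda>t. indicator E t * G \<phi> t)"
      using E(2) by (intro ext) (auto simp: indicator_def)
    finally show "\<phi> (cls (conv (indicator E))) = (LINT t:E|lebesgue_on \<Omega>. \<phi> (translation (\<sigma> * t) (cls f)))"
      using dual_conv_indicator[OF \<phi> E(1)] by simp
  qed
qed

end

context finite_weighted_Lp begin

lemma criterion_holds: "frequent_hypercyclicity_criterion X N translation"
  unfolding frequent_hypercyclicity_criterion_def
proof (intro exI conjI ballI allI impI)
  show "dense_subset X N (cls ` Cc)"
    unfolding dense_subset_iff
  proof (intro conjI ballI allI impI)
    show "cls ` Cc \<subseteq> X" using Cc_mem_X by blast
    show "\<exists>a\<in>cls ` Cc. N (u - a) < e" if "u \<in> X" "0 < e" for u e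
      using Cc_dense[OF that] by blast
  qed
  show "translation (-t) \<in> cls ` Cc \<rightarrow> cls ` Cc" for t :: real
  proof (rule Pi_I, elim imageE)
    fix u f assume f: "u = cls f" "f \<in> Cc"
    obtain R where cont: "continuous_on UNIV f" and R: "\<And>x. R < \<bar>x\<bar> \<Longrightarrow> f x = 0" using f(2) by (auto simp: Cc_def)
    have "(\<lambda>x. f (x + -t)) \<in> Cc"
      unfolding Cc_def using R
      by (auto intro!: continuous_on_compose2[OF cont] continuous_intros exI[of _ "R + \<bar>t\<bar>"])
    then show "translation (-t) u \<in> cls ` Cc"
      unfolding f translation_cls[OF Cc_lmeas[OF f(2)]] by blast
  qed
  show "translation t (translation (-t) u) = u" for t u by (simp add: translation_add)
  show "translation t (translation (-r) u) = translation (-(r - t)) u" for t r u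
    by (simp add: translation_add)
  show "pettis_integrable X N (lebesgue_on {0..}) (\<lambda>t. translation t u)" if "u \<in> cls ` Cc" for u
  proof -
    obtain f where f: "u = cls f" "f \<in> Cc" using \<open>u \<in> cls ` Cc\<close> by blast
    interpret orbit_in_Cc p \<rho> f 1 by unfold_locales (auto simp: f)
    show ?thesis using orbit_pettis_integrable[of "{0..}"] by (simp add: f)
  qed
  show "pettis_integrable X N (lebesgue_on {0<..}) (\<lambda>t. translation (-t) u)" if "u \<in> cls ` Cc" for u
  proof -
    obtain f where f: "u = cls f" "f \<in> Cc" using \<open>u \<in> cls ` Cc\<close> by blast
    interpret orbit_in_Cc p \<rho> f "-1" by unfold_locales (auto simp: f)
    show ?thesis using orbit_pettis_integrable[of "{0<..}"] by (simp add: f)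
  qed
qed

end

section \<open>Difference sets of sets of positive density\<close>

definition initial :: "int set \<Rightarrow> nat \<Rightarrow> int set" where
  "initial A n = A \<inter> {0..<int n}"

definition overlap :: "int set \<Rightarrow> nat \<Rightarrow> int \<Rightarrow> nat" where
  "overlap A n k = card {s \<in> initial A n. s + k \<in> initial A n}"

lemma finite_initial [simp]: "finite (initial A n)"
  by (simp add: initial_def)

lemma overlap_0: "overlap A n 0 = card (initial A n)"
  by (simp add: overlap_def)

lemma overlap_minus: "overlap A n (-k) = overlap A n k"
  unfolding overlap_def by (rule bij_betw_same_card[of "\<lambda>s. s - k"], rule bij_betwI[of _ _ _ "\<lambda>s. s + k"]) auto

lemma card_initial_le: "card (initial A n) \<le> n"
  using card_mono[of "{0..<int n}" "initial A n"] by (simp add: initial_def)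

text \<open>Let g x count the r in R with x + r in A below n. Its sum over x is card R times the
  number of these elements of A, its sum of squares is the double sum of overlaps, and x ranges over
  n + 2d integers. The margin d on both sides ensures that no shifted copy is cut off.\<close>

lemma overlap_Cauchy_Schwarz:
  assumes "finite R" and D: "\<And>r. r \<in> R \<Longrightarrow> \<bar>r\<bar> \<le> int d"
  shows "(real (card R) * real (card (initial A n)))\<^sup>2 \<le>
    (real n + 2 * real d) * (\<Sum>r\<in>R. \<Sum>r'\<in>R. real (overlap A n (r' - r)))"
proof -
  let ?I = "{-int d..<int n + int d}"
  let ?A = "initial A n"
  define g where "g x = (\<Sum>r\<in>R. of_bool (x + r \<in> ?A) :: real)" for x
  have "(\<Sum>x\<in>?I. g x) = (\<Sum>r\<in>R. \<Sum>x\<in>?I. of_bool (x + r \<in> ?A))"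
    unfolding g_def by (rule sum.swap)
  also have "\<dots> = (\<Sum>r\<in>R. real (card ?A))"
  proof (rule sum.cong)
    fix r assume r: "r \<in> R"
    have "(\<Sum>x\<in>?I. of_bool (x + r \<in> ?A)) = real (card {x \<in> ?I. x + r \<in> ?A})"
      by (simp add: of_bool_def sum.If_cases Int_def)
    also have "card {x \<in> ?I. x + r \<in> ?A} = card ?A"
      by (rule bij_betw_same_card[of "\<lambda>x. x + r"], rule bij_betwI[of _ _ _ "\<lambda>x. x - r"])
        (use D[OF r] in \<open>auto simp: initial_def\<close>)
    finally show "(\<Sum>x\<in>?I. of_bool (x + r \<in> ?A)) = real (card ?A)" .
  qed simp
  finally have sum1: "(\<Sum>x\<in>?I. g x) = real (card R) * real (card ?A)" by simp
  have "(\<Sum>x\<in>?I. (g x)\<^sup>2) = (\<Sum>x\<in>?I. \<Sum>r\<in>R. \<Sum>r'\<in>R. of_bool (x + r \<in> ?A \<and> x + r' \<in> ?A))"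
    unfolding g_def power2_eq_square sum_product by (simp add: of_bool_conj)
  also have "\<dots> = (\<Sum>r\<in>R. \<Sum>x\<in>?I. \<Sum>r'\<in>R. of_bool (x + r \<in> ?A \<and> x + r' \<in> ?A))"
    by (rule sum.swap)
  also have "\<dots> = (\<Sum>r\<in>R. \<Sum>r'\<in>R. \<Sum>x\<in>?I. of_bool (x + r \<in> ?A \<and> x + r' \<in> ?A))"
    by (intro sum.cong refl sum.swap)
  also have "\<dots> = (\<Sum>r\<in>R. \<Sum>r'\<in>R. real (overlap A n (r' - r)))"
  proof (intro sum.cong refl)
    fix r r' assume r: "r \<in> R" "r' \<in> R"
    have "(\<Sum>x\<in>?I. of_bool (x + r \<in> ?A \<and> x + r' \<in> ?A)) = real (card {x \<in> ?I. x + r \<in> ?A \<and> x + r' \<in> ?A})"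
      by (simp add: of_bool_def sum.If_cases Int_def)
    also have "card {x \<in> ?I. x + r \<in> ?A \<and> x + r' \<in> ?A} = overlap A n (r' - r)"
      unfolding overlap_def
      by (rule bij_betw_same_card[of "\<lambda>x. x + r"], rule bij_betwI[of _ _ _ "\<lambda>x. x - r"])
        (use D[OF r(1)] in \<open>auto simp: initial_def algebra_simps\<close>)
    finally show "(\<Sum>x\<in>?I. of_bool (x + r \<in> ?A \<and> x + r' \<in> ?A)) = real (overlap A n (r' - r))" .
  qed
  finally have sum2: "(\<Sum>x\<in>?I. (g x)\<^sup>2) = (\<Sum>r\<in>R. \<Sum>r'\<in>R. real (overlap A n (r' - r)))" .
  have "(\<Sum>x\<in>?I. 1 * g x)\<^sup>2 \<le> (\<Sum>x\<in>?I. 1\<^sup>2) * (\<Sum>x\<in>?I. (g x)\<^sup>2)"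
    by (rule Cauchy_Schwarz_ineq_sum)
  moreover have "(\<Sum>x\<in>?I. 1\<^sup>2) = real n + 2 * real d" by simp
  ultimately show ?thesis unfolding mult_1 sum1 sum2 by (simp only:)
qed

text \<open>By \<open>overlap_Cauchy_Schwarz\<close>, a family \<open>R\<close> of shifts with small pairwise overlaps has fewer than \<open>4/\<delta>\<close>
  members. If \<open>R\<close> is maximal, then every \<open>k \<notin> R\<close> has a large overlap at some \<open>k - r\<close>, \<open>r \<in> R\<close>. Shifting \<open>R\<close> into
  the nonpositive integers makes the one-sided growth condition applicable to \<open>k \<le> k - r\<close>.\<close>

lemma sum_bounded_if_difference_sums_bounded:
  fixes A :: "int set" and w :: "int \<Rightarrow> real"
  assumes \<delta>: "0 < \<delta>" and dens: "\<forall>\<^sub>F n in sequentially. \<delta> * real n \<le> real (card (initial A n))"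
    and w: "\<And>k. 0 \<le> w k" and growth: "\<And>j::nat. \<exists>C. \<forall>k. w k \<le> C * w (k + int j)"
    and S: "\<And>m F. m \<in> A \<Longrightarrow> finite F \<Longrightarrow> F \<subseteq> A \<Longrightarrow> (\<Sum>n\<in>F. w (n - m)) \<le> S"
  shows "\<exists>S'. \<forall>Q. finite Q \<longrightarrow> sum w Q \<le> S'"
proof -
  \<comment> \<open>Once m\<delta> is at least 4, m being the number of shifts and a the number of
    elements of A below n, the diagonal overlaps account for at most half of m * a^2 in the
    Cauchy-Schwarz bound. This \<eta> limits the others to a quarter, which is a
    contradiction.\<close>
  define \<eta> where "\<eta> = \<delta>\<^sup>2 / 8"
  have \<eta>: "0 < \<eta>" using \<delta> by (simp add: \<eta>_def)
  define small where "small R n \<longleftrightarrow> (\<forall>r\<in>R. \<forall>r'\<in>R. r \<noteq> r' \<longrightarrow> real (overlap A n (r' - r)) < \<eta> * real n)" for R n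
  \<comment> \<open>Smallness is asked for infinitely many n only. Its negation then holds for all
    large n, so the failures for finitely many enlarged families can be combined at a single n at
    which R itself is still small.\<close>
  define good where "good R \<longleftrightarrow> finite R \<and> (\<exists>\<^sub>F n in sequentially. small R n)" for R
  have card_good: "real (card R) * \<delta> < 4" if "good R" for R
  proof (rule ccontr)
    assume neg: "\<not> real (card R) * \<delta> < 4"
    have fin: "finite R" and freq: "\<exists>\<^sub>F n in sequentially. small R n" using that by (auto simp: good_def)
    obtain d where d: "\<And>r. r \<in> R \<Longrightarrow> \<bar>r\<bar> \<le> int d"
    proof
      fix r assume "r \<in> R"
      then have "nat \<bar>r\<bar> \<le> (\<Sum>r\<in>R. nat \<bar>r\<bar>)" using fin by (intro member_le_sum) auto
      then show "\<bar>r\<bar> \<le> int (\<Sum>r\<in>R. nat \<bar>r\<bar>)" by linarith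
    qed
    have "\<forall>\<^sub>F n in sequentially. 2 * d + 1 \<le> n" by (rule eventually_ge_at_top)
    then have "\<exists>\<^sub>F n in sequentially. small R n \<and> (\<delta> * real n \<le> real (card (initial A n)) \<and> 2 * d + 1 \<le> n)"
      by (intro frequently_eventually_frequently[OF freq] eventually_conj dens)
    then obtain n where n: "small R n" "\<delta> * real n \<le> real (card (initial A n))" "2 * d + 1 \<le> n"
      by (metis (mono_tags, lifting) frequently_ex)
    define m where "m = real (card R)"
    define a where "a = real (card (initial A n))"
    define x where "x = real n"
    have x: "0 < x" "2 * real d \<le> x" using n(3) by (auto simp: x_def)
    have a: "\<delta> * x \<le> a" "0 < a" using n(2) x(1) \<delta> less_le_trans[of 0 "\<delta> * x" a] by (auto simp: a_def x_def)
    have m: "4 \<le> m * \<delta>" "0 < m" using neg \<delta> by (auto simp: m_def not_less) (metis card.empty fin mult_zero_left not_numeral_le_zero of_nat_0 of_nat_0_less_iff card_gt_0_iff)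
    have "(\<Sum>r\<in>R. \<Sum>r'\<in>R. real (overlap A n (r' - r))) \<le> (\<Sum>r\<in>R. \<Sum>r'\<in>R. (if r = r' then a else 0) + \<eta> * x)"
    proof (intro sum_mono)
      fix r r' assume "r \<in> R" "r' \<in> R"
      then show "real (overlap A n (r' - r)) \<le> (if r = r' then a else 0) + \<eta> * x"
        using n(1) \<eta> x(1) by (cases "r = r'") (auto simp: small_def x_def a_def overlap_0 intro: less_imp_le)
    qed
    also have "\<dots> = m * a + m * (m * (\<eta> * x))"
      using fin by (simp add: sum.distrib sum.delta m_def distrib_left)
    finally have ov: "(\<Sum>r\<in>R. \<Sum>r'\<in>R. real (overlap A n (r' - r))) \<le> m * a + m * (m * (\<eta> * x))" .
    have "(m * a)\<^sup>2 \<le> (x + 2 * real d) * (\<Sum>r\<in>R. \<Sum>r'\<in>R. real (overlap A n (r' - r)))"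
      using overlap_Cauchy_Schwarz[OF fin d, of A n] by (simp add: m_def a_def x_def)
    also have "\<dots> \<le> (2 * x) * (m * a + m * (m * (\<eta> * x)))"
      using ov x by (intro mult_mono) (auto intro!: sum_nonneg)
    finally have "m * (m * a\<^sup>2) \<le> m * (2 * x * a + 2 * m * \<eta> * x\<^sup>2)"
      by (simp add: power2_eq_square algebra_simps)
    then have 1: "m * a\<^sup>2 \<le> 2 * x * a + 2 * m * \<eta> * x\<^sup>2" using m(2) by simp
    have "4 * (x * a) \<le> m * \<delta> * (x * a)" using m(1) x a by (intro mult_right_mono) auto
    also have "\<dots> = m * a * (\<delta> * x)" by simp
    also have "\<dots> \<le> m * a * a" using a m by (intro mult_left_mono) auto
    finally have 2: "4 * (x * a) \<le> m * a\<^sup>2" by (simp add: power2_eq_square)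
    have "(\<delta> * x)\<^sup>2 \<le> a\<^sup>2" using a \<delta> x by (intro power_mono) auto
    then have "m * (\<delta> * x)\<^sup>2 \<le> m * a\<^sup>2" using m by (intro mult_left_mono) auto
    then have 3: "8 * (m * \<eta> * x\<^sup>2) \<le> m * a\<^sup>2" by (simp add: \<eta>_def power_mult_distrib)
    have "0 < m * \<eta> * x\<^sup>2" using m \<eta> x by simp
    then show False using 1 2 3 by linarith
  qed
  have "good {0}" by (auto simp: good_def small_def)
  moreover have "\<forall>R. good R \<longrightarrow> card R < nat \<lceil>4 / \<delta>\<rceil> + 1"
  proof (intro allI impI)
    fix R assume "good R"
    then have "real (card R) < 4 / \<delta>" using card_good \<delta> by (simp add: field_simps)
    then show "card R < nat \<lceil>4 / \<delta>\<rceil> + 1" by linarith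
  qed
  ultimately obtain R0 where R0: "good R0" "\<And>R. good R \<Longrightarrow> card R \<le> card R0"
    using ex_has_greatest_nat[of good "{0}" card] by blast
  have R0_ne: "R0 \<noteq> {}" using R0(2)[OF \<open>good {0}\<close>] by auto
  have R0_fin: "finite R0" using R0(1) by (simp add: good_def)
  define R where "R = (\<lambda>r. r - Max R0) ` R0"
  have R_fin: "finite R" using R0_fin by (simp add: R_def)
  have R_le: "r \<le> 0" if "r \<in> R" for r using that R0_fin by (auto simp: R_def)
  have cardR: "card R = card R0" unfolding R_def by (rule card_image) (auto simp: inj_on_def)
  have R_good: "good R"
  proof -
    have "small R n = small R0 n" for n unfolding small_def R_def by auto
    then show ?thesis using R0(1) R_fin by (simp add: good_def)
  qed
  have far: "\<forall>\<^sub>F n in sequentially. \<not> small (insert k R) n" if "k \<notin> R" for k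
  proof -
    have "card (insert k R) = Suc (card R)" using that R_fin by simp
    then have "\<not> good (insert k R)" using R0(2)[of "insert k R"] cardR by auto
    then show ?thesis using R_fin by (simp add: good_def not_frequently)
  qed
  obtain CC where CC: "\<And>j k. w k \<le> CC j * w (k + int j)" using growth by metis
  define K where "K = (\<Sum>r\<in>R. \<bar>CC (nat (-r))\<bar>)"
  have K: "w k \<le> K * w (k - r)" if "r \<in> R" for k r
  proof -
    have "w k \<le> CC (nat (-r)) * w (k - r)" using CC[of k "nat (-r)"] R_le[OF that] by simp
    also have "\<dots> \<le> K * w (k - r)"
    proof (rule mult_right_mono[OF _ w])
      have "\<bar>CC (nat (-r))\<bar> \<le> K" unfolding K_def using R_fin that by (intro member_le_sum) auto
      then show "CC (nat (-r)) \<le> K" by linarith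
    qed
    finally show ?thesis .
  qed
  have K0: "0 \<le> K" by (simp add: K_def sum_nonneg)
  \<comment> \<open>Double counting: the left side sums w over the differences of pairs from A below
    n, and for each fixed first member the hypothesis bounds the sum over the second.\<close>
  have ov_sum: "(\<Sum>j\<in>Q. w j * real (overlap A n j)) \<le> \<bar>S\<bar> * real n" if "finite Q" for Q n
  proof -
    let ?A = "initial A n"
    have "(\<Sum>j\<in>Q. w j * real (overlap A n j)) = (\<Sum>j\<in>Q. \<Sum>s\<in>?A. if s + j \<in> ?A then w j else 0)"
      by (intro sum.cong refl) (simp add: overlap_def sum.If_cases Int_def mult.commute)
    also have "\<dots> = (\<Sum>s\<in>?A. \<Sum>j\<in>Q. if s + j \<in> ?A then w j else 0)" by (rule sum.swap)
    also have "\<dots> \<le> (\<Sum>s\<in>?A. \<bar>S\<bar>)"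
    proof (rule sum_mono)
      fix s assume s: "s \<in> ?A"
      have "(\<Sum>j\<in>Q. if s + j \<in> ?A then w j else 0) = (\<Sum>j\<in>{j\<in>Q. s + j \<in> ?A}. w j)"
        using that by (simp add: sum.If_cases Int_def)
      also have "\<dots> = (\<Sum>n\<in>(+) s ` {j\<in>Q. s + j \<in> ?A}. w (n - s))"
        by (subst sum.reindex) (auto simp: inj_on_def)
      also have "\<dots> \<le> S"
        by (rule S) (use s that in \<open>auto simp: initial_def\<close>)
      finally show "(\<Sum>j\<in>Q. if s + j \<in> ?A then w j else 0) \<le> \<bar>S\<bar>" by simp
    qed
    also have "\<dots> = \<bar>S\<bar> * real (card ?A)" by simp
    also have "\<dots> \<le> \<bar>S\<bar> * real n" using card_initial_le[of A n] by (intro mult_left_mono) auto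
    finally show ?thesis .
  qed
  have "sum w Q \<le> sum w R + real (card R) * (K * \<bar>S\<bar> / \<eta>)" if Q: "finite Q" for Q
  proof -
    have ev: "\<forall>\<^sub>F n in sequentially. \<forall>k\<in>Q - R. \<not> small (insert k R) n"
      using Q far by (intro eventually_ball_finite) auto
    have "\<exists>\<^sub>F n in sequentially. small R n \<and> ((\<forall>k\<in>Q - R. \<not> small (insert k R) n) \<and> 1 \<le> n)"
      using R_good by (intro frequently_eventually_frequently eventually_conj ev eventually_ge_at_top) (auto simp: good_def)
    then obtain n where n: "small R n" "\<And>k. k \<in> Q - R \<Longrightarrow> \<not> small (insert k R) n" "1 \<le> n"
      by (metis (mono_tags, lifting) frequently_ex)
    have ex: "\<exists>r\<in>R. \<eta> * real n \<le> real (overlap A n (k - r))" if k: "k \<in> Q - R" for k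
    proof -
      obtain r r' where r: "r \<in> insert k R" "r' \<in> insert k R" "r \<noteq> r'" "\<eta> * real n \<le> real (overlap A n (r' - r))"
        using n(2)[OF k] unfolding small_def by (auto simp: not_less)
      consider "r = k" "r' \<in> R" | "r' = k" "r \<in> R" | "r \<in> R" "r' \<in> R" using r by auto
      then show ?thesis
      proof cases
        case 1
        then show ?thesis using r(4) overlap_minus[of A n "k - r'"] by (intro bexI[of _ r']) auto
      next
        case 2
        then show ?thesis using r(4) by blast
      next
        case 3
        then show ?thesis using n(1) r(3,4) unfolding small_def by (meson not_less)
      qed
    qed
    have \<eta>n: "0 < \<eta> * real n" using \<eta> n(3) by simp
    have "sum w (Q - R) \<le> (\<Sum>k\<in>Q - R. \<Sum>r\<in>R. K / (\<eta> * real n) * (w (k - r) * real (overlap A n (k - r))))"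
    proof (rule sum_mono)
      fix k assume "k \<in> Q - R"
      then obtain r where r: "r \<in> R" "\<eta> * real n \<le> real (overlap A n (k - r))" using ex by blast
      have "w k \<le> K * w (k - r) * 1" using K[OF r(1)] by simp
      \<comment> \<open>The factor 1 is replaced by the overlap divided by \<eta>n, which is at
        least 1 for this r; in this weighted form the sum over k is estimated by
        \<open>ov_sum\<close>.\<close>
      also have "\<dots> \<le> K * w (k - r) * (real (overlap A n (k - r)) / (\<eta> * real n))"
        using r(2) \<eta>n K0 w by (intro mult_left_mono) (auto simp: le_divide_eq)
      also have "\<dots> = K / (\<eta> * real n) * (w (k - r) * real (overlap A n (k - r)))" by simp
      also have "\<dots> \<le> (\<Sum>r\<in>R. K / (\<eta> * real n) * (w (k - r) * real (overlap A n (k - r))))"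
        using r(1) R_fin K0 \<eta>n w by (intro member_le_sum) auto
      finally show "w k \<le> (\<Sum>r\<in>R. K / (\<eta> * real n) * (w (k - r) * real (overlap A n (k - r))))" .
    qed
    also have "\<dots> = (\<Sum>r\<in>R. \<Sum>k\<in>Q - R. K / (\<eta> * real n) * (w (k - r) * real (overlap A n (k - r))))"
      by (rule sum.swap)
    also have "\<dots> \<le> (\<Sum>r\<in>R. K * \<bar>S\<bar> / \<eta>)"
    proof (rule sum_mono)
      fix r
      have "(\<Sum>k\<in>Q - R. K / (\<eta> * real n) * (w (k - r) * real (overlap A n (k - r))))
        = K / (\<eta> * real n) * (\<Sum>j\<in>(\<lambda>k. k - r) ` (Q - R). w j * real (overlap A n j))"
        by (subst sum.reindex) (auto simp: inj_on_def sum_distrib_left)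
      also have "\<dots> \<le> K / (\<eta> * real n) * (\<bar>S\<bar> * real n)"
        using Q K0 \<eta>n by (intro mult_left_mono ov_sum) auto
      also have "\<dots> = K * \<bar>S\<bar> / \<eta>" using n(3) by simp
      finally show "(\<Sum>k\<in>Q - R. K / (\<eta> * real n) * (w (k - r) * real (overlap A n (k - r)))) \<le> K * \<bar>S\<bar> / \<eta>" .
    qed
    finally have "sum w (Q - R) \<le> real (card R) * (K * \<bar>S\<bar> / \<eta>)" by simp
    moreover have "sum w (Q \<inter> R) \<le> sum w R" using R_fin w by (intro sum_mono2) auto
    moreover have "sum w Q = sum w (Q \<inter> R) + sum w (Q - R)" using Q by (simp add: sum.Int_Diff)
    ultimately show ?thesis by linarith
  qed
  then show ?thesis by blast
qed

section \<open>Frequent hypercyclicity forces a finite weight\<close>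

text \<open>S is covered by the unit intervals starting at its integer parts. The right end n is
  added as a null set, because its integer part does not count among those below n.\<close>

lemma lower_density_pos_card:
  assumes "0 < lower_density S" "S \<subseteq> {0..}"
  obtains \<delta> where "0 < \<delta>" "\<forall>\<^sub>F n in sequentially. \<delta> * real n \<le> real (card (initial {\<lfloor>t\<rfloor> |t. t \<in> S} n))"
proof -
  obtain \<delta> where \<delta>: "0 < ereal \<delta>" "ereal \<delta> < lower_density S" using ereal_dense2[OF assms(1)] by auto
  have "\<forall>\<^sub>F x in at_top. ereal \<delta> < ereal (measure lebesgue (S \<inter> {0..x}) / x)"
    using \<delta>(2) unfolding lower_density_def by (rule less_LiminfD)
  then have "\<forall>\<^sub>F n in sequentially. ereal \<delta> < ereal (measure lebesgue (S \<inter> {0..real n}) / real n)"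
    by (rule eventually_compose_filterlim[OF _ filterlim_real_sequentially])
  then have "\<forall>\<^sub>F n in sequentially. \<delta> * real n \<le> real (card (initial {\<lfloor>t\<rfloor> |t. t \<in> S} n))"
    using eventually_gt_at_top[of 0]
  proof eventually_elim
    case (elim n)
    let ?A = "initial {\<lfloor>t\<rfloor> |t. t \<in> S} n"
    have "measure lebesgue (S \<inter> {0..real n}) \<le> real (card ?A)"
    proof (cases "S \<inter> {0..real n} \<in> sets lebesgue")
      case True
      have "S \<inter> {0..real n} \<subseteq> (\<Union>k\<in>?A. {of_int k..of_int k + 1}) \<union> {real n}"
      proof
        fix t assume t: "t \<in> S \<inter> {0..real n}"
        show "t \<in> (\<Union>k\<in>?A. {of_int k..of_int k + 1}) \<union> {real n}"
        proof (cases "t = real n")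
          case False
          then have "\<lfloor>t\<rfloor> \<in> ?A" using t by (auto simp: initial_def floor_less_iff)
          moreover have "t \<in> {of_int \<lfloor>t\<rfloor>..of_int \<lfloor>t\<rfloor> + 1}" by (simp add: less_imp_le)
          ultimately show ?thesis by blast
        qed simp
      qed
      moreover have cup: "(\<Union>k\<in>?A. {of_int k..of_int k + 1 :: real}) \<in> lmeasurable" by (intro fmeasurable.finite_UN) auto
      ultimately have "measure lebesgue (S \<inter> {0..real n}) \<le> measure lebesgue ((\<Union>k\<in>?A. {of_int k..of_int k + 1}) \<union> {real n})"
        using True by (intro measure_mono_fmeasurable fmeasurable.Un cup negligible_imp_measurable negligible_sing) auto
      also have "\<dots> \<le> measure lebesgue (\<Union>k\<in>?A. {of_int k..of_int k + 1 :: real}) + measure lebesgue {real n}"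
        using cup by (intro measure_Un_le) auto
      also have "measure lebesgue (\<Union>k\<in>?A. {of_int k..of_int k + 1 :: real}) \<le> (\<Sum>k\<in>?A. measure lebesgue {of_int k..of_int k + 1 :: real})"
        by (intro measure_UNION_le) auto
      also have "\<dots> = real (card ?A)" by simp
      finally show ?thesis by simp
    next
      case False
      \<comment> \<open>A non-measurable set has \<open>measure\<close> 0.\<close>
      then show ?thesis by (simp add: measure_notin_sets)
    qed
    moreover have "\<delta> * real n \<le> measure lebesgue (S \<inter> {0..real n})" using elim by (simp add: field_simps)
    ultimately show ?case by linarith
  qed
  then show ?thesis using that \<delta>(1) by simp
qed

context weighted_Lp begin

lemma frequently_hypercyclic_imp_integral_finite:
  assumes "frequently_hypercyclic X N translation"
  shows "(\<integral>\<^sup>+x. ennreal (\<rho> x) \<partial>lebesgue) < \<infinity>"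
proof -
  obtain u where u: "u \<in> X" and fh: "\<And>U. openin (norm_topology X N) U \<Longrightarrow> U \<noteq> {} \<Longrightarrow>
      0 < lower_density {t. 0 \<le> t \<and> translation t u \<in> U}"
    using assms unfolding frequently_hypercyclic_def by blast
  obtain f where f: "lmeas f" "u = cls f" by (rule cls_cases)
  obtain c where c: "0 < c" "\<And>x. \<bar>x\<bar> \<le> 2 \<Longrightarrow> c \<le> \<rho> x" using rho_bounds[of 2] by metis
  \<comment> \<open>At each point |f| or |f - 1| is at least 1/2, so over a block of length 1 their
    p-th powers together have integral at least \<open>(1/2) powr p\<close>, which is 2 * c1. The
    radius e, with p-th power c1 * c, leaves at most c1 to |f - 1| and hence at least c1 to
    |f|.\<close>
  define c1 where "c1 = (1/2) powr p / 2"
  have c1: "0 < c1" by (simp add: c1_def)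
  define e where "e = (c1 * c) powr (1 / p)"
  have e: "0 < e" "e powr p = c1 * c" using c c1 p_pos by (auto simp: e_def powr_powr)
  \<comment> \<open>Length 2 has the effect that [t, t + 2] contains the block [n + 1, n + 2[, which
    depends only on the integer part n of t.\<close>
  define v where "v = cls (indicator {0..2})"
  have v: "v \<in> X" using indicator_mem_X[of "{0..2}" 2] by (simp add: v_def)
  define S where "S = {t. 0 \<le> t \<and> translation t u \<in> mball v e}"
  have "0 < lower_density S"
    unfolding S_def by (rule fh) (use v e in \<open>auto simp: norm_topology_def\<close>)
  then obtain \<delta> where \<delta>: "0 < \<delta>" "\<forall>\<^sub>F n in sequentially. \<delta> * real n \<le> real (card (initial {\<lfloor>t\<rfloor> |t. t \<in> S} n))"
    by (rule lower_density_pos_card) (auto simp: S_def)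
  define A where "A = {\<lfloor>t\<rfloor> |t. t \<in> S}"
  obtain C where C: "1 \<le> C" "\<And>x t. 0 \<le> t \<Longrightarrow> t \<le> 2 \<Longrightarrow> \<rho> x \<le> C * \<rho> (x + t)"
    using rho_growth[of 2] by blast
  \<comment> \<open>The integrand of the error at time t after substituting y = x + t. In this form
    all times see the same function f, and only the weight moves.\<close>
  define h where "h t y = ennreal (\<bar>f y - indicator {t..t+2} y\<bar> powr p * \<rho> (y - t))" for t y
  have h_meas: "h t \<in> borel_measurable lebesgue" for t
  proof -
    have "lmeas (\<lambda>y. \<rho> (y - t))" using lmeas_shift[OF rho_meas, of "-t"] by simp
    then show ?thesis unfolding h_def
      by (intro measurable_compose[OF _ measurable_ennreal] borel_measurable_times measurable_abs_powr
          borel_measurable_diff f lmeas_indicator_Icc)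
  qed
  have h_le: "(\<integral>\<^sup>+y. h t y \<partial>lebesgue) \<le> ennreal (c1 * c)" if "t \<in> S" for t
  proof -
    have t: "0 \<le> t" "N (v - translation t u) < e" using that v by (auto simp: S_def)
    have d: "lmeas (\<lambda>x. f (x + t) - indicator {0..2} x)" by (intro borel_measurable_diff lmeas_shift f lmeas_indicator_Icc)
    have eq: "translation t u - v = cls (\<lambda>x. f (x + t) - indicator {0..2} x)"
      unfolding f v_def translation_cls[OF f(1)] by (intro cls_diff lmeas_shift f lmeas_indicator_Icc)
    have "N (cls (\<lambda>x. f (x + t) - indicator {0..2} x)) \<le> e" using t(2) N_minus_commute[of v "translation t u"] eq by simp
    moreover have "cls (\<lambda>x. f (x + t) - indicator {0..2} x) \<in> X"
      unfolding eq[symmetric] by (intro diff_mem_X translation_mem_X t u v)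
    ultimately have "mass (\<lambda>x. f (x + t) - indicator {0..2} x) \<le> ennreal (c1 * c)"
      using N_le_iff[OF d] e by simp
    moreover have "(\<integral>\<^sup>+y. h t y \<partial>lebesgue) = (\<integral>\<^sup>+y. h t (y + t) \<partial>lebesgue)"
      by (rule nn_integral_lebesgue_shift[OF h_meas, symmetric])
    moreover have "h t (y + t) = ennreal (\<bar>f (y + t) - indicator {0..2} y\<bar> powr p * \<rho> y)" for y
      by (simp add: h_def indicator_def)
    ultimately show ?thesis by (simp add: mass_def)
  qed
  define blk where "blk n = block 1 (n + 1)" for n
  define F where "F y = ennreal (\<bar>f y\<bar> powr p)" for y
  have F_meas: "F \<in> borel_measurable lebesgue" unfolding F_def
    by (intro measurable_compose[OF _ measurable_ennreal] measurable_abs_powr f)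
  have F_blk: "ennreal c1 \<le> (\<integral>\<^sup>+y. F y * indicator (blk n) y \<partial>lebesgue)" if "n \<in> A" for n
  proof -
    obtain t where t: "t \<in> S" "n = \<lfloor>t\<rfloor>" using \<open>n \<in> A\<close> by (auto simp: A_def)
    have nt: "of_int n \<le> t" "t < of_int n + 1" using t(2) by linarith+
    have "ennreal ((1/2) powr p) = (\<integral>\<^sup>+y. ennreal ((1/2) powr p) * indicator (blk n) y \<partial>lebesgue)"
      by (subst nn_integral_cmult_indicator) (auto simp: blk_def)
    also have "\<dots> \<le> (\<integral>\<^sup>+y. F y * indicator (blk n) y + ennreal (1 / c) * (h t y * indicator (blk n) y) \<partial>lebesgue)"
    proof (rule nn_integral_mono)
      fix y
      show "ennreal ((1/2) powr p) * indicator (blk n) y \<le> F y * indicator (blk n) y + ennreal (1 / c) * (h t y * indicator (blk n) y)"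
      proof (cases "y \<in> blk n")
        case True
        then have y: "of_int n + 1 \<le> y" "y < of_int n + 2" by (auto simp: blk_def)
        then have "y \<in> {t..t+2}" using nt by auto
        then have h: "h t y = ennreal (\<bar>f y - 1\<bar> powr p * \<rho> (y - t))" by (simp add: h_def)
        have "c \<le> \<rho> (y - t)" using y nt by (intro c) auto
        then have "\<bar>f y - 1\<bar> powr p * c \<le> \<bar>f y - 1\<bar> powr p * \<rho> (y - t)" by (intro mult_left_mono) auto
        then have 1: "\<bar>f y - 1\<bar> powr p \<le> 1 / c * (\<bar>f y - 1\<bar> powr p * \<rho> (y - t))" using c(1) by (simp add: field_simps)
        have "1/2 \<le> \<bar>f y\<bar> \<or> 1/2 \<le> \<bar>f y - 1\<bar>" by linarith
        then have "(1/2) powr p \<le> \<bar>f y\<bar> powr p \<or> (1/2) powr p \<le> \<bar>f y - 1\<bar> powr p"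
          using p_pos by (auto intro: powr_mono2)
        moreover have "0 \<le> \<bar>f y\<bar> powr p" "0 \<le> \<bar>f y - 1\<bar> powr p" by simp_all
        ultimately have "(1/2) powr p \<le> \<bar>f y\<bar> powr p + 1 / c * (\<bar>f y - 1\<bar> powr p * \<rho> (y - t))" using 1 by linarith
        then have "ennreal ((1/2) powr p) \<le> ennreal (\<bar>f y\<bar> powr p + 1 / c * (\<bar>f y - 1\<bar> powr p * \<rho> (y - t)))"
          by (rule ennreal_leI)
        also have "\<dots> = F y + ennreal (1 / c) * h t y"
          using c(1) unfolding F_def h by (subst ennreal_plus) (auto simp: ennreal_mult simp del: times_divide_eq_left)
        finally show ?thesis using True by simp
      qed simp
    qed
    also have "\<dots> = (\<integral>\<^sup>+y. F y * indicator (blk n) y \<partial>lebesgue) + ennreal (1 / c) * (\<integral>\<^sup>+y. h t y * indicator (blk n) y \<partial>lebesgue)"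
      unfolding blk_def using lmeas_block[OF F_meas] lmeas_block[OF h_meas]
      by (subst nn_integral_add) (auto simp: nn_integral_cmult)
    also have "(\<integral>\<^sup>+y. h t y * indicator (blk n) y \<partial>lebesgue) \<le> (\<integral>\<^sup>+y. h t y \<partial>lebesgue)"
      by (intro nn_integral_mono) (auto simp: indicator_def)
    also note h_le[OF t(1)]
    also have "ennreal (1 / c) * ennreal (c1 * c) = ennreal c1"
      using c(1) c1 by (simp flip: ennreal_mult)
    finally have "ennreal ((1/2) powr p) \<le> (\<integral>\<^sup>+y. F y * indicator (blk n) y \<partial>lebesgue) + ennreal c1"
      by (simp add: add_left_mono mult_left_mono)
    moreover have "ennreal ((1/2) powr p) = ennreal c1 + ennreal c1"
      using c1 by (simp flip: ennreal_plus) (simp add: c1_def)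
    ultimately show ?thesis by (simp add: ennreal_add_left_cancel_le add.commute)
  qed
  define B where "B = (\<Sum>j\<in>{-2..2}. \<rho> (of_int j))"
  \<comment> \<open>If |n - m| is at least 3, the block of n misses [t, t + 2] for a time t with
    integer part m. At that time the whole mass of f on the block is error, weighted by about
    \<rho>(n - m), and the blocks of distinct n are disjoint.\<close>
  have far_sum: "(\<Sum>n\<in>G. \<rho> (of_int (n - m))) \<le> C * c" if m: "m \<in> A" and G: "finite G" "G \<subseteq> A" "\<And>n. n \<in> G \<Longrightarrow> 3 \<le> \<bar>n - m\<bar>" for m G
  proof -
    obtain t where t: "t \<in> S" "m = \<lfloor>t\<rfloor>" using m by (auto simp: A_def)
    have mt: "of_int m \<le> t" "t < of_int m + 1" using t(2) by linarith+
    have blk: "ennreal (\<rho> (of_int (n - m))) * ennreal c1 \<le> ennreal C * (\<integral>\<^sup>+y. h t y * indicator (blk n) y \<partial>lebesgue)" if n: "n \<in> G" for n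
    proof -
      have "ennreal (\<rho> (of_int (n - m))) * ennreal c1 \<le> ennreal (\<rho> (of_int (n - m))) * (\<integral>\<^sup>+y. F y * indicator (blk n) y \<partial>lebesgue)"
        using F_blk[of n] n G(2) by (intro mult_left_mono) auto
      also have "\<dots> = (\<integral>\<^sup>+y. ennreal (\<rho> (of_int (n - m))) * (F y * indicator (blk n) y) \<partial>lebesgue)"
        unfolding blk_def by (rule nn_integral_cmult[symmetric, OF lmeas_block[OF F_meas]])
      also have "\<dots> \<le> (\<integral>\<^sup>+y. ennreal C * (h t y * indicator (blk n) y) \<partial>lebesgue)"
      proof (rule nn_integral_mono)
        fix y
        show "ennreal (\<rho> (of_int (n - m))) * (F y * indicator (blk n) y) \<le> ennreal C * (h t y * indicator (blk n) y)"
        proof (cases "y \<in> blk n")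
          case True
          then have y: "of_int n + 1 \<le> y" "y < of_int n + 2" by (auto simp: blk_def)
          have nm: "3 \<le> real_of_int n - real_of_int m \<or> real_of_int n - real_of_int m \<le> -3"
            using G(3)[OF n] by linarith
          then have "y \<notin> {t..t+2}" using y mt by auto
          then have h: "h t y = ennreal (\<bar>f y\<bar> powr p * \<rho> (y - t))" by (simp add: h_def)
          \<comment> \<open>From y in [n + 1, n + 2[ and t in [m, m + 1[ it follows that y - t
            exceeds n - m by an amount between 0 and 2, the range for which C was chosen.\<close>
          have "\<rho> (of_int (n - m)) \<le> C * \<rho> (of_int (n - m) + (y - t - of_int (n - m)))"
            using y mt by (intro C) auto
          then have "\<rho> (of_int (n - m)) * \<bar>f y\<bar> powr p \<le> C * \<rho> (y - t) * \<bar>f y\<bar> powr p"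
            by (intro mult_right_mono) auto
          then have "ennreal (\<rho> (of_int (n - m)) * \<bar>f y\<bar> powr p) \<le> ennreal (C * (\<bar>f y\<bar> powr p * \<rho> (y - t)))"
            by (intro ennreal_leI) (simp add: mult_ac)
          then show ?thesis using True C(1) by (simp add: h F_def ennreal_mult)
        qed simp
      qed
      also have "\<dots> = ennreal C * (\<integral>\<^sup>+y. h t y * indicator (blk n) y \<partial>lebesgue)"
        unfolding blk_def by (rule nn_integral_cmult[OF lmeas_block[OF h_meas]])
      finally show ?thesis .
    qed
    have "ennreal ((\<Sum>n\<in>G. \<rho> (of_int (n - m))) * c1) = (\<Sum>n\<in>G. ennreal (\<rho> (of_int (n - m))) * ennreal c1)"
      using c1 by (simp add: sum_distrib_right flip: ennreal_mult)
    also have "\<dots> \<le> (\<Sum>n\<in>G. ennreal C * (\<integral>\<^sup>+y. h t y * indicator (blk n) y \<partial>lebesgue))"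
      by (intro sum_mono blk)
    also have "\<dots> = ennreal C * (\<Sum>k\<in>(\<lambda>n. n + 1) ` G. \<integral>\<^sup>+y. h t y * indicator (block 1 k) y \<partial>lebesgue)"
      unfolding blk_def by (subst sum.reindex) (auto simp: inj_on_def sum_distrib_left)
    also have "\<dots> \<le> ennreal C * (\<integral>\<^sup>+y. h t y \<partial>lebesgue)"
      by (intro mult_left_mono nn_integral_blocks_ge h_meas) (use G in auto)
    also have "\<dots> \<le> ennreal C * ennreal (c1 * c)" by (intro mult_left_mono h_le t) auto
    also have "\<dots> = ennreal (C * c * c1)" using C c c1 by (simp add: mult_ac flip: ennreal_mult)
    finally have "(\<Sum>n\<in>G. \<rho> (of_int (n - m))) * c1 \<le> C * c * c1"
      using C c c1 by (subst (asm) ennreal_le_iff) auto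
    then show ?thesis using c1 by simp
  qed
  have "\<exists>S'. \<forall>Q. finite Q \<longrightarrow> (\<Sum>k\<in>Q. \<rho> (of_int k)) \<le> S'"
  proof (rule sum_bounded_if_difference_sums_bounded[OF \<delta>(1), of A])
    show "\<forall>\<^sub>F n in sequentially. \<delta> * real n \<le> real (card (initial A n))" using \<delta>(2) by (simp add: A_def)
    show "\<exists>C. \<forall>k. \<rho> (of_int k) \<le> C * \<rho> (of_int (k + int j))" for j
    proof -
      obtain C where "\<And>x t. 0 \<le> t \<Longrightarrow> t \<le> real j \<Longrightarrow> \<rho> x \<le> C * \<rho> (x + t)" using rho_growth[of "real j"] by metis
      from this[of "real j"] show ?thesis by (intro exI[of _ C]) auto
    qed
    fix m G assume m: "m \<in> A" and G: "finite G" "G \<subseteq> A"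
    have "(\<Sum>n\<in>G. \<rho> (of_int (n - m))) = (\<Sum>n\<in>{n\<in>G. 3 \<le> \<bar>n - m\<bar>}. \<rho> (of_int (n - m))) + (\<Sum>n\<in>{n\<in>G. \<not> 3 \<le> \<bar>n - m\<bar>}. \<rho> (of_int (n - m)))"
      using G(1) by (subst sum.union_disjoint[symmetric]) (auto intro!: sum.cong)
    also have "(\<Sum>n\<in>{n\<in>G. 3 \<le> \<bar>n - m\<bar>}. \<rho> (of_int (n - m))) \<le> C * c"
      using G by (intro far_sum m) auto
    also have "(\<Sum>n\<in>{n\<in>G. \<not> 3 \<le> \<bar>n - m\<bar>}. \<rho> (of_int (n - m))) = (\<Sum>j\<in>(\<lambda>n. n - m) ` {n\<in>G. \<not> 3 \<le> \<bar>n - m\<bar>}. \<rho> (of_int j))"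
      by (subst sum.reindex) (auto simp: inj_on_def)
    also have "\<dots> \<le> B" unfolding B_def by (rule sum_mono2) auto
    finally show "(\<Sum>n\<in>G. \<rho> (of_int (n - m))) \<le> C * c + B" by simp
  qed simp
  then obtain S' where "\<And>Q. finite Q \<Longrightarrow> (\<Sum>k\<in>Q. \<rho> (of_int k * 1)) \<le> S'" by auto
  then show ?thesis by (rule integral_finite_if_lattice_sums_bounded[OF zero_less_one])
qed

end

section \<open>The ruler sequence\<close>

text \<open>The exponent of 2 in \<open>n\<close>, with \<open>ruler 0 = 0\<close>. Every level is taken with positive density although
  the average of the levels is bounded.\<close>

fun ruler :: "nat \<Rightarrow> nat" where
  "ruler n = (if n = 0 \<or> odd n then 0 else Suc (ruler (n div 2)))"

declare ruler.simps [simp del]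

lemma ruler_simps:
  "ruler 0 = 0" "odd n \<Longrightarrow> ruler n = 0" "0 < n \<Longrightarrow> ruler (2 * n) = Suc (ruler n)"
  by (simp_all add: ruler.simps[of n] ruler.simps[of 0] ruler.simps[of "2 * n"])

lemma ruler_level: "ruler (2 ^ v * (2 * j + 1)) = v"
proof (induction v)
  case (Suc v)
  have "ruler (2 * (2 ^ v * (2 * j + 1))) = Suc (ruler (2 ^ v * (2 * j + 1)))" by (rule ruler_simps(3)) simp
  then show ?case using Suc by (simp add: mult.assoc)
qed (simp add: ruler_simps)

text \<open>Odd indices contribute 0, and a positive even index 2i contributes 1 plus the level of
  i.\<close>

lemma sum_ruler_double: "(\<Sum>i\<le>2 * n. ruler i) = n + (\<Sum>i\<le>n. ruler i)"
proof (induction n)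
  case (Suc n)
  have "ruler (Suc (2 * n)) = 0" "ruler (2 * Suc n) = Suc (ruler (Suc n))"
    by (rule ruler_simps, simp)+
  then show ?case using Suc by simp
qed (simp add: ruler_simps)

lemma sum_ruler_le: "(\<Sum>i\<le>n. ruler i) \<le> n"
proof (induction n rule: less_induct)
  case (less n)
  show ?case
  proof (cases "n = 0")
    case False
    define k where "k = n div 2"
    have k: "(\<Sum>i\<le>k. ruler i) \<le> k" using less[of k] False by (simp add: k_def)
    show ?thesis
    proof (cases "even n")
      case True
      then have "n = 2 * k" by (simp add: k_def)
      then show ?thesis using k sum_ruler_double[of k] by simp
    next
      case False
      then have n: "n = Suc (2 * k)" by (simp add: k_def)
      then have "(\<Sum>i\<le>n. ruler i) = (\<Sum>i\<le>2 * k. ruler i)" by (simp add: ruler_simps)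
      then show ?thesis using k n sum_ruler_double[of k] by simp
    qed
  qed (simp add: ruler_simps)
qed

text \<open>Piece n will have radius \<open>ruler n\<close> around \<open>position n\<close>. Twice
  the radii, instead of just the radii, keeps it at distance at least
  \<open>ruler n + ruler m\<close> from the centre of piece m, and this lets the factor H control
  its size there.\<close>

fun position :: "nat \<Rightarrow> nat" where
  "position 0 = 0"
| "position (Suc n) = position n + 1 + 2 * ruler n + 2 * ruler (Suc n)"

lemma position_gap: "m < n \<Longrightarrow> position m + 1 + 2 * ruler m + 2 * ruler n \<le> position n"
proof (induction n)
  case (Suc n)
  then show ?case by (cases "m = n") auto
qed simp

lemma position_gap_abs: "m \<noteq> n \<Longrightarrow> 1 + 2 * real (ruler m) + 2 * real (ruler n) \<le> \<bar>real (position n) - real (position m)\<bar>"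
  using position_gap[of m n] position_gap[of n m] by (cases "m < n") (auto simp: abs_if not_less)

lemma position_le: "position n \<le> 5 * n"
proof -
  \<comment> \<open>Each level enters the gaps before and after its index, twice each time, hence
    the factor 4. The term on the left prepares the second of these gaps and carries the
    induction.\<close>
  have "position n + 2 * ruler n \<le> n + 4 * (\<Sum>i\<le>n. ruler i)"
    by (induction n) (auto simp: ruler_simps)
  then show ?thesis using sum_ruler_le[of n] by simp
qed

text \<open>The intervals are disjoint, as the s j are at least 1 apart and \<eta> is at most 1, and
  about x / D of them lie in [0, x]. For x at least 2D the rounding loss of 1 is at most half,
  whence the bound \<eta> / (2D).\<close>

lemma lower_density_pos:
  fixes s :: "nat \<Rightarrow> real"
  assumes S: "S \<in> sets lebesgue" and \<eta>: "0 < \<eta>" "\<eta> \<le> 1" and D: "0 < D"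
    and s0: "\<And>j. 0 \<le> s j" and s: "\<And>i j. i < j \<Longrightarrow> s i + 1 \<le> s j" and le: "\<And>j. s j + 1 \<le> D * real (j + 1)"
    and sub: "\<And>j. {s j..<s j + \<eta>} \<subseteq> S"
  shows "0 < lower_density S"
proof -
  have bound: "\<eta> / (2 * D) \<le> measure lebesgue (S \<inter> {0..x}) / x" if x: "2 * D \<le> x" for x
  proof -
    define J where "J = nat \<lfloor>x / D\<rfloor>"
    have xD: "2 \<le> x / D" using x D by (simp add: field_simps)
    have J: "x / D - 1 \<le> real J" "real J \<le> x / D" using xD unfolding J_def by linarith+
    have s_le: "s j + \<eta> \<le> x" if "j < J" for j
    proof -
      have "s j + \<eta> \<le> D * real (j + 1)" using le[of j] \<eta>(2) by linarith
      also have "\<dots> \<le> D * real J" using that D by (intro mult_left_mono) auto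
      also have "\<dots> \<le> x" using J(2) D by (simp add: field_simps)
      finally show ?thesis .
    qed
    have "(\<Union>j<J. {s j..<s j + \<eta>}) \<subseteq> S \<inter> {0..x}"
    proof (intro UN_least Int_greatest sub)
      fix j assume "j \<in> {..<J}"
      then show "{s j..<s j + \<eta>} \<subseteq> {0..x}" using s_le[of j] s0[of j] by auto
    qed
    moreover have "(\<Union>j<J. {s j..<s j + \<eta>}) \<in> sets lebesgue" by auto
    moreover have "S \<inter> {0..x} \<in> lmeasurable" using fmeasurable_Int_fmeasurable[of "{0..x}" lebesgue S] S by (simp add: Int_commute)
    ultimately have "measure lebesgue (\<Union>j<J. {s j..<s j + \<eta>}) \<le> measure lebesgue (S \<inter> {0..x})"
      by (intro measure_mono_fmeasurable)
    moreover have "measure lebesgue (\<Union>j<J. {s j..<s j + \<eta>}) = (\<Sum>j<J. measure lebesgue {s j..<s j + \<eta>})"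
    proof (rule measure_finite_Union)
      show "disjoint_family_on (\<lambda>j. {s j..<s j + \<eta>}) {..<J}"
        unfolding disjoint_family_on_def
      proof (intro ballI impI)
        fix i j :: nat assume "i \<noteq> j"
        then show "{s i..<s i + \<eta>} \<inter> {s j..<s j + \<eta>} = {}"
          using s[of i j] s[of j i] \<eta>(2) by (cases "i < j") auto
      qed
    qed (use \<eta>(1) in auto)
    moreover have "(\<Sum>j<J. measure lebesgue {s j..<s j + \<eta>}) = \<eta> * real J" using \<eta> by simp
    moreover have "\<eta> * (x / (2 * D)) \<le> \<eta> * real J" using J(1) xD \<eta> by (intro mult_left_mono) auto
    ultimately have "\<eta> * (x / (2 * D)) \<le> measure lebesgue (S \<inter> {0..x})" by linarith
    then show ?thesis using x D by (simp add: field_simps)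
  qed
  have "ereal (\<eta> / (2 * D)) \<le> lower_density S"
    unfolding lower_density_def
  proof (rule Liminf_bounded)
    show "\<forall>\<^sub>F x in at_top. ereal (\<eta> / (2 * D)) \<le> ereal (measure lebesgue (S \<inter> {0..x}) / x)"
      using eventually_ge_at_top[of "2 * D"] by eventually_elim (simp add: bound)
  qed
  moreover have "0 < ereal (\<eta> / (2 * D))" using \<eta> D by simp
  ultimately show ?thesis by (rule less_le_trans[rotated])
qed

context weighted_Lp begin

text \<open>The empty set has lower density 0, so the orbit meets every ball.\<close>

lemma frequently_hypercyclic_imp_hypercyclic:
  assumes "frequently_hypercyclic X N translation"
  shows "hypercyclic X N translation"
proof -
  obtain u where u: "u \<in> X" and fh: "\<And>U. openin (norm_topology X N) U \<Longrightarrow> U \<noteq> {} \<Longrightarrow>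
      0 < lower_density {t. 0 \<le> t \<and> translation t u \<in> U}"
    using assms unfolding frequently_hypercyclic_def by blast
  have "dense_subset X N {translation t u |t. 0 \<le> t}"
    unfolding dense_subset_iff
  proof (intro conjI ballI allI impI)
    show "{translation t u |t. 0 \<le> t} \<subseteq> X" using translation_mem_X u by blast
    fix w and e :: real assume w: "w \<in> X" "0 < e"
    have "0 < lower_density {t. 0 \<le> t \<and> translation t u \<in> mball w e}"
      by (rule fh) (use w in \<open>auto simp: norm_topology_def\<close>)
    moreover have "lower_density {} = 0" by (simp add: lower_density_def Liminf_const zero_ereal_def[symmetric])
    ultimately have "{t. 0 \<le> t \<and> translation t u \<in> mball w e} \<noteq> {}" by (metis less_irrefl)
    then show "\<exists>a\<in>{translation t u |t. 0 \<le> t}. N (w - a) < e" by auto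
  qed
  then show ?thesis using u by (auto simp: hypercyclic_def)
qed

end

context finite_weighted_Lp begin

section \<open>A countable dense family and an unbounded integrable factor\<close>

lemma countable_dense_family:
  obtains g :: "nat \<Rightarrow> real \<Rightarrow> real" where "\<And>i. lmeas (g i)" "\<And>i. \<exists>B R. \<forall>x. \<bar>g i x\<bar> \<le> B \<and> (R < \<bar>x\<bar> \<longrightarrow> g i x = 0)"
    "\<And>u e. u \<in> X \<Longrightarrow> 0 < e \<Longrightarrow> \<exists>i. N (u - cls (g i)) < e"
proof -
  \<comment> \<open>Entry j of l is the value on the cell of length 1 / (n + 1) that starts at -n +
    j / (n + 1); the summand n * (n + 1) gives the cell at -n the number 0. Such pairs form a
    countable type, which \<open>from_nat\<close> enumerates.\<close>
  define step where "step = (\<lambda>(n::nat, l::rat list) x. let j = \<lfloor>real (n + 1) * x\<rfloor> + int (n * (n + 1)) in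
    if 0 \<le> j \<and> j < int (length l) then real_of_rat (l ! nat j) else 0)"
  have step_meas: "lmeas (step a)" for a
  proof -
    obtain n l where a: "a = (n, l)" by (cases a)
    define h where "h i = (let j = i + int (n * (n + 1)) in
      if 0 \<le> j \<and> j < int (length l) then real_of_rat (l ! nat j) else 0)" for i
    have floor: "(\<lambda>x. \<lfloor>real (n + 1) * x\<rfloor>) \<in> borel \<rightarrow>\<^sub>M count_space UNIV" by measurable
    have "lmeas (\<lambda>x. h \<lfloor>real (n + 1) * x\<rfloor>)"
      by (rule lmeas_borel[OF measurable_compose[OF floor]]) simp
    moreover have "step a = (\<lambda>x. h \<lfloor>real (n + 1) * x\<rfloor>)" by (simp add: step_def a h_def)
    ultimately show ?thesis by simp
  qed
  have step_bdd: "\<exists>B R. \<forall>x. \<bar>step a x\<bar> \<le> B \<and> (R < \<bar>x\<bar> \<longrightarrow> step a x = 0)" for a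
  proof -
    obtain n l where a: "a = (n, l)" by (cases a)
    define B where "B = (\<Sum>q\<in>set l. \<bar>real_of_rat q\<bar>)"
    define R where "R = real (n * (n + 1)) + real (length l)"
    have "\<bar>step a x\<bar> \<le> B \<and> (R < \<bar>x\<bar> \<longrightarrow> step a x = 0)" for x
    proof (cases "0 \<le> \<lfloor>real (n + 1) * x\<rfloor> + int (n * (n + 1)) \<and> \<lfloor>real (n + 1) * x\<rfloor> + int (n * (n + 1)) < int (length l)")
      case True
      define j where "j = \<lfloor>real (n + 1) * x\<rfloor> + int (n * (n + 1))"
      have "l ! nat j \<in> set l" using True by (intro nth_mem) (auto simp: j_def)
      then have "\<bar>real_of_rat (l ! nat j)\<bar> \<le> B" unfolding B_def by (intro member_le_sum) auto
      then have 1: "\<bar>step a x\<bar> \<le> B" using True by (simp add: step_def a j_def Let_def)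
      have "- real (n * (n + 1)) \<le> real (n + 1) * x" "real (n + 1) * x \<le> real (length l)"
        using True by linarith+
      then have "\<bar>real (n + 1) * x\<bar> \<le> R"
        unfolding R_def using of_nat_0_le_iff[of "n * (n + 1)"] by linarith
      then have "real (n + 1) * \<bar>x\<bar> \<le> R" by (simp add: abs_mult)
      moreover have "\<bar>x\<bar> \<le> real (n + 1) * \<bar>x\<bar>" by (simp add: distrib_right)
      ultimately show ?thesis using 1 by simp
    next
      case False
      then have "step a x = 0" unfolding step_def a Let_def by auto
      then show ?thesis by (simp add: B_def sum_nonneg)
    qed
    then show ?thesis by blast
  qed
  have dense: "\<exists>a. N (u - cls (step a)) < e" if u: "u \<in> X" and e: "0 < e" for u e
  proof -
    obtain f where f: "f \<in> Cc" "N (u - cls f) < e / 2" using Cc_dense[OF u, of "e / 2"] e by auto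
    obtain B and R :: nat where "0 < B" "\<And>x. \<bar>f x\<bar> \<le> B" and R: "\<And>x. real R < \<bar>x\<bar> \<Longrightarrow> f x = 0"
      using Cc_bounded[OF f(1)] by blast
    define \<eta> where "\<eta> = e / 4 / (W + 1)"
    have W1: "0 < W + 1" using W_nonneg by linarith
    have \<eta>: "0 < \<eta>" using e W1 by (simp add: \<eta>_def)
    obtain d where d: "0 < d" "\<And>x y. \<bar>x - y\<bar> < d \<Longrightarrow> \<bar>f x - f y\<bar> < \<eta>" using Cc_uniform[OF f(1) \<eta>] by blast
    obtain n0 :: nat where n0: "1 / real (Suc n0) < d" using d(1) by (metis reals_Archimedean inverse_eq_divide)
    \<comment> \<open>\<open>n0\<close> makes the mesh finer than d, and R + 1 puts the support of f
      inside the window [-n, n[.\<close>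
    define n where "n = max n0 (R + 1)"
    have n: "1 / real (n + 1) < d" "R < n"
    proof -
      have "1 / real (n + 1) \<le> 1 / real (Suc n0)" by (intro divide_left_mono) (auto simp: n_def)
      then show "1 / real (n + 1) < d" using n0 by linarith
    qed (simp add: n_def)
    have "\<exists>q. \<bar>f y - real_of_rat q\<bar> < \<eta>" for y
    proof -
      obtain q where "f y - \<eta> < real_of_rat q" "real_of_rat q < f y + \<eta>"
        using of_rat_dense[of "f y - \<eta>" "f y + \<eta>"] \<eta> by auto
      then have "\<bar>f y - real_of_rat q\<bar> < \<eta>" by linarith
      then show ?thesis ..
    qed
    then obtain q where q: "\<And>y. \<bar>f y - real_of_rat (q y)\<bar> < \<eta>" by metis
    define l where "l = map (\<lambda>j. q (of_int (int j - int (n * (n + 1))) / real (n + 1))) [0..<2 * (n * (n + 1))]"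
    have near: "\<bar>f x - step (n, l) x\<bar> \<le> 2 * \<eta>" for x
    proof -
      define j where "j = \<lfloor>real (n + 1) * x\<rfloor> + int (n * (n + 1))"
      show ?thesis
      proof (cases "0 \<le> j \<and> j < int (length l)")
        case True
        have "nat j < length l" using True by linarith
        moreover have "length l = 2 * (n * (n + 1))" by (simp add: l_def)
        ultimately have len: "nat j < 2 * (n * (n + 1))" by simp
        have "l ! nat j = q (of_int (int (nat j) - int (n * (n + 1))) / real (n + 1))"
          unfolding l_def using len by (subst nth_map) auto
        also have "int (nat j) - int (n * (n + 1)) = \<lfloor>real (n + 1) * x\<rfloor>" using True by (simp add: j_def)
        finally have "step (n, l) x = real_of_rat (q (of_int \<lfloor>real (n + 1) * x\<rfloor> / real (n + 1)))"
          using True by (simp add: step_def j_def Let_def)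
        moreover have "\<bar>f x - f (of_int \<lfloor>real (n + 1) * x\<rfloor> / real (n + 1))\<bar> < \<eta>"
          using floor_div_near[of "n + 1" x] n(1) by (intro d(2)) simp
        ultimately show ?thesis using q[of "of_int \<lfloor>real (n + 1) * x\<rfloor> / real (n + 1)"] by linarith
      next
        case False
        then have 0: "step (n, l) x = 0" unfolding step_def Let_def j_def by auto
        have "real n \<le> \<bar>x\<bar>"
        proof (rule ccontr)
          assume "\<not> real n \<le> \<bar>x\<bar>"
          then have x: "- real n \<le> x" "x < real n" by linarith+
          have real_eq: "real_of_int (int (n * (n + 1))) = real (n + 1) * real n" by (simp add: algebra_simps)
          from x have "real (n + 1) * (- real n) \<le> real (n + 1) * x" "real (n + 1) * x < real (n + 1) * real n"
            by (intro mult_left_mono mult_strict_left_mono; simp)+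
          then have "real_of_int (- int (n * (n + 1))) \<le> real (n + 1) * x" "real (n + 1) * x < real_of_int (int (n * (n + 1)))"
            by (simp_all only: of_int_minus real_eq mult_minus_right)
          then have "- int (n * (n + 1)) \<le> \<lfloor>real (n + 1) * x\<rfloor>" "\<lfloor>real (n + 1) * x\<rfloor> < int (n * (n + 1))"
            by (simp_all only: le_floor_iff floor_less_iff)
          then show False using False by (simp add: j_def l_def)
        qed
        then have "f x = 0" using n(2) by (intro R) simp
        then show ?thesis using 0 \<eta> by simp
      qed
    qed
    obtain B' R' where "\<And>x. \<bar>step (n, l) x\<bar> \<le> B'" using step_bdd by metis
    then have sX: "cls (step (n, l)) \<in> X" by (rule bounded_mem_X[OF step_meas])
    have "N (cls f - cls (step (n, l))) \<le> 2 * \<eta> * W"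
      unfolding cls_diff[OF Cc_lmeas[OF f(1)] step_meas]
      by (rule N_bounded_le[OF borel_measurable_diff[OF Cc_lmeas[OF f(1)] step_meas] near])
    also have "\<dots> \<le> 2 * \<eta> * (W + 1)" using \<eta> by (intro mult_left_mono) auto
    also have "\<dots> = 2 * (\<eta> * (W + 1))" by simp
    also have "\<eta> * (W + 1) = e / 4" unfolding \<eta>_def using W1 by (intro nonzero_eq_divide_eq[THEN iffD1]) auto
    also have "2 * (e / 4) = e / 2" by simp
    finally have "N (u - cls (step (n, l))) < e"
      using N_triangle_diff[OF u Cc_mem_X[OF f(1)] sX] f(2) by linarith
    then show ?thesis by blast
  qed
  show ?thesis
  proof
    show "lmeas (step (from_nat i))" for i by (rule step_meas)
    show "\<exists>B R. \<forall>x. \<bar>step (from_nat i) x\<bar> \<le> B \<and> (R < \<bar>x\<bar> \<longrightarrow> step (from_nat i) x = 0)" for i by (rule step_bdd)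
    show "\<exists>i. N (u - cls (step (from_nat i))) < e" if "u \<in> X" "0 < e" for u e
      using dense[OF that] by (metis from_nat_to_nat)
  qed
qed

text \<open>Let R j be so large that \<rho> has integral below 2^(-j) outside radius R j. The sum
  over j of the indicators of these outer regions is unbounded, while its integral against \<rho> is
  at most a geometric series. H is a truncated version that depends on the integer part of |x|
  only.\<close>

lemma unbounded_integrable_factor:
  obtains H :: "nat \<Rightarrow> real" where "\<And>n. 0 \<le> H n" "mono H" "\<And>K. \<exists>n. K \<le> H n"
    "integrable lebesgue (\<lambda>x. H (nat \<lfloor>\<bar>x\<bar>\<rfloor>) * \<rho> x)"
proof -
  let ?q = "\<lambda>n::nat. LINT x|lebesgue. \<rho> x * indicator (outside n) x"
  have q: "?q \<longlonglongrightarrow> 0" using integral_tail_tendsto_0[OF rho_integrable] by simp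
  have "\<exists>n\<ge>j. ?q n < (1/2) ^ j" for j
  proof -
    have "\<forall>\<^sub>F n in sequentially. ?q n < (1/2) ^ j \<and> j \<le> n"
      by (intro eventually_conj order_tendstoD(2)[OF q] eventually_ge_at_top) simp
    then show ?thesis using eventually_happens'[OF sequentially_bot] by blast
  qed
  then obtain R where R: "\<And>j. j \<le> R j" "\<And>j. ?q (R j) < (1/2) ^ j" by metis
  define H where "H n = (\<Sum>j\<le>n. of_bool (R j \<le> n) :: real)" for n
  show ?thesis
  proof
    show "0 \<le> H n" for n by (simp add: H_def sum_nonneg)
    show "mono H"
    proof (rule monoI)
      fix m n :: nat assume "m \<le> n"
      then have "H m \<le> (\<Sum>j\<le>m. of_bool (R j \<le> n))" unfolding H_def by (intro sum_mono) auto
      also have "\<dots> \<le> H n" unfolding H_def using \<open>m \<le> n\<close> by (intro sum_mono2) auto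
      finally show "H m \<le> H n" .
    qed
    show "\<exists>n. K \<le> H n" for K
    proof -
      obtain k :: nat where k: "K \<le> real k" using real_arch_simple by blast
      define n where "n = k + (\<Sum>j<k. R j)"
      have "R j \<le> n" if "j < k" for j
        using member_le_sum[of j "{..<k}" R] that by (simp add: n_def)
      then have "real k = (\<Sum>j<k. of_bool (R j \<le> n))" by simp
      also have "\<dots> \<le> H n" unfolding H_def by (intro sum_mono2) (auto simp: n_def)
      finally show ?thesis using k by (intro exI[of _ n]) simp
    qed
    have floor_eq: "R j \<le> nat \<lfloor>\<bar>x\<bar>\<rfloor> \<longleftrightarrow> real (R j) \<le> \<bar>x\<bar>" for j and x :: real
      by (simp add: le_nat_iff le_floor_iff)
    have meas_int: "integrable lebesgue (\<lambda>x. \<rho> x * indicator (outside n) x)" for n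
      using integrable_mult_indicator[OF outside_measurable rho_integrable] by (simp add: mult.commute)
    have floor_meas: "(\<lambda>x::real. nat \<lfloor>\<bar>x\<bar>\<rfloor>) \<in> borel \<rightarrow>\<^sub>M count_space UNIV" by measurable
    have H_meas: "lmeas (\<lambda>x. H (nat \<lfloor>\<bar>x\<bar>\<rfloor>))"
      by (rule lmeas_borel[OF measurable_compose[OF floor_meas]]) simp
    have "(\<integral>\<^sup>+x. ennreal (H (nat \<lfloor>\<bar>x\<bar>\<rfloor>) * \<rho> x) \<partial>lebesgue) \<le> (\<integral>\<^sup>+x. (\<Sum>j. ennreal (\<rho> x * indicator (outside (R j)) x)) \<partial>lebesgue)"
    proof (rule nn_integral_mono)
      fix x :: real
      have "ennreal (H (nat \<lfloor>\<bar>x\<bar>\<rfloor>) * \<rho> x) = (\<Sum>j\<le>nat \<lfloor>\<bar>x\<bar>\<rfloor>. ennreal (\<rho> x * indicator (outside (R j)) x))"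
        unfolding H_def sum_distrib_right floor_eq by (subst sum_ennreal) (auto simp: indicator_def intro!: sum.cong)
      also have "\<dots> \<le> (\<Sum>j. ennreal (\<rho> x * indicator (outside (R j)) x))"
        by (intro sum_le_suminf summableI) auto
      finally show "ennreal (H (nat \<lfloor>\<bar>x\<bar>\<rfloor>) * \<rho> x) \<le> \<dots>" .
    qed
    also have "\<dots> = (\<Sum>j. \<integral>\<^sup>+x. ennreal (\<rho> x * indicator (outside (R j)) x) \<partial>lebesgue)"
      by (intro nn_integral_suminf measurable_compose[OF borel_measurable_integrable[OF meas_int] measurable_ennreal])
    also have "\<dots> = (\<Sum>j. ennreal (?q (R j)))"
      by (intro suminf_cong nn_integral_eq_integral meas_int) auto
    also have "\<dots> \<le> (\<Sum>j. ennreal ((1/2) ^ j))"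
      by (intro suminf_le summableI ennreal_leI less_imp_le R)
    also have "\<dots> = ennreal (\<Sum>j. (1/2) ^ j)" by (intro suminf_ennreal2) (auto intro: summable_geometric)
    finally have "(\<integral>\<^sup>+x. ennreal (H (nat \<lfloor>\<bar>x\<bar>\<rfloor>) * \<rho> x) \<partial>lebesgue) < \<infinity>" by (simp add: le_less_trans)
    moreover have "0 \<le> H n" for n by (simp add: H_def sum_nonneg)
    ultimately show "integrable lebesgue (\<lambda>x. H (nat \<lfloor>\<bar>x\<bar>\<rfloor>) * \<rho> x)"
      by (intro integrableI_bounded borel_measurable_times H_meas rho_meas) (simp add: abs_mult)
  qed
qed

section \<open>A frequently hypercyclic function\<close>

lemma frequently_hypercyclic_holds: "frequently_hypercyclic X N translation"
proof -
  obtain e :: "nat \<Rightarrow> real \<Rightarrow> real" where e_meas: "\<And>i. lmeas (e i)"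
    and e_bdd: "\<And>i. \<exists>B R. \<forall>x. \<bar>e i x\<bar> \<le> B \<and> (R < \<bar>x\<bar> \<longrightarrow> e i x = 0)"
    and e_dense: "\<And>u d. u \<in> X \<Longrightarrow> 0 < d \<Longrightarrow> \<exists>i. N (u - cls (e i)) < d"
    using countable_dense_family by blast
  obtain H :: "nat \<Rightarrow> real" where H: "\<And>n. 0 \<le> H n" "mono H" "\<And>K. \<exists>n. K \<le> H n"
    and H_int: "integrable lebesgue (\<lambda>x. H (nat \<lfloor>\<bar>x\<bar>\<rfloor>) * \<rho> x)"
    using unbounded_integrable_factor by blast
  define fits where "fits v i \<longleftrightarrow> (\<forall>x. \<bar>e i x\<bar> powr p \<le> H v \<and> (real v < \<bar>x\<bar> \<longrightarrow> e i x = 0))" for v i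
  \<comment> \<open>The first component of \<open>prod_decode v\<close> takes every value for
    infinitely many v, so each \<open>e i\<close> is tried at arbitrarily high levels. At levels too
    low to accommodate it, 0 stands in for it.\<close>
  define g where "g v = (if fits v (fst (prod_decode v)) then e (fst (prod_decode v)) else (\<lambda>_. 0))" for v
  have g_meas: "lmeas (g v)" for v by (simp add: g_def e_meas)
  have g_le: "\<bar>g v x\<bar> powr p \<le> H v" for v x using H(1) p_pos by (auto simp: g_def fits_def)
  have g_supp: "real v < \<bar>x\<bar> \<Longrightarrow> g v x = 0" for v x by (auto simp: g_def fits_def)
  have e_X: "cls (e i) \<in> X" for i
  proof -
    obtain B R where "\<And>x. \<bar>e i x\<bar> \<le> B" using e_bdd by metis
    then show ?thesis by (rule bounded_mem_X[OF e_meas])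
  qed
  have g_X: "cls (g v) \<in> X" for v
    using e_X cls_zero zero_mem_X by (simp add: g_def)
  have g_hits: "\<exists>v\<ge>n. g v = e i" for n i
  proof -
    obtain B R where BR: "\<And>x. \<bar>e i x\<bar> \<le> B" "\<And>x. R < \<bar>x\<bar> \<Longrightarrow> e i x = 0" using e_bdd by metis
    obtain a where a: "B powr p \<le> H a" using H(3) by blast
    obtain b :: nat where b: "R \<le> real b" using real_arch_simple by blast
    define v where "v = prod_encode (i, n + a + b)"
    have v: "n + a + b \<le> v" unfolding v_def by (rule le_prod_encode_2)
    have "fits v i"
      unfolding fits_def
    proof (intro allI conjI impI)
      fix x
      have "\<bar>e i x\<bar> powr p \<le> B powr p" using BR(1)[of x] p_pos by (intro powr_mono2) auto
      also have "\<dots> \<le> H v" using a monoD[OF H(2), of a v] v by simp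
      finally show "\<bar>e i x\<bar> powr p \<le> H v" .
      assume "real v < \<bar>x\<bar>"
      then show "e i x = 0" using b v by (intro BR(2)) simp
    qed
    then have "g v = e i" by (simp add: g_def v_def)
    then show ?thesis using v by (intro exI[of _ v]) simp
  qed
  \<comment> \<open>The supports of the pieces are disjoint, so at each point at most one term of
    the series is nonzero.\<close>
  define f where "f x = (\<Sum>n. g (ruler n) (x - real (position n)))" for x
  have near: "\<bar>x - real (position n)\<bar> \<le> real (ruler n)" if "g (ruler n) (x - real (position n)) \<noteq> 0" for n x
    using g_supp[of "ruler n" "x - real (position n)"] that by force
  have unique: "g (ruler m) (x - real (position m)) = 0"
    if "g (ruler n) (x - real (position n)) \<noteq> 0" "m \<noteq> n" for m n x
  proof (rule ccontr)
    assume "\<not> ?thesis"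
    then show False using near[of m x] near[OF that(1)] position_gap_abs[OF that(2)] by linarith
  qed
  have f_eq: "f x = g (ruler n) (x - real (position n))" if "g (ruler n) (x - real (position n)) \<noteq> 0" for n x
    unfolding f_def using unique[OF that] by (subst suminf_finite[of "{n}"]) auto
  have f_0: "f x = 0" if "\<And>n. g (ruler n) (x - real (position n)) = 0" for x
    by (simp add: f_def that)
  have sh_meas: "lmeas (\<lambda>x. g v (x - c))" for v c
    using lmeas_shift[OF g_meas, of v "-c"] by simp
  have f_meas: "lmeas f"
    unfolding f_def[abs_def] by (intro borel_measurable_suminf sh_meas)
  define Q where "Q n = (LINT x|lebesgue. H (nat \<lfloor>\<bar>x\<bar>\<rfloor>) * \<rho> x * indicator (outside n) x)" for n
  have Q_lim: "Q \<longlonglongrightarrow> 0"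
    using integral_tail_tendsto_0[OF H_int] H(1) by (simp add: Q_def[abs_def] abs_mult)
  have Q_nonneg: "0 \<le> Q n" for n unfolding Q_def by (intro Bochner_Integration.integral_nonneg) (simp add: H(1))
  have F_meas: "lmeas (\<lambda>x. f (x + real (position m)) - g (ruler m) x)" for m
    by (intro borel_measurable_diff lmeas_shift f_meas g_meas)
  \<comment> \<open>At time \<open>position m\<close> piece m sits at the origin and cancels against
    \<open>g (ruler m)\<close>. Any other piece n lives where |x| is at least both
    \<open>ruler n\<close> and \<open>ruler m\<close>: the first makes its p-th power at most H at
    |x|, the second confines the error to \<open>outside (ruler m)\<close>.\<close>
  have F_mass: "mass (\<lambda>x. f (x + real (position m)) - g (ruler m) x) \<le> ennreal (Q (ruler m))" for m
  proof -
    have int: "integrable lebesgue (\<lambda>x. H (nat \<lfloor>\<bar>x\<bar>\<rfloor>) * \<rho> x * indicator (outside (ruler m)) x)"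
      using integrable_mult_indicator[OF outside_measurable H_int] by (simp add: mult.commute)
    have "\<bar>f (x + real (position m)) - g (ruler m) x\<bar> powr p \<le> H (nat \<lfloor>\<bar>x\<bar>\<rfloor>) * indicator (outside (ruler m)) x" for x
    proof (cases "f (x + real (position m)) - g (ruler m) x = 0")
      case True
      then show ?thesis using H(1) p_pos by simp
    next
      case False
      let ?x = "x + real (position m)"
      obtain n where n: "g (ruler n) (?x - real (position n)) \<noteq> 0"
        using False f_0[of ?x] by (metis add_diff_cancel_right' diff_self)
      have "n \<noteq> m"
      proof
        assume "n = m"
        then show False using False f_eq[OF n] by simp
      qed
      then have "g (ruler m) x = 0" using unique[OF n, of m] by simp
      then have eq: "f ?x - g (ruler m) x = g (ruler n) (?x - real (position n))" using f_eq[OF n] by simp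
      have "real (ruler n) + real (ruler m) \<le> \<bar>x\<bar>"
        using near[OF n] position_gap_abs[OF \<open>n \<noteq> m\<close>] by linarith
      then have x: "real (ruler m) \<le> \<bar>x\<bar>" "real (ruler n) \<le> \<bar>x\<bar>" by linarith+
      have "ruler n \<le> nat \<lfloor>\<bar>x\<bar>\<rfloor>" using x(2) by (simp add: le_nat_iff le_floor_iff)
      then have "H (ruler n) \<le> H (nat \<lfloor>\<bar>x\<bar>\<rfloor>)" by (rule monoD[OF H(2)])
      then show ?thesis unfolding eq using g_le[of "ruler n" "?x - real (position n)"] x(1) by simp
    qed
    then have le: "\<bar>f (x + real (position m)) - g (ruler m) x\<bar> powr p * \<rho> x \<le> H (nat \<lfloor>\<bar>x\<bar>\<rfloor>) * \<rho> x * indicator (outside (ruler m)) x" for x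
      using mult_right_mono[of "\<bar>f (x + real (position m)) - g (ruler m) x\<bar> powr p" "H (nat \<lfloor>\<bar>x\<bar>\<rfloor>) * indicator (outside (ruler m)) x" "\<rho> x"]
      by (simp add: mult_ac)
    have "mass (\<lambda>x. f (x + real (position m)) - g (ruler m) x) \<le> (\<integral>\<^sup>+x. ennreal (H (nat \<lfloor>\<bar>x\<bar>\<rfloor>) * \<rho> x * indicator (outside (ruler m)) x) \<partial>lebesgue)"
      unfolding mass_def by (intro nn_integral_mono ennreal_leI le)
    also have "\<dots> = ennreal (Q (ruler m))"
      unfolding Q_def by (rule nn_integral_eq_integral[OF int]) (simp add: H(1))
    finally show ?thesis .
  qed
  define u where "u = cls f"
  have uX: "u \<in> X"
  proof -
    \<comment> \<open>For index 0 position and level are 0, so the error is \<open>f - g 0\<close>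
      and its bound already puts f into X.\<close>
    have "cls (\<lambda>x. f (x + real (position 0)) - g (ruler 0) x) \<in> X"
      by (rule mem_X_I[OF F_meas F_mass])
    then have "cls f - cls (g 0) \<in> X" by (simp add: ruler_simps cls_diff f_meas g_meas)
    then show ?thesis using N_triangle(1)[OF _ g_X[of 0]] by (metis diff_add_cancel u_def)
  qed
  have orbit: "N (translation (real (position m)) u - cls (g (ruler m))) \<le> Q (ruler m) powr (1 / p)" for m
  proof -
    have "translation (real (position m)) u - cls (g (ruler m)) = cls (\<lambda>x. f (x + real (position m)) - g (ruler m) x)"
      unfolding u_def translation_cls[OF f_meas] by (intro cls_diff lmeas_shift f_meas g_meas)
    also have "N \<dots> \<le> Q (ruler m) powr (1 / p)"
      using F_mass[of m] Q_nonneg[of "ruler m"] p_pos by (intro N_leI[OF F_meas]) (auto simp: powr_powr)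
    finally show ?thesis .
  qed
  have "0 < lower_density {t. 0 \<le> t \<and> translation t u \<in> U}"
    if U: "openin (norm_topology X N) U" "U \<noteq> {}" for U
  proof -
    define S where "S = {t. 0 \<le> t \<and> translation t u \<in> U}"
    \<comment> \<open>Measurability matters, as \<open>measure\<close> is 0 on non-measurable sets.
      Strong continuity makes S relatively open in the half-line.\<close>
    have "S \<in> sets lebesgue"
    proof -
      have "openin (top_of_set {0..}) S"
        unfolding openin_contains_ball
      proof (intro conjI ballI)
        fix t assume t: "t \<in> S"
        then obtain d where d: "0 < d" "\<And>v. v \<in> X \<Longrightarrow> N (translation t u - v) < d \<Longrightarrow> v \<in> U"
          using U(1) unfolding openin_norm_iff S_def by blast
        obtain r where r: "0 < r" "\<And>s. 0 \<le> s \<Longrightarrow> \<bar>s - t\<bar> < r \<Longrightarrow> N (translation s u - translation t u) < d"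
          using translation_strongly_continuous[OF uX d(1), of t] t by (auto simp: S_def)
        have "ball t r \<inter> {0..} \<subseteq> S"
        proof
          fix s assume s: "s \<in> ball t r \<inter> {0..}"
          then have "N (translation t u - translation s u) < d"
            using r(2)[of s] N_minus_commute[of "translation t u"] by (auto simp: dist_real_def abs_minus_commute)
          then show "s \<in> S" using s d(2) translation_mem_X[OF _ uX] by (simp add: S_def)
        qed
        then show "\<exists>r>0. ball t r \<inter> {0..} \<subseteq> S" using r(1) by blast
      qed (auto simp: S_def)
      then obtain O' where "open O'" "S = {0..} \<inter> O'" by (auto simp: openin_open)
      then show ?thesis by (auto intro: sets_completionI_sets)
    qed
    obtain w d where w: "w \<in> X" "0 < d" "\<And>v. v \<in> X \<Longrightarrow> N (w - v) < d \<Longrightarrow> v \<in> U"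
      using U unfolding openin_norm_iff by blast
    obtain C where C: "1 \<le> C" "\<And>s v. 0 \<le> s \<Longrightarrow> s \<le> 1 \<Longrightarrow> v \<in> X \<Longrightarrow> translation s v \<in> X \<and> N (translation s v) \<le> C * N v"
      using translation_bound[of 1] by metis
    obtain i where i: "N (w - cls (e i)) < d / 4" using e_dense[OF w(1), of "d / 4"] w(2) by auto
    obtain r where r: "0 < r" "\<And>s. 0 \<le> s \<Longrightarrow> s < r \<Longrightarrow> N (translation s (cls (e i)) - cls (e i)) < d / 4"
      using translation_strongly_continuous[OF e_X[of i], of "d / 4" 0] w(2) by auto
    have "(\<lambda>n. C * Q n powr (1 / p)) \<longlonglongrightarrow> C * 0 powr (1 / p)"
      using p_pos Q_nonneg by (intro tendsto_mult_left tendsto_powr' Q_lim) auto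
    then have "\<forall>\<^sub>F n in sequentially. C * Q n powr (1 / p) < d / 4"
      using w(2) by (intro order_tendstoD(2)) auto
    then obtain n0 where n0: "\<And>n. n0 \<le> n \<Longrightarrow> C * Q n powr (1 / p) < d / 4" by (auto simp: eventually_sequentially)
    obtain v where v: "n0 \<le> v" "g v = e i" using g_hits by blast
    \<comment> \<open>The positive indices of level v. Consecutive ones differ by 2^(v + 1), which
      is why the times of this level have positive density.\<close>
    define k where "k j = 2 ^ v * (2 * j + 1)" for j :: nat
    have ruler_k: "ruler (k j) = v" for j unfolding k_def by (rule ruler_level)
    have hit: "real (position (k j)) + s \<in> S" if s: "0 \<le> s" "s < min r 1" for j s
    proof -
      let ?T = "translation (real (position (k j))) u"
      have TX: "?T \<in> X" by (rule translation_mem_X[OF _ uX]) simp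
      have TsX: "translation s ?T \<in> X" "translation s (cls (e i)) \<in> X"
        using s by (auto intro!: translation_mem_X TX e_X)
      have "N (translation s (cls (e i)) - translation s ?T) = N (translation s (?T - cls (e i)))"
        by (simp add: translation_diff N_minus_commute)
      also have "\<dots> \<le> C * N (?T - cls (e i))"
        using C(2)[OF _ _ diff_mem_X[OF TX e_X]] s by simp
      also have "\<dots> \<le> C * Q v powr (1 / p)"
        using orbit[of "k j"] C(1) by (intro mult_left_mono) (auto simp: ruler_k v(2))
      also have "\<dots> < d / 4" by (rule n0[OF v(1)])
      finally have 1: "N (translation s (cls (e i)) - translation s ?T) < d / 4" .
      have 2: "N (cls (e i) - translation s (cls (e i))) < d / 4"
        using r(2)[of s] s N_minus_commute[of "cls (e i)"] by simp
      have "N (cls (e i) - translation s ?T) \<le> N (cls (e i) - translation s (cls (e i))) + N (translation s (cls (e i)) - translation s ?T)"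
        by (rule N_triangle_diff[OF e_X TsX(2) TsX(1)])
      moreover have "N (w - translation s ?T) \<le> N (w - cls (e i)) + N (cls (e i) - translation s ?T)"
        by (rule N_triangle_diff[OF w(1) e_X TsX(1)])
      ultimately have "N (w - translation s ?T) < d" using 1 2 i w(2) by linarith
      then have "translation s ?T \<in> U" by (rule w(3)[OF TsX(1)])
      then show ?thesis using s by (simp add: S_def translation_add add.commute)
    qed
    \<comment> \<open>By \<open>position_le\<close>, \<open>position (k j) + 1\<close> is at most
      \<open>5 * k j + 2 ^ v\<close>, that is \<open>2 ^ v * (10 * j + 6)\<close>; this explains D.
      The length min r 1 respects both the continuity radius r at time 0 and the range of times for
      which C was obtained.\<close>
    have "0 < lower_density S"
    proof (rule lower_density_pos[OF \<open>S \<in> sets lebesgue\<close>, where \<eta> = "min r 1" and D = "10 * 2 ^ v" and s = "\<lambda>j. real (position (k j))"])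
      show "real (position (k i)) + 1 \<le> real (position (k j))" if "i < j" for i j
      proof -
        have "k i < k j" using that by (simp add: k_def)
        from position_gap[OF this] show ?thesis by linarith
      qed
      show "real (position (k j)) + 1 \<le> 10 * 2 ^ v * real (j + 1)" for j
      proof -
        have "position (k j) + 1 \<le> 5 * k j + 2 ^ v" using position_le[of "k j"] one_le_power[of "2::nat" v] by linarith
        also have "\<dots> \<le> 10 * 2 ^ v * (j + 1)" by (simp add: k_def algebra_simps)
        finally have "real (position (k j) + 1) \<le> real (10 * 2 ^ v * (j + 1))" by (simp only: of_nat_le_iff)
        then show ?thesis by (simp add: algebra_simps)
      qed
      show "{real (position (k j))..<real (position (k j)) + min r 1} \<subseteq> S" for j
      proof
        fix t assume "t \<in> {real (position (k j))..<real (position (k j)) + min r 1}"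
        then have "0 \<le> t - real (position (k j))" "t - real (position (k j)) < min r 1" by auto
        from hit[OF this, of j] show "t \<in> S" by simp
      qed
    qed (use r(1) in auto)
    then show ?thesis by (simp add: S_def)
  qed
  then show ?thesis using uX unfolding frequently_hypercyclic_def by blast
qed

end

theorem theorem3p9:
  fixes p :: real and \<rho> :: "real \<Rightarrow> real"
  assumes "1 \<le> p"
    and "admissible_weight \<rho>"
  shows
    "(frequently_hypercyclic (Lp p \<rho>) (Lp_norm p \<rho>) translation
        \<longleftrightarrow> (\<lambda>k::int. \<rho> (of_int k)) summable_on UNIV) \<and>
     ((\<lambda>k::int. \<rho> (of_int k)) summable_on UNIV
        \<longleftrightarrow> (\<integral>\<^sup>+ t. ennreal (\<rho> t) \<partial>lebesgue) < \<infinity>) \<and>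
     ((\<integral>\<^sup>+ t. ennreal (\<rho> t) \<partial>lebesgue) < \<infinity>
        \<longleftrightarrow> chaotic (Lp p \<rho>) (Lp_norm p \<rho>) translation) \<and>
     (chaotic (Lp p \<rho>) (Lp_norm p \<rho>) translation
        \<longleftrightarrow> frequent_hypercyclicity_criterion (Lp p \<rho>) (Lp_norm p \<rho>) translation)"
proof -
  interpret weighted_Lp p \<rho> by unfold_locales (fact assms)+
  \<comment> \<open>Finiteness of the integral is the hub: it implies each of the other assertions
    and is implied by each of them.\<close>
  have sufficient: "frequently_hypercyclic X N translation \<and> chaotic X N translation \<and>
      frequent_hypercyclicity_criterion X N translation"
    if "(\<integral>\<^sup>+ t. ennreal (\<rho> t) \<partial>lebesgue) < \<infinity>"
  proof -
    interpret finite_weighted_Lp p \<rho> by unfold_locales (fact that)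
    show ?thesis
      using frequently_hypercyclic_holds frequently_hypercyclic_imp_hypercyclic periodic_points_dense criterion_holds
      by (simp add: chaotic_def)
  qed
  then show ?thesis
    using summable_iff_integral_finite frequently_hypercyclic_imp_integral_finite
      chaotic_imp_integral_finite criterion_imp_integral_finite by blast
qed

end
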